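(* In the instrumental-variable setting described in the context, suppose the following conditions hold. (a) (Regularity) For $a=0,1$, $\mathbb E[|Y(a)|^q]\le C_q$ for some $q\ge4$. (b) (Boundedness) There is $\varepsilon>0$ such that $e_0(X)\in[\varepsilon,1-\varepsilon]$ a.s., and $\|g_{a,0}\|_q=O(1)$ for $a\in\{t,c\}$. (c) (Identification) $\mathbb E[m_{t,0}(X)-m_{c,0}(X)]\ge c$ for a constant $c>0$. (d) (Strong consistency) $\|\hat\eta-\eta_0\|_2\to0$ a.s., $\hat\eta\to\eta_0$ almost surely, and $\|\hat\eta-\eta_0\|_\infty=O(1)$. (e) (Rate) $$\|\hat e-e_0\|_2\left(\sum_{a\in\{t,c\}}\|\hat g_a-g_{a,0}\|_2+\sum_{a\in\{t,c\}}\|\hat m_a-m_{a,0}\|_2\right)=o\left(\left[\frac{\log\log n}{n}\right]^{1/2}\right).$$ Let $\hat\sigma^2=\frac1n\sum_{k=1}^K\sum_{i\in I_k}\psi(W_i;\hat\theta,\hat\eta)^2$. Then for any $\rho>0$, $$\hat\theta\pm\hat\sigma\sqrt{\frac{2n\rho^2+1}{n^2\rho^2}\log\frac{n\rho^2+1}{\alpha}}$$ constitutes a $(1-\alpha)$ asymptotic confidence sequence for $\theta_0$.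
   Context: All $O(\cdot)$ and $o(\cdot)$ are in the almost sure sense. Norms $\|\cdot\|_p$ of functions of $X$ are $L_p$ norms under the law of $X$. $\alpha\in(0,1)$, and $C_q<\infty$ is a constant. Asymptotic confidence sequence: intervals $\{[\tilde L_n,\tilde U_n]\}_{n\ge1}$ form a $(1-\alpha)$ asymptotic confidence sequence for a real parameter $\vartheta$ if there is a (possibly unknown) sequence $\{[L_n^\star,U_n^\star]\}_{n\ge1}$ with $\mathbb P(\forall n\ge1,\ \vartheta\in[L_n^\star,U_n^\star])\ge1-\alpha$ and $L_n^\star/\tilde L_n\to1$, $U_n^\star/\tilde U_n\to1$ almost surely. Setting. The data $W_i=(Y_i,A_i,Z_i,X_i)$, $i\ge1$, are i.i.d. copies of $W=(Y,A,Z,X)$, with outcome $Y$, binary treatment $A$, binary instrument $Z$, measured covariates $X$, and a possible unmeasured confounder $U$. $Y(a)$ is the potential outcome under $A=a$, $Y=Y(A)$, and $A(z)$ is the potential treatment under $Z=z$. Standing assumptions: $(Y(0),Y(1))$ is independent of $A$ given $(X,U)$; $Z$ is independent of $Y$ given $(A,U,X)$; $Z$ is independent of $U$ given $X$; $Z$ is not independent of $A$ given $X$; and $A(1)\ge A(0)$ (monotonicity). The target is the local average treatment effect $\theta_0=\mathbb E[Y(1)-Y(0)\mid A(1)>A(0)]$, identified as $$\theta_0=\frac{\mathbb E\big[\mathbb E[Y\mid Z=1,X]-\mathbb E[Y\mid Z=0,X]\big]}{\mathbb E\big[\mathbb E[A\mid Z=1,X]-\mathbb E[A\mid Z=0,X]\big]}.$$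 The true nuisance is $\eta_0=(g_{t,0},g_{c,0},m_{t,0},m_{c,0},e_0)$ with $g_{t,0}(X)=\mathbb E[Y\mid Z=1,X]$, $g_{c,0}(X)=\mathbb E[Y\mid Z=0,X]$, $m_{t,0}(X)=\mathbb E[A\mid Z=1,X]$, $m_{c,0}(X)=\mathbb E[A\mid Z=0,X]$, $e_0(X)=\mathbb E[Z\mid X]$. For $\eta=(g_t,g_c,m_t,m_c,e)$ let $$\psi(W;\theta,\eta)=g_t(X)-g_c(X)+\frac{Z(Y-g_t(X))}{e(X)}-\frac{(1-Z)(Y-g_c(X))}{1-e(X)}-\theta\left[m_t(X)-m_c(X)+\frac{Z(A-m_t(X))}{e(X)}-\frac{(1-Z)(A-m_c(X))}{1-e(X)}\right].$$ Estimator. $\{I_k\}_{k=1}^K$ is a $K$-fold random partition of $\{1,\dots,n\}$ with $|I_k|/n\to1/K$ a.s. A split-sample scheme is used: the nuisance parameters are estimated from one part of the sample ($\{W_i\}_{i\in I_1^c}$), giving $\hat\eta=(\hat g_t,\hat g_c,\hat m_t,\hat m_c,\hat e)$, and $\hat\theta$ is the solution $\theta$ obtained by equating to $0$ the empirical average of $\psi(W;\theta,\hat\eta)$ over the remaining part of the sample ($\{W_i\}_{i\in I_1}$).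
   Formalization: Adds that the score at the true parameters has nonzero variance and that the estimated propensity is eventually bounded away from 0 and 1, without which the claim fails; folds are given by labels assigned once on arrival, independently of the data. *)

theory Defs
  imports "HOL-Probability.Probability" "HOL-Library.Landau_Symbols"
begin

definition Lp_norm :: "'x measure \<Rightarrow> real \<Rightarrow> ('x \<Rightarrow> 'b::real_normed_vector) \<Rightarrow> ennreal" where
  "Lp_norm N p f =
     (let I = \<integral>\<^sup>+ x. ennreal (norm (f x) powr p) \<partial>N
      in if I = \<infinity> then \<infinity> else ennreal (enn2real I powr (1 / p)))"

definition Linf_norm :: "'x measure \<Rightarrow> ('x \<Rightarrow> 'b::real_normed_vector) \<Rightarrow> ennreal" where
  "Linf_norm N f = esssup N (\<lambda>x. ennreal (norm (f x)))"

definition sigma_gen :: "'w measure \<Rightarrow> 'c measure \<Rightarrow> ('w \<Rightarrow> 'c) \<Rightarrow> 'w measure" where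
  "sigma_gen M N C = vimage_algebra (space M) C N"

definition cond_indep ::
  "'w measure \<Rightarrow> 'a measure \<Rightarrow> ('w \<Rightarrow> 'a) \<Rightarrow> 'b measure \<Rightarrow> ('w \<Rightarrow> 'b) \<Rightarrow> 'c measure \<Rightarrow> ('w \<Rightarrow> 'c) \<Rightarrow> bool"
where
  "cond_indep M NV V NT T NC C \<longleftrightarrow>
     (\<forall>B\<in>sets NV. \<forall>D\<in>sets NT. AE \<omega> in M.
        real_cond_exp M (sigma_gen M NC C) (\<lambda>\<omega>. indicator B (V \<omega>) * indicator D (T \<omega>)) \<omega> =
        real_cond_exp M (sigma_gen M NC C) (\<lambda>\<omega>. indicator B (V \<omega>)) \<omega> *
        real_cond_exp M (sigma_gen M NC C) (\<lambda>\<omega>. indicator D (T \<omega>)) \<omega>)"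

text \<open>The ratio of the endpoints tending to one is the library relation of asymptotic equivalence;
  it differs from the limit of the bare quotient only in reading \<open>0 / 0\<close> as one.\<close>

definition asymptotic_confseq ::
  "'w measure \<Rightarrow> real \<Rightarrow> real \<Rightarrow> (nat \<Rightarrow> 'w \<Rightarrow> real) \<Rightarrow> (nat \<Rightarrow> 'w \<Rightarrow> real) \<Rightarrow> bool"
where
  "asymptotic_confseq M \<alpha> \<theta> L U \<longleftrightarrow>
     (\<exists>Ls Us.
        (\<forall>n\<ge>1. Ls n \<in> borel_measurable M \<and> Us n \<in> borel_measurable M) \<and>
        measure M {\<omega> \<in> space M. \<forall>n\<ge>1. \<theta> \<in> {Ls n \<omega> .. Us n \<omega>}} \<ge> 1 - \<alpha> \<and>
        (AE \<omega> in M. (\<lambda>n. Ls n \<omega>) \<sim>[sequentially] (\<lambda>n. L n \<omega>)) \<and>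
        (AE \<omega> in M. (\<lambda>n. Us n \<omega>) \<sim>[sequentially] (\<lambda>n. U n \<omega>)))"

text \<open>An observation is \<open>(y, a, z, x)\<close>; \<open>True\<close> stands for the value 1 of a binary variable.\<close>

type_synonym 'x obs = "real \<times> bool \<times> bool \<times> 'x"

definition obs_space :: "'x measure \<Rightarrow> 'x obs measure" where
  "obs_space MX = borel \<Otimes>\<^sub>M (count_space UNIV \<Otimes>\<^sub>M (count_space UNIV \<Otimes>\<^sub>M MX))"

text \<open>A nuisance \<open>(g\<^sub>t, g\<^sub>c, m\<^sub>t, m\<^sub>c, e)\<close> is one vector-valued function, so that the norm of a
  difference of nuisances is the norm of its pointwise Euclidean length.\<close>

type_synonym 'x nuisance = "'x \<Rightarrow> real \<times> real \<times> real \<times> real \<times> real"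

definition g_t :: "'x nuisance \<Rightarrow> 'x \<Rightarrow> real" where "g_t \<eta> x = fst (\<eta> x)"
definition g_c :: "'x nuisance \<Rightarrow> 'x \<Rightarrow> real" where "g_c \<eta> x = fst (snd (\<eta> x))"
definition m_t :: "'x nuisance \<Rightarrow> 'x \<Rightarrow> real" where "m_t \<eta> x = fst (snd (snd (\<eta> x)))"
definition m_c :: "'x nuisance \<Rightarrow> 'x \<Rightarrow> real" where "m_c \<eta> x = fst (snd (snd (snd (\<eta> x))))"
definition propensity :: "'x nuisance \<Rightarrow> 'x \<Rightarrow> real" where "propensity \<eta> x = snd (snd (snd (snd (\<eta> x))))"

definition score :: "'x obs \<Rightarrow> real \<Rightarrow> 'x nuisance \<Rightarrow> real" where
  "score w \<theta> \<eta> = (case w of (y, a, z, x) \<Rightarrow>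
     g_t \<eta> x - g_c \<eta> x
       + of_bool z * (y - g_t \<eta> x) / propensity \<eta> x
       - (1 - of_bool z) * (y - g_c \<eta> x) / (1 - propensity \<eta> x)
     - \<theta> * (m_t \<eta> x - m_c \<eta> x
       + of_bool z * (of_bool a - m_t \<eta> x) / propensity \<eta> x
       - (1 - of_bool z) * (of_bool a - m_c \<eta> x) / (1 - propensity \<eta> x)))"

locale iv_model = prob_space M
  for M :: "'w measure" +
  fixes MX :: "'x measure" and MU :: "'u measure"
    and Ypot :: "bool \<Rightarrow> 'w \<Rightarrow> real" and Apot :: "bool \<Rightarrow> 'w \<Rightarrow> bool"
    and Y :: "'w \<Rightarrow> real" and A Z :: "'w \<Rightarrow> bool"
    and X :: "'w \<Rightarrow> 'x" and U :: "'w \<Rightarrow> 'u"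
    and \<eta>\<^sub>0 :: "'x nuisance" and \<theta>\<^sub>0 :: real
  assumes rv_Ypot: "Ypot a \<in> borel_measurable M"
    and rv_Apot: "Apot z \<in> measurable M (count_space UNIV)"
    and rv_Y: "Y \<in> borel_measurable M"
    and rv_A: "A \<in> measurable M (count_space UNIV)"
    and rv_Z: "Z \<in> measurable M (count_space UNIV)"
    and rv_X: "X \<in> measurable M MX"
    and rv_U: "U \<in> measurable M MU"
    and consistency_Y: "AE \<omega> in M. Y \<omega> = Ypot (A \<omega>) \<omega>"
    and consistency_A: "AE \<omega> in M. A \<omega> = Apot (Z \<omega>) \<omega>"
    and ignorability:
      "cond_indep M (borel \<Otimes>\<^sub>M borel) (\<lambda>\<omega>. (Ypot False \<omega>, Ypot True \<omega>))
         (count_space UNIV) A (MX \<Otimes>\<^sub>M MU) (\<lambda>\<omega>. (X \<omega>, U \<omega>))"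
    and exclusion:
      "cond_indep M (count_space UNIV) Z borel Y
         (count_space UNIV \<Otimes>\<^sub>M (MU \<Otimes>\<^sub>M MX)) (\<lambda>\<omega>. (A \<omega>, U \<omega>, X \<omega>))"
    and instrument_unconfounded: "cond_indep M (count_space UNIV) Z MU U MX X"
    and relevance: "\<not> cond_indep M (count_space UNIV) Z (count_space UNIV) A MX X"
    and monotonicity: "AE \<omega> in M. Apot True \<omega> \<ge> Apot False \<omega>"
    \<comment> \<open>\<open>E[Y | Z = z, X]\<close> is the value at \<open>z\<close> of the function of \<open>(Z, X)\<close> representing
      \<open>E[Y | Z, X]\<close>.\<close>
    and eta0_measurable: "\<eta>\<^sub>0 \<in> borel_measurable MX"
    and eta0_g: "AE \<omega> in M.
      real_cond_exp M (sigma_gen M (count_space UNIV \<Otimes>\<^sub>M MX) (\<lambda>\<omega>. (Z \<omega>, X \<omega>))) Y \<omega> =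
      (if Z \<omega> then g_t \<eta>\<^sub>0 (X \<omega>) else g_c \<eta>\<^sub>0 (X \<omega>))"
    and eta0_m: "AE \<omega> in M.
      real_cond_exp M (sigma_gen M (count_space UNIV \<Otimes>\<^sub>M MX) (\<lambda>\<omega>. (Z \<omega>, X \<omega>)))
        (\<lambda>\<omega>. of_bool (A \<omega>)) \<omega> =
      (if Z \<omega> then m_t \<eta>\<^sub>0 (X \<omega>) else m_c \<eta>\<^sub>0 (X \<omega>))"
    and eta0_e: "AE \<omega> in M.
      real_cond_exp M (sigma_gen M MX X) (\<lambda>\<omega>. of_bool (Z \<omega>)) \<omega> = propensity \<eta>\<^sub>0 (X \<omega>)"
    and theta0_LATE:
      "\<theta>\<^sub>0 = (\<integral>\<omega>. Ypot True \<omega> - Ypot False \<omega>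
               \<partial>uniform_measure M {\<omega> \<in> space M. Apot True \<omega> > Apot False \<omega>})"
    \<comment> \<open>The identification formula is part of the setting: the independence assumptions above do
      not restrict the joint law of \<open>(Apot False, Apot True)\<close> enough to imply it.\<close>
    and theta0_identified:
      "\<theta>\<^sub>0 = (\<integral>\<omega>. g_t \<eta>\<^sub>0 (X \<omega>) - g_c \<eta>\<^sub>0 (X \<omega>) \<partial>M) /
            (\<integral>\<omega>. m_t \<eta>\<^sub>0 (X \<omega>) - m_c \<eta>\<^sub>0 (X \<omega>) \<partial>M)"

text \<open>Observation \<open>i \<ge> 1\<close> receives a fold label \<open>\<kappa> i\<close> when it arrives, and the folds of
  \<open>{1..n}\<close> are the level sets of the labels.\<close>

definition fold_set :: "(nat \<Rightarrow> 'w \<Rightarrow> nat) \<Rightarrow> nat \<Rightarrow> nat \<Rightarrow> 'w \<Rightarrow> nat set" where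
  "fold_set \<kappa> n k \<omega> = {i \<in> {1..n}. \<kappa> i \<omega> = k}"

text \<open>The information in the labels of \<open>{1..n}\<close> and the observations outside the first fold.\<close>

definition train_sigma ::
  "'w measure \<Rightarrow> 'd measure \<Rightarrow> (nat \<Rightarrow> 'w \<Rightarrow> nat) \<Rightarrow> (nat \<Rightarrow> 'w \<Rightarrow> 'd) \<Rightarrow> nat \<Rightarrow> 'w measure"
where
  "train_sigma M N \<kappa> W n = sigma (space M)
     ({{\<omega> \<in> space M. \<kappa> i \<omega> = k} | i k. i \<in> {1..n}} \<union>
      {{\<omega> \<in> space M. \<kappa> i \<omega> \<noteq> 1 \<and> W i \<omega> \<in> B} | i B. i \<in> {1..n} \<and> B \<in> sets N})"

definition mean_score ::
  "(nat \<Rightarrow> 'w \<Rightarrow> 'x obs) \<Rightarrow> nat set \<Rightarrow> 'w \<Rightarrow> real \<Rightarrow> 'x nuisance \<Rightarrow> real" where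
  "mean_score W I \<omega> \<theta> \<eta> = (\<Sum>i\<in>I. score (W i \<omega>) \<theta> \<eta>) / real (card I)"

locale iv_split_sample = iv_model M MX MU Ypot Apot Y A Z X U \<eta>\<^sub>0 \<theta>\<^sub>0
  for M :: "'w measure" and MX :: "'x measure" and MU :: "'u measure"
    and Ypot Apot Y A Z X U \<eta>\<^sub>0 \<theta>\<^sub>0 +
  fixes W :: "nat \<Rightarrow> 'w \<Rightarrow> 'x obs" and K :: nat and \<kappa> :: "nat \<Rightarrow> 'w \<Rightarrow> nat"
    and \<eta>h :: "nat \<Rightarrow> 'w \<Rightarrow> 'x nuisance" and \<theta>h :: "nat \<Rightarrow> 'w \<Rightarrow> real"
  assumes data_indep: "indep_vars (\<lambda>_. obs_space MX) W {1..}"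
    and data_law: "i \<ge> 1 \<Longrightarrow>
      distr M (obs_space MX) (W i) = distr M (obs_space MX) (\<lambda>\<omega>. (Y \<omega>, A \<omega>, Z \<omega>, X \<omega>))"
    and labels: "i \<ge> 1 \<Longrightarrow> \<omega> \<in> space M \<Longrightarrow> \<kappa> i \<omega> \<in> {1..K}"
    and rv_label: "i \<ge> 1 \<Longrightarrow> \<kappa> i \<in> measurable M (count_space UNIV)"
    and labels_indep:
      "indep_set
         (sets (sigma_gen M (\<Pi>\<^sub>M i\<in>{1..}. count_space UNIV) (\<lambda>\<omega>. \<lambda>i\<in>{1..}. \<kappa> i \<omega>)))
         (sets (sigma_gen M (\<Pi>\<^sub>M i\<in>{1..}. obs_space MX) (\<lambda>\<omega>. \<lambda>i\<in>{1..}. W i \<omega>)))"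
    and balanced: "k \<in> {1..K} \<Longrightarrow>
      AE \<omega> in M. (\<lambda>n. real (card (fold_set \<kappa> n k \<omega>)) / real n) \<longlonglongrightarrow> 1 / real K"
    and eta_hat_trained: "n \<ge> 1 \<Longrightarrow>
      (\<lambda>(\<omega>, x). \<eta>h n \<omega> x) \<in> borel_measurable (train_sigma M (obs_space MX) \<kappa> W n \<Otimes>\<^sub>M MX)"
    and rv_theta_hat: "n \<ge> 1 \<Longrightarrow> \<theta>h n \<in> borel_measurable M"
    \<comment> \<open>The estimating equation is affine in its unknown and can fail to have a solution for
      individual \<open>n\<close> and \<open>\<omega>\<close>; nothing is required of \<open>\<theta>h n \<omega>\<close> then.\<close>
    and theta_hat_solves: "n \<ge> 1 \<Longrightarrow> \<omega> \<in> space M \<Longrightarrow>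
      \<exists>\<theta>. mean_score W (fold_set \<kappa> n 1 \<omega>) \<omega> \<theta> (\<eta>h n \<omega>) = 0 \<Longrightarrow>
      mean_score W (fold_set \<kappa> n 1 \<omega>) \<omega> (\<theta>h n \<omega>) (\<eta>h n \<omega>) = 0"

definition sigma_hat ::
  "(nat \<Rightarrow> 'w \<Rightarrow> 'x obs) \<Rightarrow> nat \<Rightarrow> (nat \<Rightarrow> 'w \<Rightarrow> nat) \<Rightarrow> (nat \<Rightarrow> 'w \<Rightarrow> 'x nuisance) \<Rightarrow>
   (nat \<Rightarrow> 'w \<Rightarrow> real) \<Rightarrow> nat \<Rightarrow> 'w \<Rightarrow> real"
where
  "sigma_hat W K \<kappa> \<eta>h \<theta>h n \<omega> =
     sqrt (1 / real n * (\<Sum>k = 1..K. \<Sum>i\<in>fold_set \<kappa> n k \<omega>. (score (W i \<omega>) (\<theta>h n \<omega>) (\<eta>h n \<omega>))\<^sup>2))"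

definition half_width :: "real \<Rightarrow> real \<Rightarrow> nat \<Rightarrow> real" where
  "half_width \<alpha> \<rho> n =
     sqrt ((2 * real n * \<rho>\<^sup>2 + 1) / ((real n)\<^sup>2 * \<rho>\<^sup>2) * ln ((real n * \<rho>\<^sup>2 + 1) / \<alpha>))"

end

theory Submission
  imports Defs "HOL-Real_Asymp.Real_Asymp"
begin

text \<open>Asymptotic equivalence constrains endpoints only in the limit, so
  \<open>min \<theta>\<^sub>0 L\<close> and \<open>max \<theta>\<^sub>0 U\<close> witness the confidence sequence as soon as, almost surely,
  \<open>\<bar>\<theta>h n - \<theta>\<^sub>0\<bar>\<close> is eventually at most the half-length of the interval, and that is at least
  \<open>\<sigma>h n * sqrt (ln n / n)\<close>. As \<open>\<theta>h n - \<theta>\<^sub>0\<close> is the quotient of the first-fold sums of the score at \<open>\<theta>\<^sub>0\<close> and of its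
  slope in \<open>\<theta>\<close>, it suffices that the former is \<open>o(sqrt (n ln n))\<close>, that the latter grows linearly and that
  the variance estimate stays away from zero.

  Given the training information the first-fold observations are still an i.i.d. sample. The exponential
  Markov inequality for sums normalised by their conditional moment generating function, together with
  Borel--Cantelli, bounds the deviation of such a sum from its conditional mean by
  \<open>sqrt (n ln n) (C v + 2 / C)\<close> for each \<open>C > 0\<close>, with \<open>v\<close> the conditional second moment. This settles the
  increment of the score from \<open>\<eta>\<^sub>0\<close> to \<open>\<eta>h n\<close>, for which \<open>v\<close> tends to zero. The score at \<open>\<eta>\<^sub>0\<close> does not
  depend on \<open>n\<close>, so there the bound is needed only along a polynomially growing subsequence and over the
  short gaps between its members. Fourth moments pay for the truncation. The conditional mean of the score is
  a product of nuisance errors because the score is doubly robust.\<close>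

section \<open>Integrals, truncation and exponential moments\<close>

text \<open>The trained nuisance changes with \<open>n\<close> and with the folds, so the first-fold
  sums form a triangular array without a martingale structure in \<open>n\<close>. Hence a union
  bound over all \<open>n\<close>: it costs \<open>ln n\<close>, which is just affordable because
  the interval itself has length of order \<open>sqrt (ln n / n)\<close>. A fixed variance leaves a
  constant multiple of \<open>sqrt (n * ln n)\<close>; only a vanishing variance or a sparser set of
  sample sizes gives a smaller order. No conditional distribution is constructed: an integral
  identity for products over the first fold carries the conditioning. The fourth moment fixes the
  exponents: envelope values up to \<open>n\<close> stay below the order
  \<open>n powr (1/3)\<close>, so truncation at \<open>n powr (2/5)\<close> is eventually inactive,
  and this level is still below the \<open>sqrt (n / ln n)\<close> that bounded exponents require.
  The score divides by the estimated propensity, which a bounded sup-norm error does not keep off 0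
  and 1, hence the separate overlap constant \<delta>.\<close>

lemma space_sigma_gen: "space (sigma_gen M S f) = space M"
  by (simp add: sigma_gen_def)

lemma subalgebra_sigma_gen: "f \<in> measurable M S \<Longrightarrow> subalgebra M (sigma_gen M S f)"
  unfolding subalgebra_def sigma_gen_def using sets_image_in_sets[OF refl] by simp

text \<open>Domination is asked for only eventually, since the bounds on the trained nuisance hold
  from an index on that depends on the sample point. Shifting the sequence discards the earlier
  terms.\<close>

lemma tendsto_integral_dominated:
  fixes f :: "'a \<Rightarrow> real" and s :: "nat \<Rightarrow> 'a \<Rightarrow> real"
  assumes f: "f \<in> borel_measurable M" and s: "\<And>n. s n \<in> borel_measurable M" and g: "integrable M g"
    and lim: "AE x in M. (\<lambda>n. s n x) \<longlonglongrightarrow> f x"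
    and dom: "\<forall>\<^sub>F n in sequentially. AE x in M. \<bar>s n x\<bar> \<le> g x"
  shows "(\<lambda>n. \<integral>x. s n x \<partial>M) \<longlonglongrightarrow> (\<integral>x. f x \<partial>M)"
proof -
  obtain m where m: "\<And>n. n \<ge> m \<Longrightarrow> AE x in M. \<bar>s n x\<bar> \<le> g x"
    using dom unfolding eventually_sequentially by blast
  have "(\<lambda>n. \<integral>x. s (n + m) x \<partial>M) \<longlonglongrightarrow> (\<integral>x. f x \<partial>M)"
  proof (rule integral_dominated_convergence[OF f _ g])
    show "AE x in M. (\<lambda>n. s (n + m) x) \<longlonglongrightarrow> f x"
      using lim by eventually_elim (rule LIMSEQ_ignore_initial_segment)
  qed (use s m in auto)
  then show ?thesis by (rule LIMSEQ_offset)
qed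

section \<open>Square integrability, fourth moments and truncation\<close>

lemma integrable_mult_of_squares:
  fixes f g :: "'a \<Rightarrow> real"
  assumes [measurable]: "f \<in> borel_measurable M" "g \<in> borel_measurable M"
    and f2: "integrable M (\<lambda>x. (f x)\<^sup>2)" and g2: "integrable M (\<lambda>x. (g x)\<^sup>2)"
  shows "integrable M (\<lambda>x. f x * g x)"
proof (rule Bochner_Integration.integrable_bound)
  show "integrable M (\<lambda>x. (f x)\<^sup>2 + (g x)\<^sup>2)" using f2 g2 by simp
  have "\<bar>a * b\<bar> \<le> a\<^sup>2 + b\<^sup>2" for a b :: real
  proof -
    have "2 * (\<bar>a\<bar> * \<bar>b\<bar>) \<le> a\<^sup>2 + b\<^sup>2" using sum_squares_bound[of "\<bar>a\<bar>" "\<bar>b\<bar>"] by simp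
    moreover have "0 \<le> \<bar>a\<bar> * \<bar>b\<bar>" by simp
    ultimately show ?thesis unfolding abs_mult by linarith
  qed
  then show "AE x in M. norm (f x * g x) \<le> norm ((f x)\<^sup>2 + (g x)\<^sup>2)" by simp
qed measurable

lemma Cauchy_Schwarz_integral:
  fixes f g :: "'a \<Rightarrow> real"
  assumes f[measurable]: "f \<in> borel_measurable M" and g[measurable]: "g \<in> borel_measurable M"
    and f2: "integrable M (\<lambda>x. (f x)\<^sup>2)" and g2: "integrable M (\<lambda>x. (g x)\<^sup>2)"
  shows "(\<integral>x. \<bar>f x * g x\<bar> \<partial>M) \<le> sqrt (\<integral>x. (f x)\<^sup>2 \<partial>M) * sqrt (\<integral>x. (g x)\<^sup>2 \<partial>M)"
proof -
  have fg: "integrable M (\<lambda>x. \<bar>f x * g x\<bar>)"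
    using integrable_mult_of_squares[OF f g f2 g2] by simp
  have "(\<integral>\<^sup>+x. ennreal \<bar>f x\<bar> * ennreal \<bar>g x\<bar> \<partial>M)\<^sup>2 \<le> (\<integral>\<^sup>+x. (ennreal \<bar>f x\<bar>)\<^sup>2 \<partial>M) * (\<integral>\<^sup>+x. (ennreal \<bar>g x\<bar>)\<^sup>2 \<partial>M)"
    by (rule Cauchy_Schwarz_nn_integral) measurable
  also have "(\<integral>\<^sup>+x. ennreal \<bar>f x\<bar> * ennreal \<bar>g x\<bar> \<partial>M) = ennreal (\<integral>x. \<bar>f x * g x\<bar> \<partial>M)"
    using nn_integral_eq_integral[OF fg] by (simp add: abs_mult ennreal_mult)
  also have "(\<integral>\<^sup>+x. (ennreal \<bar>f x\<bar>)\<^sup>2 \<partial>M) = ennreal (\<integral>x. (f x)\<^sup>2 \<partial>M)"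
    using nn_integral_eq_integral[OF f2] by (simp add: ennreal_power)
  also have "(\<integral>\<^sup>+x. (ennreal \<bar>g x\<bar>)\<^sup>2 \<partial>M) = ennreal (\<integral>x. (g x)\<^sup>2 \<partial>M)"
    using nn_integral_eq_integral[OF g2] by (simp add: ennreal_power)
  finally have "ennreal ((\<integral>x. \<bar>f x * g x\<bar> \<partial>M)\<^sup>2) \<le> ennreal ((\<integral>x. (f x)\<^sup>2 \<partial>M) * (\<integral>x. (g x)\<^sup>2 \<partial>M))"
    by (simp add: ennreal_power ennreal_mult)
  then have "(\<integral>x. \<bar>f x * g x\<bar> \<partial>M)\<^sup>2 \<le> (\<integral>x. (f x)\<^sup>2 \<partial>M) * (\<integral>x. (g x)\<^sup>2 \<partial>M)"
    by simp
  then show ?thesis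
    using real_le_rsqrt by (metis real_sqrt_mult)
qed

lemma Lp_norm_2:
  assumes "integrable N (\<lambda>x. (norm (f x))\<^sup>2)"
  shows "Lp_norm N 2 f = ennreal (sqrt (\<integral>x. (norm (f x))\<^sup>2 \<partial>N))"
  using nn_integral_eq_integral[OF assms]
  by (simp add: Lp_norm_def powr_half_sqrt integral_nonneg_AE)

lemma integrable_power4_add:
  fixes f g :: "'a \<Rightarrow> real"
  assumes [measurable]: "f \<in> borel_measurable M" "g \<in> borel_measurable M"
    and f4: "integrable M (\<lambda>x. f x ^ 4)" and g4: "integrable M (\<lambda>x. g x ^ 4)"
  shows "integrable M (\<lambda>x. (f x + g x) ^ 4)"
proof (rule Bochner_Integration.integrable_bound)
  show "integrable M (\<lambda>x. 8 * (f x ^ 4 + g x ^ 4))" using f4 g4 by simp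
  have "(a + b) ^ 4 \<le> 8 * (a ^ 4 + b ^ 4)" for a b :: real
  proof -
    have sq: "(u + v)\<^sup>2 \<le> 2 * (u\<^sup>2 + v\<^sup>2)" for u v :: real
      using zero_le_power2[of "u - v"] by (simp add: power2_eq_square algebra_simps)
    have "(a + b) ^ 4 = ((a + b)\<^sup>2)\<^sup>2" by simp
    also have "\<dots> \<le> (2 * (a\<^sup>2 + b\<^sup>2))\<^sup>2" by (intro power_mono sq) auto
    also have "\<dots> \<le> 4 * (2 * ((a\<^sup>2)\<^sup>2 + (b\<^sup>2)\<^sup>2))" using sq[of "a\<^sup>2" "b\<^sup>2"] unfolding power_mult_distrib[of 2] by simp
    also have "\<dots> = 8 * (a ^ 4 + b ^ 4)" by simp
    finally show ?thesis .
  qed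
  then show "AE x in M. norm ((f x + g x) ^ 4) \<le> norm (8 * (f x ^ 4 + g x ^ 4))" by simp
qed measurable

lemma (in finite_measure) integrable_power4_of_powr:
  fixes f :: "'a \<Rightarrow> real"
  assumes [measurable]: "f \<in> borel_measurable M" and q: "q \<ge> 4"
    and fin: "(\<integral>\<^sup>+ x. ennreal (\<bar>f x\<bar> powr q) \<partial>M) < \<infinity>"
  shows "integrable M (\<lambda>x. f x ^ 4)"
proof (rule Bochner_Integration.integrable_bound)
  have "integrable M (\<lambda>x. \<bar>f x\<bar> powr q)"
    by (rule integrableI_nonneg) (use fin in auto)
  then show "integrable M (\<lambda>x. 1 + \<bar>f x\<bar> powr q)" by simp
  have "y ^ 4 \<le> 1 + \<bar>y\<bar> powr q" for y :: real
  proof (cases "\<bar>y\<bar> \<le> 1")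
    case True
    then have "\<bar>y\<bar> ^ 4 \<le> 1" by (intro power_le_one) auto
    then show ?thesis by (simp add: add_increasing2)
  next
    case False
    then have "\<bar>y\<bar> ^ 4 = \<bar>y\<bar> powr 4" by simp
    also have "\<dots> \<le> \<bar>y\<bar> powr q" using False q by (intro powr_mono) auto
    finally show ?thesis by simp
  qed
  then show "AE x in M. norm (f x ^ 4) \<le> norm (1 + \<bar>f x\<bar> powr q)" by simp
qed measurable

lemma (in finite_measure) integrable_of_power4:
  fixes f :: "'a \<Rightarrow> real"
  assumes [measurable]: "f \<in> borel_measurable M" and f4: "integrable M (\<lambda>x. f x ^ 4)"
  shows "integrable M f" "integrable M (\<lambda>x. (f x)\<^sup>2)"
proof -
  have int: "integrable M (\<lambda>x. 1 + f x ^ 4)" using f4 by simp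
  have p: "x \<le> 1 + x ^ 4" "x\<^sup>2 \<le> 1 + x ^ 4" for x :: real
  proof -
    \<comment> \<open>The first square gives the bound on \<open>x\<^sup>2\<close>; the two together
      give \<open>x ^ 4 - x + 1/2 \<ge> 0\<close>, hence the bound on \<open>x\<close>.\<close>
    have "(x\<^sup>2 - 1/2)\<^sup>2 \<ge> 0" "(x - 1/2)\<^sup>2 \<ge> 0" by auto
    then show "x \<le> 1 + x ^ 4" "x\<^sup>2 \<le> 1 + x ^ 4"
      by (simp_all add: power2_eq_square power4_eq_xxxx algebra_simps)
  qed
  have "norm (f x) \<le> norm (1 + f x ^ 4)" for x
    using p(1)[of "\<bar>f x\<bar>"] by simp
  then show "integrable M f"
    by (intro Bochner_Integration.integrable_bound[OF int]) auto
  have "norm ((f x)\<^sup>2) \<le> norm (1 + f x ^ 4)" for x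
    using p(2)[of "f x"] by simp
  then show "integrable M (\<lambda>x. (f x)\<^sup>2)"
    by (intro Bochner_Integration.integrable_bound[OF int]) auto
qed

text \<open>Where \<open>\<bar>g w\<bar>\<close> exceeds \<open>b\<close> it is at most
  \<open>g w ^ 4 / b ^ 3\<close>, so the fourth moment of the envelope bounds the mean that
  truncation removes. The envelope \<open>V\<close> stays fixed while \<open>g\<close> and
  \<open>C\<close> vary with the training sample.\<close>

lemma (in finite_measure) truncation_bounds:
  fixes g V :: "'a \<Rightarrow> real"
  assumes g[measurable]: "g \<in> borel_measurable M" and dom: "AE w in M. \<bar>g w\<bar> \<le> C * V w" and b: "b > 0"
    and V4: "integrable M (\<lambda>w. V w ^ 4)"
  shows "integrable M g" "integrable M (\<lambda>w. (g w)\<^sup>2)"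
    "\<bar>(\<integral>w. (if \<bar>g w\<bar> \<le> b then g w else 0) \<partial>M) - (\<integral>w. g w \<partial>M)\<bar> \<le> C ^ 4 * (\<integral>w. V w ^ 4 \<partial>M) / b ^ 3"
    "(\<integral>w. (if \<bar>g w\<bar> \<le> b then g w else 0)\<^sup>2 \<partial>M) \<le> (\<integral>w. (g w)\<^sup>2 \<partial>M)"
proof -
  have g4: "AE w in M. g w ^ 4 \<le> C ^ 4 * V w ^ 4"
    using dom
  proof eventually_elim
    case (elim w)
    have "g w ^ 4 = \<bar>g w\<bar> ^ 4" by simp
    also have "\<dots> \<le> (C * V w) ^ 4" using elim by (intro power_mono) auto
    finally show ?case by (simp add: power_mult_distrib)
  qed
  have CV: "integrable M (\<lambda>w. C ^ 4 * V w ^ 4)" using V4 by simp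
  have "integrable M (\<lambda>w. g w ^ 4)"
  proof (rule Bochner_Integration.integrable_bound[OF CV])
    show "AE w in M. norm (g w ^ 4) \<le> norm (C ^ 4 * V w ^ 4)"
      using g4 by eventually_elim simp
  qed measurable
  note i = integrable_of_power4[OF g this]
  then show "integrable M g" "integrable M (\<lambda>w. (g w)\<^sup>2)" by auto
  define h where "h w = (if \<bar>g w\<bar> \<le> b then g w else 0)" for w
  have h[measurable]: "h \<in> borel_measurable M" unfolding h_def by measurable
  have ih: "integrable M h"
    by (rule Bochner_Integration.integrable_bound[OF i(1)]) (auto simp: h_def)
  have "\<bar>(\<integral>w. h w \<partial>M) - (\<integral>w. g w \<partial>M)\<bar> = \<bar>\<integral>w. h w - g w \<partial>M\<bar>"
    using ih i(1) by simp
  also have "\<dots> \<le> (\<integral>w. \<bar>h w - g w\<bar> \<partial>M)" by (rule integral_abs_bound)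
  also have "\<dots> \<le> (\<integral>w. C ^ 4 * V w ^ 4 / b ^ 3 \<partial>M)"
  proof (rule integral_mono_AE)
    show "AE w in M. \<bar>h w - g w\<bar> \<le> C ^ 4 * V w ^ 4 / b ^ 3"
      using g4
    proof eventually_elim
      case (elim w)
      show ?case
      proof (cases "\<bar>g w\<bar> \<le> b")
        case True
        then show ?thesis using b by (simp add: h_def)
      next
        case False
        have "\<bar>g w\<bar> * b ^ 3 \<le> \<bar>g w\<bar> * \<bar>g w\<bar> ^ 3"
          using False b by (intro mult_left_mono power_mono) auto
        also have "\<dots> = g w ^ 4" by (simp flip: power_Suc)
        finally show ?thesis using False b elim by (simp add: h_def field_simps)
      qed
    qed
  qed (use V4 ih i(1) in auto)
  also have "\<dots> = C ^ 4 * (\<integral>w. V w ^ 4 \<partial>M) / b ^ 3" by simp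
  finally show "\<bar>(\<integral>w. (if \<bar>g w\<bar> \<le> b then g w else 0) \<partial>M) - (\<integral>w. g w \<partial>M)\<bar> \<le> C ^ 4 * (\<integral>w. V w ^ 4 \<partial>M) / b ^ 3"
    unfolding h_def .
  show "(\<integral>w. (if \<bar>g w\<bar> \<le> b then g w else 0)\<^sup>2 \<partial>M) \<le> (\<integral>w. (g w)\<^sup>2 \<partial>M)"
    by (rule integral_mono_AE') (use i(2) in auto)
qed

section \<open>Exponential moments of bounded functions\<close>

lemma exp_le_quadratic:
  fixes x :: real
  assumes "\<bar>x\<bar> \<le> 1"
  shows "exp x \<le> 1 + x + x\<^sup>2"
proof (cases "x \<ge> 0")
  case True
  then show ?thesis using exp_bound assms by auto
next
  case False
  define y where "y = - x"
  have y: "0 \<le> y" "y \<le> 1" using False assms by (auto simp: y_def)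
  \<comment> \<open>\<open>1 + y + y\<^sup>2 / 2\<close> is a lower bound for \<open>exp y\<close>;
    multiplied by the claimed bound for \<open>exp (- y)\<close> it is already at least 1.\<close>
  have "1 \<le> (1 - y + y\<^sup>2) * (1 + y + y\<^sup>2 / 2)"
  proof -
    have "(1 - y + y\<^sup>2) * (1 + y + y\<^sup>2 / 2) = 1 + (y\<^sup>2 + y ^ 3 + y ^ 4) / 2"
      by (simp add: field_simps power2_eq_square power3_eq_cube power4_eq_xxxx)
    then show ?thesis using y by simp
  qed
  also have "\<dots> \<le> (1 - y + y\<^sup>2) * exp y"
    using y exp_lower_Taylor_quadratic[OF y(1)] by (intro mult_left_mono) auto
  finally have "exp (- y) \<le> 1 - y + y\<^sup>2"
    by (simp add: exp_minus field_simps)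
  then show ?thesis by (simp add: y_def)
qed

text \<open>The quadratic bound on \<open>exp\<close>, followed by \<open>ln t \<le> t - 1\<close>.
  The uniform bound by 1 is what later forces the truncation level to be small against the
  reciprocal of the exponential tilt.\<close>

lemma (in prob_space) ln_mgf_le:
  fixes f :: "'a \<Rightarrow> real"
  assumes f[measurable]: "f \<in> borel_measurable M" and bdd: "\<And>x. \<bar>f x\<bar> \<le> 1"
  shows "ln (expectation (\<lambda>x. exp (f x))) \<le> expectation f + expectation (\<lambda>x. (f x)\<^sup>2)"
proof -
  have i1: "integrable M f"
    by (rule integrable_const_bound[where B=1]) (use bdd in auto)
  have i2: "integrable M (\<lambda>x. (f x)\<^sup>2)"
    by (rule integrable_const_bound[where B=1]) (use bdd in \<open>auto simp: abs_square_le_1\<close>)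
  have up: "exp (f x) \<le> 1 + f x + (f x)\<^sup>2" for x
    by (rule exp_le_quadratic[OF bdd])
  have i3: "integrable M (\<lambda>x. exp (f x))"
    by (rule integrable_const_bound[where B="exp 1"]) (use bdd in \<open>auto simp: abs_le_iff\<close>)
  have "expectation (\<lambda>x. exp (f x)) \<le> expectation (\<lambda>x. 1 + f x + (f x)\<^sup>2)"
    using i1 i2 by (intro integral_mono i3 up) auto
  also have "\<dots> = 1 + expectation f + expectation (\<lambda>x. (f x)\<^sup>2)"
    using i1 i2 by (simp add: prob_space)
  finally have "expectation (\<lambda>x. exp (f x)) \<le> 1 + expectation f + expectation (\<lambda>x. (f x)\<^sup>2)" .
  moreover have "expectation (\<lambda>x. exp (f x)) > 0"
  proof -
    have "exp (- 1) = expectation (\<lambda>x. exp (- 1))" by (simp add: prob_space)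
    also have "\<dots> \<le> expectation (\<lambda>x. exp (f x))"
      using bdd by (intro integral_mono i3) (auto simp: abs_le_iff minus_le_iff)
    finally show ?thesis by (meson exp_gt_zero order_less_le_trans)
  qed
  ultimately show ?thesis
    using ln_le_minus_one[of "expectation (\<lambda>x. exp (f x))"] by linarith
qed

text \<open>The defining property of a conditional expectation given \<open>f\<close>, for a version
  \<open>r\<close> known only almost surely and a weight that is a function of \<open>f\<close>. In
  this form the nuisance functions enter the bias computation.\<close>

lemma (in prob_space) sigma_gen_integral:
  fixes T r :: "'a \<Rightarrow> real"
  assumes f: "f \<in> measurable M S" and h: "h \<in> borel_measurable S"
    and T[measurable]: "T \<in> borel_measurable M" and r[measurable]: "r \<in> borel_measurable M"
    and int: "integrable M (\<lambda>\<omega>. h (f \<omega>) * T \<omega>)"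
    and ce: "AE \<omega> in M. real_cond_exp M (sigma_gen M S f) T \<omega> = r \<omega>"
  shows "(\<integral>\<omega>. h (f \<omega>) * T \<omega> \<partial>M) = (\<integral>\<omega>. h (f \<omega>) * r \<omega> \<partial>M)"
proof -
  interpret finite_measure_subalgebra M "sigma_gen M S f"
    by unfold_locales (rule subalgebra_sigma_gen[OF f])
  have [measurable]: "h \<in> borel_measurable S" "f \<in> measurable M S" by (fact h f)+
  have "f \<in> measurable (sigma_gen M S f) S"
    unfolding sigma_gen_def by (rule measurable_vimage_algebra1) (use measurable_space[OF f] in auto)
  then have hf: "(\<lambda>\<omega>. h (f \<omega>)) \<in> borel_measurable (sigma_gen M S f)"
    using h by (rule measurable_compose)
  have "(\<integral>\<omega>. h (f \<omega>) * T \<omega> \<partial>M) = (\<integral>\<omega>. h (f \<omega>) * real_cond_exp M (sigma_gen M S f) T \<omega> \<partial>M)"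
    by (rule real_cond_exp_intg(2)[OF int hf T, symmetric])
  also have "\<dots> = (\<integral>\<omega>. h (f \<omega>) * r \<omega> \<partial>M)"
  proof (rule integral_cong_AE)
    show "AE \<omega> in M. h (f \<omega>) * real_cond_exp M (sigma_gen M S f) T \<omega> = h (f \<omega>) * r \<omega>"
      using ce by eventually_elim simp
    show "(\<lambda>\<omega>. h (f \<omega>) * real_cond_exp M (sigma_gen M S f) T \<omega>) \<in> borel_measurable M"
      using borel_measurable_cond_exp2 by measurable
  qed measurable
  finally show ?thesis .
qed

section \<open>Relative gaps between consecutive powers\<close>

lemma root_at_top:
  assumes "q > 0"
  shows "filterlim (\<lambda>n. root q (real n)) at_top sequentially"
  unfolding filterlim_at_top
proof
  fix Z :: real
  show "\<forall>\<^sub>F n in sequentially. Z \<le> root q (real n)"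
    using eventually_ge_at_top[of "nat \<lceil>\<bar>Z\<bar> ^ q\<rceil>"]
  proof eventually_elim
    case (elim n)
    then have "\<bar>Z\<bar> ^ q \<le> real n" by linarith
    then have "root q (\<bar>Z\<bar> ^ q) \<le> root q (real n)" using assms by simp
    then show ?case using assms by (simp add: real_root_power_cancel)
  qed
qed

text \<open>With \<open>r = root q (real n)\<close> the quotient
  \<open>\<lfloor>r\<rfloor> / r\<close> tends to 1, and so does its \<open>q\<close>-th power. Thus
  the largest \<open>q\<close>-th power not exceeding \<open>n\<close> misses it by
  \<open>o(n)\<close>.\<close>

lemma floor_root_power_ratio:
  assumes "q > 0"
  shows "(\<lambda>n. (real n - real (nat \<lfloor>root q (real n)\<rfloor> ^ q)) / real n) \<longlonglongrightarrow> 0"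
proof -
  note r = root_at_top[OF assms]
  have "((\<lambda>x::real. \<lfloor>x\<rfloor> / x) \<longlongrightarrow> 1) at_top"
    by real_asymp
  from filterlim_compose[OF this r]
  have "(\<lambda>n. (\<lfloor>root q (real n)\<rfloor> / root q (real n)) ^ q) \<longlonglongrightarrow> 1 ^ q"
    by (rule tendsto_power)
  from tendsto_diff[OF tendsto_const[of 1] this]
  have "(\<lambda>n. 1 - (\<lfloor>root q (real n)\<rfloor> / root q (real n)) ^ q) \<longlonglongrightarrow> 0" by simp
  then show ?thesis
  proof (rule Lim_transform_eventually)
    show "\<forall>\<^sub>F n in sequentially. 1 - (\<lfloor>root q (real n)\<rfloor> / root q (real n)) ^ q =
        (real n - real (nat \<lfloor>root q (real n)\<rfloor> ^ q)) / real n"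
      using eventually_gt_at_top[of 0]
    proof eventually_elim
      case (elim n)
      have "real (nat \<lfloor>root q (real n)\<rfloor>) = real_of_int \<lfloor>root q (real n)\<rfloor>"
        by (intro of_nat_nat) (simp add: real_root_ge_zero)
      then show ?case
        using elim assms by (simp add: power_divide diff_divide_distrib)
    qed
  qed
qed

section \<open>First-fold sums given the training information\<close>

lemma card_fold_set_le: "card (fold_set \<kappa> n k \<omega>) \<le> n"
proof -
  have "fold_set \<kappa> n k \<omega> \<subseteq> {1..n}" by (auto simp: fold_set_def)
  from card_mono[OF _ this] show ?thesis by simp
qed

lemma fold_set_Int_all: "fold_set \<kappa> n k \<omega> \<inter> {1..n} = fold_set \<kappa> n k \<omega>"
  by (auto simp: fold_set_def)

locale split_sample = prob_space M for M :: "'w measure" +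
  fixes N :: "'d measure" and P :: "'d measure" and W :: "nat \<Rightarrow> 'w \<Rightarrow> 'd" and \<kappa> :: "nat \<Rightarrow> 'w \<Rightarrow> nat"
  assumes W_indep: "indep_vars (\<lambda>_. N) W {1..}"
    and W_law: "i \<ge> 1 \<Longrightarrow> distr M N (W i) = P"
    and rv_\<kappa>: "i \<ge> 1 \<Longrightarrow> \<kappa> i \<in> measurable M (count_space UNIV)"
    and \<kappa>_indep:
      "indep_set
         (sets (sigma_gen M (\<Pi>\<^sub>M i\<in>{1..}. count_space UNIV) (\<lambda>\<omega>. \<lambda>i\<in>{1..}. \<kappa> i \<omega>)))
         (sets (sigma_gen M (\<Pi>\<^sub>M i\<in>{1..}. N) (\<lambda>\<omega>. \<lambda>i\<in>{1..}. W i \<omega>)))"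
begin

lemma rv_W: "i \<ge> 1 \<Longrightarrow> W i \<in> measurable M N"
  using W_indep by (auto simp: indep_vars_def)

lemma sets_P [measurable_cong, simp]: "sets P = sets N"
  using W_law[of 1] by (metis order_refl sets_distr)

lemma space_P [simp]: "space P = space N"
  by (rule sets_eq_imp_space_eq) simp

lemma prob_space_P: "prob_space P"
  using W_law[of 1] prob_space_distr[OF rv_W[of 1]] by simp

sublocale P: prob_space P
  by (rule prob_space_P)

section \<open>Independence of one observation from the labels and the other observations\<close>

definition label_events :: "'w set set" where
  "label_events = sets (sigma_gen M (\<Pi>\<^sub>M i\<in>{1..}. count_space UNIV) (\<lambda>\<omega>. \<lambda>i\<in>{1..}. \<kappa> i \<omega>))"

definition other_events :: "nat \<Rightarrow> 'w set set" where
  "other_events i = sets (sigma_gen M (\<Pi>\<^sub>M j\<in>{1..} - {i}. N) (\<lambda>\<omega>. \<lambda>j\<in>{1..} - {i}. W j \<omega>))"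

text \<open>The information in all labels and all observations except \<open>W i\<close>.
  Intersections serve as generators because they form a system closed under intersection on which
  the product rule can be verified directly.\<close>

definition rest :: "nat \<Rightarrow> 'w measure" where
  "rest i = sigma (space M) {L \<inter> C | L C. L \<in> label_events \<and> C \<in> other_events i}"

lemma label_events_subset: "label_events \<subseteq> events"
  using \<kappa>_indep unfolding label_events_def by (rule indep_setD_ev1)

lemma rv_W_restrict: "J \<subseteq> {1..} \<Longrightarrow> (\<lambda>\<omega>. \<lambda>j\<in>J. W j \<omega>) \<in> measurable M (\<Pi>\<^sub>M j\<in>J. N)"
  by (rule measurable_restrict, rule rv_W) auto

lemma other_events_subset: "other_events i \<subseteq> events"
  unfolding other_events_def
  using subalgebra_sigma_gen[OF rv_W_restrict[of "{1..} - {i}"]] by (auto simp: subalgebra_def)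

text \<open>Labels are independent of the whole data sequence, so to multiply with a label event
  both \<open>C\<close> and its intersection with an event of \<open>W i\<close> must be seen as
  events of that sequence; the last two claims provide this. The first is the independence of
  \<open>W i\<close> from the other observations.\<close>

lemma other_events_Int:
  assumes C: "C \<in> other_events i" and B: "B \<in> sets N" and i: "i \<ge> 1"
  shows "prob (C \<inter> (W i -` B \<inter> space M)) = prob C * measure P B"
    and "C \<inter> (W i -` B \<inter> space M) \<in> sets (sigma_gen M (\<Pi>\<^sub>M i\<in>{1..}. N) (\<lambda>\<omega>. \<lambda>i\<in>{1..}. W i \<omega>))"
    and "C \<in> sets (sigma_gen M (\<Pi>\<^sub>M i\<in>{1..}. N) (\<lambda>\<omega>. \<lambda>i\<in>{1..}. W i \<omega>))"
proof -
  let ?J = "{1..} - {i}"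
  let ?V = "\<lambda>J \<omega>. \<lambda>j\<in>J. W j \<omega>"
  have sp: "?V J \<in> space M \<rightarrow> space (\<Pi>\<^sub>M j\<in>J. N)" if "J \<subseteq> {1..}" for J
    using rv_W_restrict[OF that] by (auto dest: measurable_space)
  obtain D where D: "D \<in> sets (\<Pi>\<^sub>M j\<in>?J. N)" "C = ?V ?J -` D \<inter> space M"
    using C sp[of ?J] unfolding other_events_def sigma_gen_def by (auto simp: sets_vimage_algebra2)
  define E where "E = (\<lambda>f. f i) -` B \<inter> space (\<Pi>\<^sub>M j\<in>{i}. N)"
  have E: "E \<in> sets (\<Pi>\<^sub>M j\<in>{i}. N)"
    unfolding E_def using B by (intro measurable_sets[OF measurable_component_singleton]) auto
  have "?V {i} \<omega> \<in> space (\<Pi>\<^sub>M j\<in>{i}. N)" if "\<omega> \<in> space M" for \<omega>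
    using sp[of "{i}"] i that by auto
  then have WE: "?V {i} -` E \<inter> space M = W i -` B \<inter> space M"
    unfolding E_def by auto
  have "indep_var (\<Pi>\<^sub>M j\<in>?J. N) (?V ?J) (\<Pi>\<^sub>M j\<in>{i}. N) (?V {i})"
    using i by (intro indep_var_restrict[OF W_indep]) auto
  note indep_varD[OF this D(1) E]
  moreover have "(\<lambda>\<omega>. (?V ?J \<omega>, ?V {i} \<omega>)) -` (D \<times> E) \<inter> space M = C \<inter> (W i -` B \<inter> space M)"
    unfolding D(2) WE[symmetric] by blast
  ultimately have "prob (C \<inter> (W i -` B \<inter> space M)) = prob C * prob (W i -` B \<inter> space M)"
    unfolding WE D(2) by (simp only:)
  moreover have "prob (W i -` B \<inter> space M) = measure P B"
    using measure_distr[OF rv_W[OF i] B] W_law[OF i] by simp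
  ultimately show "prob (C \<inter> (W i -` B \<inter> space M)) = prob C * measure P B"
    by simp
  let ?F = "sigma_gen M (\<Pi>\<^sub>M i\<in>{1..}. N) (?V {1..})"
  have F: "?V {1..} \<in> measurable ?F (\<Pi>\<^sub>M i\<in>{1..}. N)"
    unfolding sigma_gen_def by (rule measurable_vimage_algebra1) (use sp in auto)
  have "(\<lambda>\<omega>. restrict (?V {1..} \<omega>) ?J) \<in> measurable ?F (\<Pi>\<^sub>M j\<in>?J. N)"
    by (rule measurable_compose[OF F measurable_restrict_subset]) auto
  moreover have "restrict (?V {1..} \<omega>) ?J = ?V ?J \<omega>" for \<omega>
    by (auto simp: restrict_def fun_eq_iff)
  ultimately show *: "C \<in> sets ?F"
    using D by (auto simp: space_sigma_gen dest: measurable_sets)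
  have "(\<lambda>\<omega>. ?V {1..} \<omega> i) \<in> measurable ?F N"
    by (rule measurable_compose[OF F measurable_component_singleton]) (use i in auto)
  then have "W i \<in> measurable ?F N" using i by simp
  then have "W i -` B \<inter> space M \<in> sets ?F"
    using B by (auto simp: space_sigma_gen dest: measurable_sets)
  with * show "C \<inter> (W i -` B \<inter> space M) \<in> sets ?F"
    by auto
qed

lemma rest_generators: "{L \<inter> C | L C. L \<in> label_events \<and> C \<in> other_events i} \<subseteq> events"
  using label_events_subset other_events_subset by blast

lemma sets_rest: "sets (rest i) = sigma_sets (space M) {L \<inter> C | L C. L \<in> label_events \<and> C \<in> other_events i}"
  unfolding rest_def using rest_generators[of i] sets.sets_into_space by (intro sets_measure_of) blast

lemma space_rest [simp]: "space (rest i) = space M"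
  unfolding rest_def using rest_generators[of i] sets.sets_into_space by (intro space_measure_of) blast

lemma sets_rest_subset: "sets (rest i) \<subseteq> events"
  unfolding sets_rest by (rule sets.sigma_sets_subset[OF rest_generators])

text \<open>The product rule holds on the generators, by splitting off the label event first and the
  event of \<open>W i\<close> second. It passes to the generated sigma-algebras because both
  generators are closed under intersection.\<close>

lemma rest_indep:
  assumes H: "H \<in> sets (rest i)" and B: "B \<in> sets N" and i: "i \<ge> 1"
  shows "prob (H \<inter> (W i -` B \<inter> space M)) = prob H * measure P B"
proof -
  let ?A = "{L \<inter> C | L C. L \<in> label_events \<and> C \<in> other_events i}"
  let ?B = "{W i -` B \<inter> space M | B. B \<in> sets N}"
  have A: "Int_stable ?A"
  proof (rule Int_stableI)
    fix a b assume "a \<in> ?A" "b \<in> ?A"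
    then obtain L C L' C' where LC: "a = L \<inter> C" "b = L' \<inter> C'" "L \<in> label_events"
      "L' \<in> label_events" "C \<in> other_events i" "C' \<in> other_events i" by blast
    then have "L \<inter> L' \<in> label_events" "C \<inter> C' \<in> other_events i"
      unfolding label_events_def other_events_def by auto
    moreover have "a \<inter> b = (L \<inter> L') \<inter> (C \<inter> C')" using LC by auto
    ultimately show "a \<inter> b \<in> ?A" by blast
  qed
  have B': "Int_stable ?B"
  proof (rule Int_stableI)
    fix a b assume "a \<in> ?B" "b \<in> ?B"
    then obtain B B' where B: "a = W i -` B \<inter> space M" "b = W i -` B' \<inter> space M" "B \<in> sets N" "B' \<in> sets N"
      by blast
    then have "a \<inter> b = W i -` (B \<inter> B') \<inter> space M" "B \<inter> B' \<in> sets N" by auto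
    then show "a \<inter> b \<in> ?B" by blast
  qed
  have "indep_set ?A ?B"
  proof (rule indep_setI)
    show "?A \<subseteq> events" by (rule rest_generators)
    show "?B \<subseteq> events" using rv_W[OF i] by (auto dest: measurable_sets)
    fix a b assume "a \<in> ?A" "b \<in> ?B"
    then obtain L C B where ab: "a = L \<inter> C" "L \<in> label_events" "C \<in> other_events i"
      "b = W i -` B \<inter> space M" "B \<in> sets N" by blast
    note * = other_events_Int[OF ab(3,5) i] and ** = ab(2)[unfolded label_events_def]
    have "prob (L \<inter> (C \<inter> b)) = prob L * (prob C * measure P B)"
      using indep_setD[OF \<kappa>_indep ** *(2)] *(1) ab(4) by simp
    moreover have "prob (L \<inter> C) = prob L * prob C"
      by (rule indep_setD[OF \<kappa>_indep ** *(3)])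
    moreover have "prob b = measure P B"
      using measure_distr[OF rv_W[OF i] ab(5)] W_law[OF i] ab(4) by simp
    ultimately show "prob (a \<inter> b) = prob a * prob b"
      unfolding ab(1) by (simp add: Int_assoc)
  qed
  note indep_set_sigma_sets[OF this A B']
  moreover have "W i -` B \<inter> space M \<in> sigma_sets (space M) ?B"
    using B by (intro sigma_sets.Basic) blast
  ultimately have "prob (H \<inter> (W i -` B \<inter> space M)) = prob H * prob (W i -` B \<inter> space M)"
    using H unfolding sets_rest by (intro indep_setD)
  then show ?thesis
    using measure_distr[OF rv_W[OF i] B] W_law[OF i] by simp
qed

lemma Int_in_rest: "L \<in> label_events \<Longrightarrow> C \<in> other_events i \<Longrightarrow> L \<inter> C \<in> sets (rest i)"
  unfolding sets_rest by (intro sigma_sets.Basic) blast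

lemma space_events: "space M \<in> label_events" "space M \<in> other_events i"
  unfolding label_events_def other_events_def by (metis sets.top space_sigma_gen)+

lemma label_in_rest: "j \<ge> 1 \<Longrightarrow> {\<omega> \<in> space M. \<kappa> j \<omega> \<in> S} \<in> sets (rest i)"
proof -
  assume j: "j \<ge> 1"
  let ?F = "sigma_gen M (\<Pi>\<^sub>M i\<in>{1..}. count_space UNIV) (\<lambda>\<omega>. \<lambda>i\<in>{1..}. \<kappa> i \<omega>)"
  have "(\<lambda>\<omega>. \<lambda>i\<in>{1..}. \<kappa> i \<omega>) \<in> measurable ?F (\<Pi>\<^sub>M i\<in>{1..}. count_space UNIV)"
    unfolding sigma_gen_def by (rule measurable_vimage_algebra1) (auto simp: space_PiM)
  from measurable_compose[OF this measurable_component_singleton, of j]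
  have "\<kappa> j \<in> measurable ?F (count_space UNIV)" using j by simp
  from measurable_sets[OF this, of S]
  have L: "{\<omega> \<in> space M. \<kappa> j \<omega> \<in> S} \<in> label_events"
    unfolding label_events_def by (simp add: space_sigma_gen vimage_def Int_def conj_commute)
  from Int_in_rest[OF this space_events(2)] show ?thesis
    by (simp add: Int_absorb2)
qed

lemma W_in_rest:
  assumes j: "j \<ge> 1" "j \<noteq> i"
  shows "W j \<in> measurable (rest i) N"
proof (rule measurableI)
  fix B assume B: "B \<in> sets N"
  let ?J = "{1..} - {i}"
  let ?F = "sigma_gen M (\<Pi>\<^sub>M j\<in>?J. N) (\<lambda>\<omega>. \<lambda>j\<in>?J. W j \<omega>)"
  have "(\<lambda>\<omega>. \<lambda>j\<in>?J. W j \<omega>) \<in> measurable ?F (\<Pi>\<^sub>M j\<in>?J. N)"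
    unfolding sigma_gen_def
    by (rule measurable_vimage_algebra1) (use measurable_space[OF rv_W_restrict[of ?J]] in auto)
  from measurable_compose[OF this measurable_component_singleton, of j]
  have "W j \<in> measurable ?F N" using j by simp
  from measurable_sets[OF this B] have C: "W j -` B \<inter> space M \<in> other_events i"
    unfolding other_events_def by (simp add: space_sigma_gen)
  from Int_in_rest[OF space_events(1) this]
  show "W j -` B \<inter> space (rest i) \<in> sets (rest i)"
    by (simp add: Int_absorb1)
qed (use measurable_space[OF rv_W[OF j(1)]] in auto)

text \<open>The events whose trace on \<open>\<kappa> i = 1\<close> is determined by the labels and the observations other than
  \<open>W i\<close>. They include the training events, since \<open>W i\<close> is not used for training when \<open>\<kappa> i = 1\<close>.\<close>

definition off :: "nat \<Rightarrow> 'w measure" where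
  "off i = sigma (space M) {H \<in> events. {\<omega> \<in> space M. \<kappa> i \<omega> = 1} \<inter> H \<in> sets (rest i)}"

lemma fold_event: "i \<ge> 1 \<Longrightarrow> {\<omega> \<in> space M. \<kappa> i \<omega> = 1} \<in> sets (rest j)"
  using label_in_rest[of i "{1}" j] by simp

lemma
  assumes i: "i \<ge> 1"
  shows sets_off: "sets (off i) = {H \<in> events. {\<omega> \<in> space M. \<kappa> i \<omega> = 1} \<inter> H \<in> sets (rest i)}" (is "_ = ?S")
    and space_off: "space (off i) = space M"
proof -
  let ?E = "{\<omega> \<in> space M. \<kappa> i \<omega> = 1}"
  have "sigma_algebra (space M) ?S"
    unfolding sigma_algebra_iff2
  proof (intro conjI ballI allI impI)
    show "?S \<subseteq> Pow (space M)" using sets.sets_into_space by blast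
    show "{} \<in> ?S" by simp
    fix H assume H: "H \<in> ?S"
    have "?E \<inter> (space M - H) = ?E - (?E \<inter> H)" by auto
    moreover have "?E - (?E \<inter> H) \<in> sets (rest i)"
      using H fold_event[OF i, of i] by auto
    ultimately show "space M - H \<in> ?S" using H by auto
  next
    fix A :: "nat \<Rightarrow> _" assume A: "range A \<subseteq> ?S"
    have "?E \<inter> (\<Union>n. A n) = (\<Union>n. ?E \<inter> A n)" by auto
    moreover have "(\<Union>n. ?E \<inter> A n) \<in> sets (rest i)"
      by (intro sets.countable_nat_UN) (use A in auto)
    ultimately show "(\<Union>n. A n) \<in> ?S" using A by auto
  qed
  from sigma_algebra.sets_measure_of_eq[OF this] show "sets (off i) = ?S"
    unfolding off_def by simp
  show "space (off i) = space M"
    unfolding off_def using sets.sets_into_space by (intro space_measure_of) blast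
qed

lemma id_off: "i \<ge> 1 \<Longrightarrow> (\<lambda>\<omega>. \<omega>) \<in> measurable M (off i)"
  by (rule measurableI) (auto simp: sets_off space_off Int_absorb2 sets.sets_into_space)

lemma rest_off: "i \<ge> 1 \<Longrightarrow> sets (rest i) \<subseteq> sets (off i)"
  using fold_event[of i i] sets_rest_subset[of i] by (auto simp: sets_off)

lemma measurable_off: "i \<ge> 1 \<Longrightarrow> f \<in> measurable (rest i) S \<Longrightarrow> f \<in> measurable (off i) S"
  using rest_off[of i] by (auto simp: measurable_def space_off)

lemma measurable_off_M: "i \<ge> 1 \<Longrightarrow> f \<in> measurable (off i) S \<Longrightarrow> f \<in> measurable M S"
  using measurable_compose[OF id_off] by simp

text \<open>Given \<open>\<kappa> i = 1\<close>, the observation \<open>W i\<close> has law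
  \<open>P\<close> and is independent of \<open>off i\<close>. On that event the joint law of
  \<open>(\<omega>, W i \<omega>)\<close> is therefore a product measure, and Tonelli's theorem
  gives the identity.\<close>

lemma nn_integral_off:
  assumes i: "i \<ge> 1" and f: "f \<in> borel_measurable (off i \<Otimes>\<^sub>M N)"
  shows "(\<integral>\<^sup>+ \<omega>. indicator {\<omega> \<in> space M. \<kappa> i \<omega> = 1} \<omega> * f (\<omega>, W i \<omega>) \<partial>M) =
    (\<integral>\<^sup>+ \<omega>. indicator {\<omega> \<in> space M. \<kappa> i \<omega> = 1} \<omega> * (\<integral>\<^sup>+ w. f (\<omega>, w) \<partial>P) \<partial>M)"
proof -
  let ?E = "{\<omega> \<in> space M. \<kappa> i \<omega> = 1}"
  have E[measurable]: "?E \<in> events" using rv_\<kappa>[OF i] by measurable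
  note [measurable] = rv_W[OF i] id_off[OF i] f
  \<comment> \<open>The restriction of \<open>M\<close> to the fold event, not normalised.
    \<open>Q'\<close> below is the same measure on the coarser sigma-algebra \<open>off i\<close>,
    where the product rule is available.\<close>
  define Q where "Q = density M (indicator ?E)"
  have Q[measurable_cong, simp]: "sets Q = events" and [simp]: "space Q = space M"
    by (simp_all add: Q_def)
  have EQ: "emeasure Q H = emeasure M (?E \<inter> H)" if "H \<in> events" for H
    unfolding Q_def using that E by (simp add: emeasure_density nn_integral_indicator flip: indicator_inter_arith)
  define Q' where "Q' = distr Q (off i) (\<lambda>\<omega>. \<omega>)"
  have idQ[measurable]: "(\<lambda>\<omega>. \<omega>) \<in> measurable Q (off i)" using id_off[OF i] by (simp add: Q_def)
  have "finite_measure Q"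
    by (rule finite_measureI) (use EQ[of "space M"] E emeasure_finite in \<open>auto simp: Int_absorb2\<close>)
  then have fQ': "finite_measure Q'"
    unfolding Q'_def by (rule finite_measure.finite_measure_distr) (rule idQ)
  have Wm[measurable]: "(\<lambda>\<omega>. (\<omega>, W i \<omega>)) \<in> measurable Q (off i \<Otimes>\<^sub>M N)"
    by measurable
  have sQ'[measurable_cong, simp]: "sets Q' = sets (off i)" by (simp add: Q'_def)
  have eq: "Q' \<Otimes>\<^sub>M P = distr Q (off i \<Otimes>\<^sub>M N) (\<lambda>\<omega>. (\<omega>, W i \<omega>))"
  proof (rule pair_measure_eqI)
    show "sigma_finite_measure Q'" using fQ' by (simp add: finite_measure.axioms(1))
    show "sigma_finite_measure P" ..
    show "sets (Q' \<Otimes>\<^sub>M P) = sets (distr Q (off i \<Otimes>\<^sub>M N) (\<lambda>\<omega>. (\<omega>, W i \<omega>)))"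
      using sets_pair_measure_cong[OF sQ' sets_P] by simp
    fix A B assume "A \<in> sets Q'" and "B \<in> sets P"
    then have A: "A \<in> sets (off i)" "A \<in> events" "?E \<inter> A \<in> sets (rest i)" and B: "B \<in> sets N"
      using i by (auto simp: sets_off)
    have "emeasure Q' A = emeasure M (?E \<inter> A)"
      unfolding Q'_def using A idQ EQ
      by (subst emeasure_distr) (auto simp: Int_absorb2 sets.sets_into_space)
    moreover have "emeasure (distr Q (off i \<Otimes>\<^sub>M N) (\<lambda>\<omega>. (\<omega>, W i \<omega>))) (A \<times> B) =
        emeasure Q (A \<inter> (W i -` B \<inter> space M))"
      using A B Wm sets.sets_into_space[OF A(2)]
      by (subst emeasure_distr) (auto intro!: arg_cong[where f="emeasure Q"])
    moreover have "\<dots> = emeasure M ((?E \<inter> A) \<inter> (W i -` B \<inter> space M))"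
      using A B measurable_sets[OF rv_W[OF i] B] by (subst EQ) (auto simp: Int_assoc)
    ultimately show "emeasure Q' A * emeasure P B =
        emeasure (distr Q (off i \<Otimes>\<^sub>M N) (\<lambda>\<omega>. (\<omega>, W i \<omega>))) (A \<times> B)"
      using rest_indep[OF A(3) B i]
      by (simp add: emeasure_eq_measure P.emeasure_eq_measure ennreal_mult)
  qed
  have g: "(\<lambda>\<omega>. \<integral>\<^sup>+ w. f (\<omega>, w) \<partial>P) \<in> borel_measurable (off i)"
    by (rule P.borel_measurable_nn_integral_fst) measurable
  have f': "f \<in> borel_measurable (Q' \<Otimes>\<^sub>M P)"
    using f by simp
  have "(\<integral>\<^sup>+ \<omega>. indicator ?E \<omega> * f (\<omega>, W i \<omega>) \<partial>M) = (\<integral>\<^sup>+ \<omega>. f (\<omega>, W i \<omega>) \<partial>Q)"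
    unfolding Q_def using E by (subst nn_integral_density) auto
  also have "\<dots> = (\<integral>\<^sup>+ x. f x \<partial>(Q' \<Otimes>\<^sub>M P))"
    unfolding eq using f by (subst nn_integral_distr) auto
  also have "\<dots> = (\<integral>\<^sup>+ \<omega>. \<integral>\<^sup>+ w. f (\<omega>, w) \<partial>P \<partial>Q')"
    by (rule P.nn_integral_fst[OF f', symmetric])
  also have "\<dots> = (\<integral>\<^sup>+ \<omega>. \<integral>\<^sup>+ w. f (\<omega>, w) \<partial>P \<partial>Q)"
    unfolding Q'_def using g idQ by (subst nn_integral_distr) auto
  also have "\<dots> = (\<integral>\<^sup>+ \<omega>. indicator ?E \<omega> * (\<integral>\<^sup>+ w. f (\<omega>, w) \<partial>P) \<partial>M)"
    unfolding Q_def using measurable_off_M[OF i g] E by (subst nn_integral_density) auto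
  finally show ?thesis .
qed

section \<open>Integrating out the first fold given the training information\<close>

abbreviation "train n \<equiv> train_sigma M N \<kappa> W n"

lemma train_generators_events:
  "{{\<omega> \<in> space M. \<kappa> i \<omega> = k} | i k. i \<in> {1..n}} \<union>
    {{\<omega> \<in> space M. \<kappa> i \<omega> \<noteq> 1 \<and> W i \<omega> \<in> B} | i B. i \<in> {1..n} \<and> B \<in> sets N} \<subseteq> Pow (space M)"
  by blast

lemma space_train [simp]: "space (train n) = space M"
  unfolding train_sigma_def by (rule space_measure_of[OF train_generators_events])

text \<open>A generator involving \<open>W i\<close> also demands
  \<open>\<kappa> i \<noteq> 1\<close>, so its trace on the fold event is empty; every other
  generator belongs to \<open>rest i\<close>. This is where sample splitting enters.\<close>

lemma train_subset_off:
  assumes i: "i \<ge> 1"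
  shows "sets (train n) \<subseteq> sets (off i)"
proof -
  let ?E = "{\<omega> \<in> space M. \<kappa> i \<omega> = 1}"
  have 1: "{\<omega> \<in> space M. \<kappa> j \<omega> = k} \<in> sets (off i)" if "j \<ge> 1" for j k
    using label_in_rest[OF that, of "{k}" i] rest_off[OF i] by auto
  have 2: "{\<omega> \<in> space M. \<kappa> j \<omega> \<noteq> 1 \<and> W j \<omega> \<in> B} \<in> sets (off i)" if j: "j \<ge> 1" and B: "B \<in> sets N" for j B
  proof (cases "j = i")
    case True
    have "{\<omega> \<in> space M. \<kappa> j \<omega> \<noteq> 1 \<and> W j \<omega> \<in> B} \<in> events"
      using rv_\<kappa>[OF j] rv_W[OF j] B by measurable
    moreover have "?E \<inter> {\<omega> \<in> space M. \<kappa> j \<omega> \<noteq> 1 \<and> W j \<omega> \<in> B} = {}" using True by auto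
    ultimately show ?thesis using i by (simp add: sets_off)
  next
    case False
    have "{\<omega> \<in> space M. \<kappa> j \<omega> \<in> - {1}} \<inter> (W j -` B \<inter> space M) \<in> sets (rest i)"
      using label_in_rest[OF j, of "- {1}" i] measurable_sets[OF W_in_rest[OF j False] B]
      by (metis sets.Int space_rest)
    moreover have "{\<omega> \<in> space M. \<kappa> j \<omega> \<in> - {1}} \<inter> (W j -` B \<inter> space M) = {\<omega> \<in> space M. \<kappa> j \<omega> \<noteq> 1 \<and> W j \<omega> \<in> B}"
      by auto
    ultimately show ?thesis using rest_off[OF i] by auto
  qed
  show ?thesis
    unfolding train_sigma_def sets_measure_of[OF train_generators_events]
  proof (rule sets.sigma_sets_subset[of _ "off i", unfolded space_off[OF i]])
  qed (use 1 2 in auto)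
qed

lemma train_subset: "sets (train n) \<subseteq> events"
  using train_subset_off[of 1 n] by (auto simp: sets_off)

lemma id_train: "(\<lambda>\<omega>. \<omega>) \<in> measurable M (train n)"
  using train_subset[of n] by (intro measurableI) (auto simp: Int_absorb2 sets.sets_into_space)

lemma id_off_train: "i \<ge> 1 \<Longrightarrow> (\<lambda>\<omega>. \<omega>) \<in> measurable (off i) (train n)"
  using train_subset_off[of i n] sets.sets_into_space[of _ "train n"]
  by (intro measurableI) (auto simp: Int_absorb2 space_off)

text \<open>Conditional independence of the first-fold observations given the training information,
  expressed through products of nonnegative functions so that conditional kernels are avoided. The
  observations are integrated out one at a time.\<close>

lemma nn_integral_prod_fold:
  assumes f: "\<And>i. i \<in> {1..n} \<Longrightarrow> f i \<in> borel_measurable (train n \<Otimes>\<^sub>M N)"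
  shows "(\<integral>\<^sup>+ \<omega>. (\<Prod>i\<in>fold_set \<kappa> n 1 \<omega>. f i (\<omega>, W i \<omega>)) \<partial>M) =
    (\<integral>\<^sup>+ \<omega>. (\<Prod>i\<in>fold_set \<kappa> n 1 \<omega>. \<integral>\<^sup>+ w. f i (\<omega>, w) \<partial>P) \<partial>M)"
proof -
  \<comment> \<open>\<open>A\<close> holds the indices already integrated out. Indices outside the
    first fold contribute the factor 1, so the index set of the product no longer depends on
    \<omega>.\<close>
  define g where "g A i \<omega> = (if \<kappa> i \<omega> = 1 then
      if i \<in> A then \<integral>\<^sup>+ w. f i (\<omega>, w) \<partial>P else f i (\<omega>, W i \<omega>) else 1)" for A i \<omega>
  have int: "(\<lambda>\<omega>. \<integral>\<^sup>+ w. f i (\<omega>, w) \<partial>P) \<in> borel_measurable (train n)" if "i \<in> {1..n}" for i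
  proof -
    note [measurable] = f[OF that]
    show ?thesis by (rule P.borel_measurable_nn_integral_fst) measurable
  qed
  have g_off: "g A j \<in> borel_measurable (off i)" if ij: "i \<ge> 1" "j \<in> {1..n}" "j \<noteq> i" for A i j
  proof -
    have [measurable]: "\<kappa> j \<in> measurable (off i) (count_space UNIV)"
      using label_in_rest[of j _ i] rest_off[OF ij(1)] ij(2)
      by (intro measurableI) (auto simp: vimage_def Int_def conj_commute space_off[OF ij(1)])
    have [measurable]: "W j \<in> measurable (off i) N"
      using W_in_rest[of j i] ij by (intro measurable_off) auto
    note [measurable] = id_off_train[OF ij(1), of n] f[OF ij(2)] measurable_compose[OF id_off_train[OF ij(1)] int[OF ij(2)]]
    have [measurable]: "(\<lambda>\<omega>. f j (\<omega>, W j \<omega>)) \<in> borel_measurable (off i)"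
      by measurable
    show ?thesis unfolding g_def by measurable
  qed
  have swap: "(\<integral>\<^sup>+ \<omega>. (\<Prod>j\<in>{1..n}. g (insert i A) j \<omega>) \<partial>M) = (\<integral>\<^sup>+ \<omega>. (\<Prod>j\<in>{1..n}. g A j \<omega>) \<partial>M)"
    if i: "i \<in> {1..n}" "i \<notin> A" for i A
  proof -
    have i1: "i \<ge> 1" using i by simp
    \<comment> \<open>All remaining factors are measurable for \<open>off i\<close>, so they act as
      constants when \<open>W i\<close> is integrated out.\<close>
    define G where "G \<omega> = (\<Prod>j\<in>{1..n} - {i}. g A j \<omega>)" for \<omega>
    have G[measurable]: "G \<in> borel_measurable (off i)"
      unfolding G_def using g_off[OF i1] by (intro borel_measurable_prod_ennreal) auto
    have G_M[measurable]: "G \<in> borel_measurable M" by (rule measurable_off_M[OF i1 G])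
    note [measurable] = id_off_train[OF i1, of n] f[OF i(1)] rv_W[OF i1] id_train[of n]
      measurable_compose[OF id_train int[OF i(1)]] rv_\<kappa>[OF i1]
    let ?E = "{\<omega> \<in> space M. \<kappa> i \<omega> = 1}"
    have prod: "(\<Prod>j\<in>{1..n}. g B j \<omega>) = G \<omega> * g B i \<omega>" if "B = A \<or> B = insert i A" for B \<omega>
    proof -
      have "(\<Prod>j\<in>{1..n} - {i}. g B j \<omega>) = G \<omega>"
        unfolding G_def using that by (intro prod.cong) (auto simp: g_def)
      then show ?thesis using prod.remove[OF _ i(1), of "\<lambda>j. g B j \<omega>"] by (simp add: mult.commute)
    qed
    have split: "(\<integral>\<^sup>+ \<omega>. G \<omega> * (if \<kappa> i \<omega> = 1 then u \<omega> else 1) \<partial>M) =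
        (\<integral>\<^sup>+ \<omega>. indicator ?E \<omega> * (G \<omega> * u \<omega>) \<partial>M) + (\<integral>\<^sup>+ \<omega>. indicator (space M - ?E) \<omega> * G \<omega> \<partial>M)"
      if [measurable]: "u \<in> borel_measurable M" for u
      by (subst nn_integral_add[symmetric]) (auto intro!: nn_integral_cong simp: indicator_def)
    have m1: "(\<lambda>\<omega>. f i (\<omega>, W i \<omega>)) \<in> borel_measurable M" by measurable
    have m2: "(\<lambda>(\<omega>, w). G \<omega> * f i (\<omega>, w)) \<in> borel_measurable (off i \<Otimes>\<^sub>M N)" by measurable
    have m3: "(\<lambda>w. f i (\<omega>, w)) \<in> borel_measurable P" if "\<omega> \<in> space M" for \<omega>
      using measurable_compose[OF measurable_Pair1' f[OF i(1)], of \<omega>] that by simp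
    have "(\<integral>\<^sup>+ \<omega>. (\<Prod>j\<in>{1..n}. g A j \<omega>) \<partial>M) = (\<integral>\<^sup>+ \<omega>. G \<omega> * (if \<kappa> i \<omega> = 1 then f i (\<omega>, W i \<omega>) else 1) \<partial>M)"
      using i prod[of A] by (simp add: g_def[of A i] cong: if_cong)
    also have "\<dots> = (\<integral>\<^sup>+ \<omega>. G \<omega> * (if \<kappa> i \<omega> = 1 then \<integral>\<^sup>+ w. f i (\<omega>, w) \<partial>P else 1) \<partial>M)"
      unfolding split[OF m1] split[OF measurable_compose[OF id_train int[OF i(1)]]]
      using nn_integral_off[OF i1 m2] m3 by (simp add: nn_integral_cmult cong: nn_integral_cong)
    also have "\<dots> = (\<integral>\<^sup>+ \<omega>. (\<Prod>j\<in>{1..n}. g (insert i A) j \<omega>) \<partial>M)"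
      using i prod[of "insert i A"] by (simp add: g_def[of "insert i A" i] cong: if_cong)
    finally show ?thesis ..
  qed
  have "(\<integral>\<^sup>+ \<omega>. (\<Prod>j\<in>{1..n}. g A j \<omega>) \<partial>M) = (\<integral>\<^sup>+ \<omega>. (\<Prod>j\<in>{1..n}. g {} j \<omega>) \<partial>M)"
    if "finite A" "A \<subseteq> {1..n}" for A
    using that
  proof (induction A rule: finite_induct)
    case (insert x F)
    then show ?case using swap[of x F] by simp
  qed simp
  from this[of "{1..n}"] have "(\<integral>\<^sup>+ \<omega>. (\<Prod>j\<in>{1..n}. g {1..n} j \<omega>) \<partial>M) = (\<integral>\<^sup>+ \<omega>. (\<Prod>j\<in>{1..n}. g {} j \<omega>) \<partial>M)"
    by simp
  moreover have "(\<Prod>i\<in>fold_set \<kappa> n 1 \<omega>. h i) = (\<Prod>i\<in>{1..n}. if \<kappa> i \<omega> = 1 then h i else 1)"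
    for h :: "nat \<Rightarrow> ennreal" and \<omega>
    unfolding fold_set_def by (rule prod.inter_filter) simp
  moreover have "(\<Prod>j\<in>{1..n}. g {1..n} j \<omega>) =
      (\<Prod>j\<in>{1..n}. if \<kappa> j \<omega> = 1 then \<integral>\<^sup>+ w. f j (\<omega>, w) \<partial>P else 1)" for \<omega>
    unfolding g_def by (intro prod.cong) auto
  ultimately show ?thesis
    by (simp add: g_def cong: if_cong)
qed

section \<open>Null sets, exponential tails and the largest observation\<close>

lemma P_space_N [simp]: "emeasure P (space N) = 1" "measure P (space N) = 1"
  using P.emeasure_space_1 P.prob_space by simp_all

text \<open>The null set depends on the trained nuisance and hence on \<omega>, so the law of
  \<open>W i\<close> alone does not exclude it; the product identity does.\<close>

lemma AE_fold_avoids_null: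
  assumes D: "D \<in> sets (train n \<Otimes>\<^sub>M N)"
  shows "AE \<omega> in M. (AE w in P. (\<omega>, w) \<notin> D) \<longrightarrow> (\<forall>i\<in>fold_set \<kappa> n 1 \<omega>. (\<omega>, W i \<omega>) \<notin> D)"
proof -
  \<comment> \<open>The value 1 on sections that are not null makes every section integral equal to
    1. The product over the fold is then at most 1 with expectation 1, so almost surely it is 1 and
    no factor vanishes.\<close>
  define f :: "'w \<times> 'd \<Rightarrow> ennreal"
    where "f x = (if emeasure P (Pair (fst x) -` D) = 0 then indicator (- D) x else 1)" for x
  have Dp: "Pair \<omega> -` D \<in> sets P" for \<omega>
    using sets_Pair1[OF D] by simp
  have em: "(\<lambda>\<omega>. emeasure P (Pair \<omega> -` D)) \<in> borel_measurable (train n)"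
    by (rule P.measurable_emeasure_Pair) (use D in measurable)
  have f: "f \<in> borel_measurable (train n \<Otimes>\<^sub>M N)"
    unfolding f_def using D measurable_compose[OF measurable_fst em] by measurable
  have int: "(\<integral>\<^sup>+ w. f (\<omega>, w) \<partial>P) = 1" for \<omega>
  proof (cases "emeasure P (Pair \<omega> -` D) = 0")
    case True
    have "(\<integral>\<^sup>+ w. f (\<omega>, w) \<partial>P) = (\<integral>\<^sup>+ w. indicator (space P - Pair \<omega> -` D) w \<partial>P)"
      unfolding f_def using True by (intro nn_integral_cong) (auto simp: indicator_def)
    also have "\<dots> = emeasure P (space P - Pair \<omega> -` D)"
      using Dp by (intro nn_integral_indicator) auto
    also have "\<dots> = 1"
      using True Dp emeasure_Diff_null_set[of "Pair \<omega> -` D" P "space P"] P.emeasure_space_1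
      by (auto simp: null_sets_def)
    finally show ?thesis .
  qed (use P.emeasure_space_1 in \<open>simp add: f_def\<close>)
  have f01: "f x \<le> 1" for x
    by (auto simp: f_def indicator_def)
  define G where "G \<omega> = (\<Prod>i\<in>fold_set \<kappa> n 1 \<omega>. f (\<omega>, W i \<omega>))" for \<omega>
  have G1: "G \<omega> \<le> 1" for \<omega>
    unfolding G_def by (rule prod_le_1) (use f01 in auto)
  have Geq: "G \<omega> = (\<Prod>i\<in>{1..n}. if \<kappa> i \<omega> = 1 then f (\<omega>, W i \<omega>) else 1)" for \<omega>
    unfolding G_def fold_set_def by (rule prod.inter_filter) simp
  have "(\<lambda>\<omega>. if \<kappa> i \<omega> = 1 then f (\<omega>, W i \<omega>) else 1) \<in> borel_measurable M" if "i \<in> {1..n}" for i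
  proof -
    have i: "1 \<le> i" using that by simp
    note [measurable] = rv_\<kappa>[OF i] rv_W[OF i] id_train[of n] f
    show ?thesis by measurable
  qed
  then have Gm[measurable]: "G \<in> borel_measurable M"
    unfolding Geq[abs_def] by (rule borel_measurable_prod_ennreal)
  have "(\<integral>\<^sup>+ \<omega>. G \<omega> \<partial>M) = 1"
    unfolding G_def using nn_integral_prod_fold[of n "\<lambda>_. f"] f by (simp add: int emeasure_space_1)
  then have "(\<integral>\<^sup>+ \<omega>. 1 - G \<omega> \<partial>M) = 0"
    using G1 by (subst nn_integral_diff) (auto simp: emeasure_space_1)
  then have "AE \<omega> in M. 1 - G \<omega> = 0"
    by (subst (asm) nn_integral_0_iff_AE) auto
  then show ?thesis
  proof eventually_elim
    case (elim \<omega>)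
    have G: "G \<omega> = 1" by (rule order.antisym[OF G1 ennreal_minus_eq_0[OF elim]])
    show ?case
    proof (intro impI ballI)
      assume null: "AE w in P. (\<omega>, w) \<notin> D"
      fix i assume i: "i \<in> fold_set \<kappa> n 1 \<omega>"
      have "emeasure P (Pair \<omega> -` D) = 0"
      proof -
        have "Pair \<omega> -` D \<in> null_sets P"
          by (rule AE_iff_null_sets[THEN iffD2]) (use Dp null in auto)
        then show ?thesis by auto
      qed
      show "(\<omega>, W i \<omega>) \<notin> D"
      proof
        assume "(\<omega>, W i \<omega>) \<in> D"
        then have "f (\<omega>, W i \<omega>) = 0"
          unfolding f_def using \<open>emeasure P (Pair \<omega> -` D) = 0\<close> by simp
        then have "G \<omega> = 0"
          unfolding G_def using i by (intro prod_zero) (auto simp: fold_set_def)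
        with G show False by simp
      qed
    qed
  qed
qed

text \<open>Dividing every exponential by its integral under \<open>P\<close> gives the product over
  the fold expectation exactly 1, whatever the training. The index \<open>j\<close> is kept apart
  from the sample size \<open>n j\<close>, so along a sparse sequence the union bound costs only
  \<open>ln j\<close>.\<close>

lemma exp_sum_fold_le:
  fixes F :: "nat \<Rightarrow> 'w \<times> 'd \<Rightarrow> real" and n :: "nat \<Rightarrow> nat" and J :: "nat \<Rightarrow> nat set"
  assumes F: "\<And>j. F j \<in> borel_measurable (train (n j) \<Otimes>\<^sub>M N)" and bdd: "\<And>j x. \<bar>F j x\<bar> \<le> b j"
  shows "AE \<omega> in M. \<forall>\<^sub>F j in sequentially.
    (\<Sum>i\<in>fold_set \<kappa> (n j) 1 \<omega> \<inter> J j. F j (\<omega>, W i \<omega>)) \<le>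
      real (card (fold_set \<kappa> (n j) 1 \<omega> \<inter> J j)) * ln (\<integral>w. exp (F j (\<omega>, w)) \<partial>P) + 2 * ln (real j)"
proof -
  define m where "m j \<omega> = (\<integral>w. exp (F j (\<omega>, w)) \<partial>P)" for j \<omega>
  define S where "S j \<omega> = (\<Sum>i\<in>fold_set \<kappa> (n j) 1 \<omega> \<inter> J j. F j (\<omega>, W i \<omega>) - ln (m j \<omega>))" for j \<omega>
  have Fs: "(\<lambda>w. F j (\<omega>, w)) \<in> borel_measurable P" if "\<omega> \<in> space M" for j \<omega>
    using measurable_compose[OF measurable_Pair1' F[of j], of \<omega>] that by simp
  have ub: "F j x \<le> b j" and lb: "- b j \<le> F j x" for j x
    using bdd[of j x] by auto
  have int: "integrable P (\<lambda>w. exp (F j (\<omega>, w)))" if "\<omega> \<in> space M" for j \<omega>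
    by (rule P.integrable_const_bound[where B="exp (b j)"])
       (use ub Fs[OF that] in simp_all)
  have m_pos: "m j \<omega> > 0" if "\<omega> \<in> space M" for j \<omega>
  proof -
    have "exp (- b j) = (\<integral>w. exp (- b j) \<partial>P)" by (simp add: P.prob_space)
    also have "\<dots> \<le> m j \<omega>"
      unfolding m_def using lb by (intro integral_mono int[OF that]) simp_all
    finally show ?thesis by (meson exp_gt_zero order_less_le_trans)
  qed
  have m_meas: "m j \<in> borel_measurable (train (n j))" for j
  proof -
    have "(\<lambda>(\<omega>, w). exp (F j (\<omega>, w))) \<in> borel_measurable (train (n j) \<Otimes>\<^sub>M P)"
      using F[of j] by measurable
    then show ?thesis unfolding m_def by (rule P.borel_measurable_lebesgue_integral)
  qed
  \<comment> \<open>The value 1 outside \<open>J j\<close> lets the identity for whole folds be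
    applied to a window of indices.\<close>
  define f where "f j i x = (if i \<in> J j then ennreal (exp (F j x - ln (m j (fst x)))) else 1)" for j and i :: nat and x
  have f: "f j i \<in> borel_measurable (train (n j) \<Otimes>\<^sub>M N)" for j i
  proof -
    note [measurable] = F[of j] measurable_compose[OF measurable_fst m_meas[of j]]
    show ?thesis unfolding f_def by measurable
  qed
  have fint: "(\<integral>\<^sup>+ w. f j i (\<omega>, w) \<partial>P) = 1" if "\<omega> \<in> space M" for j i \<omega>
  proof (cases "i \<in> J j")
    case True
    have "(\<integral>\<^sup>+ w. f j i (\<omega>, w) \<partial>P) = (\<integral>\<^sup>+ w. ennreal (exp (F j (\<omega>, w)) / m j \<omega>) \<partial>P)"
      using True m_pos[OF that, of j] by (simp add: f_def exp_diff)
    also have "\<dots> = ennreal (\<integral>w. exp (F j (\<omega>, w)) / m j \<omega> \<partial>P)"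
      by (rule nn_integral_eq_integral) (use int[OF that, of j] m_pos[OF that, of j] in simp_all)
    also have "\<dots> = 1"
      using m_pos[OF that, of j] by (simp add: m_def)
    finally show ?thesis .
  qed (use P.emeasure_space_1 in \<open>simp add: f_def\<close>)
  have expS: "ennreal (exp (S j \<omega>)) = (\<Prod>i\<in>fold_set \<kappa> (n j) 1 \<omega>. f j i (\<omega>, W i \<omega>))" for j \<omega>
  proof -
    have fin: "finite (fold_set \<kappa> (n j) 1 \<omega>)" by (simp add: fold_set_def)
    have "ennreal (exp (S j \<omega>)) =
        (\<Prod>i\<in>fold_set \<kappa> (n j) 1 \<omega> \<inter> J j. ennreal (exp (F j (\<omega>, W i \<omega>) - ln (m j \<omega>))))"
      unfolding S_def using fin by (subst exp_sum) (auto simp: prod_ennreal)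
    also have "fold_set \<kappa> (n j) 1 \<omega> \<inter> J j = {i \<in> fold_set \<kappa> (n j) 1 \<omega>. i \<in> J j}" by auto
    also have "(\<Prod>i\<in>\<dots>. ennreal (exp (F j (\<omega>, W i \<omega>) - ln (m j \<omega>)))) =
        (\<Prod>i\<in>fold_set \<kappa> (n j) 1 \<omega>. f j i (\<omega>, W i \<omega>))"
      by (subst prod.inter_filter[OF fin]) (simp add: f_def cong: if_cong)
    finally show ?thesis .
  qed
  have Sm[measurable]: "S j \<in> borel_measurable M" for j
  proof -
    have Seq: "S j \<omega> = (\<Sum>i\<in>{1..n j}. if \<kappa> i \<omega> = 1 \<and> i \<in> J j then F j (\<omega>, W i \<omega>) - ln (m j \<omega>) else 0)" for \<omega>
      unfolding S_def by (subst sum.inter_filter[symmetric]) (auto simp: fold_set_def intro!: sum.cong)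
    have "(\<lambda>\<omega>. if \<kappa> i \<omega> = 1 \<and> i \<in> J j then F j (\<omega>, W i \<omega>) - ln (m j \<omega>) else 0) \<in> borel_measurable M"
      if "i \<in> {1..n j}" for i
    proof -
      have i: "1 \<le> i" using that by simp
      note [measurable] = rv_\<kappa>[OF i] rv_W[OF i] id_train[of "n j"] F[of j] measurable_compose[OF id_train m_meas[of j]]
      show ?thesis by measurable
    qed
    then show ?thesis
      unfolding Seq[abs_def] by (rule borel_measurable_sum)
  qed
  have expect: "(\<integral>\<^sup>+ \<omega>. ennreal (exp (S j \<omega>)) \<partial>M) = 1" for j
    unfolding expS using nn_integral_prod_fold[of "n j" "f j", OF f]
    by (simp add: fint emeasure_space_1 cong: nn_integral_cong)
  \<comment> \<open>By the exponential Markov inequality this threshold is reached with probability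
    at most \<open>1 / (real j)\<^sup>2\<close>, which is summable.\<close>
  define A where "A j = {\<omega> \<in> space M. S j \<omega> \<ge> 2 * ln (real j)}" for j
  have A[measurable]: "A j \<in> events" for j unfolding A_def by measurable
  have pA: "prob (A j) \<le> 1 / (real j)\<^sup>2" if j: "j \<ge> 1" for j
  proof -
    have "emeasure M (A j) \<le> ennreal (exp (- 1 * (2 * ln (real j)))) *
        (\<integral>\<^sup>+ \<omega>. ennreal (exp (1 * S j \<omega>)) * indicator (space M) \<omega> \<partial>M)"
      unfolding A_def by (rule Chernoff_ineq_nn_integral_ge) auto
    also have "(\<integral>\<^sup>+ \<omega>. ennreal (exp (1 * S j \<omega>)) * indicator (space M) \<omega> \<partial>M) = 1"
      unfolding expect[of j, symmetric] by (intro nn_integral_cong) auto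
    also have "exp (- 1 * (2 * ln (real j))) = 1 / (real j)\<^sup>2"
      using j by (simp add: exp_minus exp_double divide_inverse)
    finally show ?thesis by (simp add: emeasure_eq_measure)
  qed
  have "summable (\<lambda>j. prob (A j))"
    by (rule summable_comparison_test'[where N=1 and g="\<lambda>j. 1 / (real j)\<^sup>2"])
       (use pA inverse_power_summable[of 2] in \<open>auto simp: field_simps inverse_eq_divide\<close>)
  then have "AE \<omega> in M. \<forall>\<^sub>F j in sequentially. \<omega> \<in> space M - A j"
    by (intro borel_cantelli_AE1) (auto simp: emeasure_eq_measure)
  then show ?thesis
  proof eventually_elim
    case (elim \<omega>)
    then show ?case
      by eventually_elim (auto simp: A_def S_def sum_subtractf m_def)
  qed
qed

text \<open>Markov's inequality for the fourth power bounds the probability that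
  \<open>V (W i \<omega>)\<close> exceeds \<open>i powr (1/3)\<close> by a multiple of the summable
  \<open>i powr (- (4/3))\<close>. The margin between 1/3 and 2/5 absorbs the constant
  \<open>C\<close>, which may therefore be chosen after \<omega>.\<close>

lemma AE_max_envelope:
  assumes V[measurable]: "V \<in> borel_measurable N" and V0: "\<And>w. V w \<ge> (0::real)"
    and V4: "integrable P (\<lambda>w. V w ^ 4)"
  shows "AE \<omega> in M. \<forall>C. \<forall>\<^sub>F n in sequentially. \<forall>i\<in>{1..n}. C * V (W i \<omega>) \<le> real n powr (2/5)"
proof -
  define A where "A i = {\<omega> \<in> space M. i \<ge> 1 \<and> V (W i \<omega>) > real i powr (1/3)}" for i
  have A[measurable]: "A i \<in> events" for i
  proof (cases "i \<ge> 1")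
    case True
    note [measurable] = rv_W[OF True]
    show ?thesis unfolding A_def by measurable
  qed (simp add: A_def)
  define c where "c = (\<integral>w. V w ^ 4 \<partial>P)"
  have pA: "prob (A i) \<le> c * real i powr (- (4/3))" if i: "i \<ge> 1" for i
  proof -
    note [measurable] = rv_W[OF i]
    have "prob (A i) = measure P {w \<in> space N. V w > real i powr (1/3)}"
      unfolding W_law[OF i, symmetric] A_def using i measurable_space[OF rv_W[OF i]]
      by (subst measure_distr) (auto intro!: arg_cong[where f=prob])
    also have "\<dots> \<le> measure P {w \<in> space P. V w ^ 4 \<ge> real i powr (4/3)}"
    proof (rule P.finite_measure_mono)
      have "real i powr (4/3) \<le> V w ^ 4" if "real i powr (1/3) < V w" for w
      proof -
        have "real i powr (4/3) = (real i powr (1/3)) ^ 4"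
          using i by (simp add: powr_power)
        also have "\<dots> \<le> V w ^ 4" using that by (intro power_mono) auto
        finally show ?thesis .
      qed
      then show "{w \<in> space N. V w > real i powr (1/3)} \<subseteq> {w \<in> space P. V w ^ 4 \<ge> real i powr (4/3)}"
        by auto
    qed measurable
    also have "\<dots> \<le> c / real i powr (4/3)"
      unfolding c_def
      by (rule integral_Markov_inequality_measure[where A="{}"]) (use V4 V0 i in simp_all)
    also have "\<dots> = c * real i powr (- (4/3))"
      by (simp only: powr_minus divide_inverse)
    finally show ?thesis .
  qed
  have "summable (\<lambda>i. prob (A i))"
    by (rule summable_comparison_test'[where N=1 and g="\<lambda>i. c * real i powr (- (4/3))"])
       (use pA in \<open>auto intro!: summable_mult simp: summable_real_powr_iff\<close>)
  then have "AE \<omega> in M. \<forall>\<^sub>F i in sequentially. \<omega> \<in> space M - A i"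
    by (intro borel_cantelli_AE1) (auto simp: emeasure_eq_measure)
  then show ?thesis
  proof eventually_elim
    case (elim \<omega>)
    then obtain m where m: "\<And>i. i \<ge> m \<Longrightarrow> \<omega> \<in> space M - A i"
      unfolding eventually_sequentially by blast
    \<comment> \<open>Absorbs the finitely many indices before the Borel--Cantelli bound takes
      effect.\<close>
    define B where "B = (\<Sum>i\<in>{..m}. V (W i \<omega>))"
    have B0: "B \<ge> 0" unfolding B_def using V0 by (intro sum_nonneg) auto
    have bd: "V (W i \<omega>) \<le> B + real n powr (1/3)" if "i \<in> {1..n}" for i n
    proof (cases "i \<ge> m")
      case True
      then have "V (W i \<omega>) \<le> real i powr (1/3)" using m[OF True] that by (auto simp: A_def)
      also have "\<dots> \<le> real n powr (1/3)" using that by (intro powr_mono2) auto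
      finally show ?thesis using B0 by simp
    next
      case False
      then have "V (W i \<omega>) \<le> B"
        unfolding B_def using V0 by (intro member_le_sum) auto
      then show ?thesis by (simp add: add_increasing2)
    qed
    show ?case
    proof
      fix C :: real
      have "(\<lambda>n. (B + real n powr (1/3)) / real n powr (2/5)) \<longlonglongrightarrow> 0"
        by real_asymp
      from tendsto_mult_right_zero[OF this, of "\<bar>C\<bar>"]
      have "\<forall>\<^sub>F n in sequentially. \<bar>C\<bar> * ((B + real n powr (1/3)) / real n powr (2/5)) < 1"
        by (rule order_tendstoD) simp
      then show "\<forall>\<^sub>F n in sequentially. \<forall>i\<in>{1..n}. C * V (W i \<omega>) \<le> real n powr (2/5)"
        using eventually_gt_at_top[of 0]
      proof eventually_elim
        case (elim n)
        show ?case
        proof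
          fix i assume i: "i \<in> {1..n}"
          have "C * V (W i \<omega>) \<le> \<bar>C\<bar> * V (W i \<omega>)" using V0 by (intro mult_right_mono) auto
          also have "\<dots> \<le> \<bar>C\<bar> * (B + real n powr (1/3))" using bd[OF i] by (intro mult_left_mono) auto
          also have "\<dots> \<le> real n powr (2/5)" using elim by (simp add: field_simps)
          finally show "C * V (W i \<omega>) \<le> real n powr (2/5)" .
        qed
      qed
    qed
  qed
qed

section \<open>Deviations of first-fold sums over a window of indices\<close>

lemma measurable_train_section:
  assumes "f \<in> borel_measurable (train n \<Otimes>\<^sub>M N)" "\<omega> \<in> space M"
  shows "(\<lambda>w. f (\<omega>, w)) \<in> borel_measurable P"
  using measurable_compose[OF measurable_Pair1' assms(1), of \<omega>] assms(2) by simp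

text \<open>The constant \<open>C\<close> depends on \<omega>, whereas null sets may be discarded
  only countably often. Rounding \<open>C\<close> up to a natural number leaves countably many
  bounds and preserves domination because \<open>V\<close> is nonnegative.\<close>

lemma AE_fold_dominated:
  fixes R :: "nat \<Rightarrow> 'w \<times> 'd \<Rightarrow> real"
  assumes R[measurable]: "\<And>j. R j \<in> borel_measurable (train (n j) \<Otimes>\<^sub>M N)"
    and V[measurable]: "V \<in> borel_measurable N" and V0: "\<And>w. V w \<ge> (0::real)"
  shows "AE \<omega> in M. \<forall>C j. (AE w in P. \<bar>R j (\<omega>, w)\<bar> \<le> C * V w) \<longrightarrow>
    (\<forall>i\<in>fold_set \<kappa> (n j) 1 \<omega>. \<bar>R j (\<omega>, W i \<omega>)\<bar> \<le> real (nat \<lceil>C\<rceil>) * V (W i \<omega>))"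
proof -
  let ?D = "\<lambda>j m. {x \<in> space (train (n j) \<Otimes>\<^sub>M N). \<bar>R j x\<bar> > real m * V (snd x)}"
  have D: "?D j m \<in> sets (train (n j) \<Otimes>\<^sub>M N)" for j m
    by measurable
  have "AE \<omega> in M. \<forall>j m. (AE w in P. (\<omega>, w) \<notin> ?D j m) \<longrightarrow> (\<forall>i\<in>fold_set \<kappa> (n j) 1 \<omega>. (\<omega>, W i \<omega>) \<notin> ?D j m)"
    unfolding AE_all_countable using AE_fold_avoids_null[OF D] by blast
  with AE_space show ?thesis
  proof eventually_elim
    case (elim \<omega>)
    show ?case
    proof (intro allI impI ballI)
      fix C j i
      assume AE: "AE w in P. \<bar>R j (\<omega>, w)\<bar> \<le> C * V w" and i: "i \<in> fold_set \<kappa> (n j) 1 \<omega>"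
      have le: "C * V w \<le> real (nat \<lceil>C\<rceil>) * V w" for w
        using V0[of w] by (intro mult_right_mono) (auto intro: real_nat_ceiling_ge)
      have "AE w in P. (\<omega>, w) \<notin> ?D j (nat \<lceil>C\<rceil>)"
        using AE by eventually_elim (auto simp: not_less intro: order.trans[OF _ le])
      then have "(\<omega>, W i \<omega>) \<notin> ?D j (nat \<lceil>C\<rceil>)"
        using elim(2) i by blast
      moreover have "W i \<omega> \<in> space N"
        using i elim(1) by (intro measurable_space[OF rv_W]) (auto simp: fold_set_def)
      ultimately show "\<bar>R j (\<omega>, W i \<omega>)\<bar> \<le> real (nat \<lceil>C\<rceil>) * V (W i \<omega>)"
        using elim(1) by (auto simp: space_pair_measure)
    qed
  qed
qed

text \<open>The arithmetic of \<open>fold_deviation\<close>: \<open>up\<close> and \<open>dn\<close>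
  are the two exponential bounds, to be divided by \<open>lam\<close>, and \<open>1 / lam\<close>
  equals \<open>sqrt (n * ln n) / (c * ln n)\<close>. Here \<open>cJ\<close> is the window size,
  \<open>k\<close> the number of fold members in it, and \<open>D\<close> bounds the truncation
  bias.\<close>

lemma deviation_bound_algebra:
  fixes S mT mR vT vR k cJ n c B lam b D j :: real
  assumes n: "n > 1" and c: "c > 0" and lam: "lam = c * sqrt (ln n / n)"
    and up: "lam * S \<le> k * (lam * mT + lam\<^sup>2 * vT) + 2 * ln j"
    and dn: "- lam * S \<le> k * (- lam * mT + lam\<^sup>2 * vT) + 2 * ln j"
    and k: "0 \<le> k" "k \<le> cJ" "cJ \<le> n" and v: "0 \<le> vT" "vT \<le> vR"
    and m: "\<bar>mT - mR\<bar> \<le> D" and nD: "n * D \<le> \<tau> * sqrt (n * ln n)"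
  shows "\<bar>S - k * mR\<bar> \<le> sqrt (n * ln n) * (c * (cJ / n) * vR + 2 * ln j / (c * ln n) + \<tau>)"
proof -
  have ln: "ln n > 0" using n by simp
  have lam0: "lam > 0" using n c ln by (simp add: lam)
  have "lam * (S - k * mT) \<le> lam * (k * lam * vT + 2 * ln j / lam)"
    using up lam0 by (simp add: algebra_simps power2_eq_square)
  then have 1: "S - k * mT \<le> k * lam * vT + 2 * ln j / lam"
    using lam0 by simp
  have "lam * (k * mT - S) \<le> lam * (k * lam * vT + 2 * ln j / lam)"
    using dn lam0 by (simp add: algebra_simps power2_eq_square)
  then have 2: "k * mT - S \<le> k * lam * vT + 2 * ln j / lam"
    using lam0 by simp
  have "\<bar>k * mT - k * mR\<bar> = k * \<bar>mT - mR\<bar>" using k by (simp add: abs_mult flip: right_diff_distrib)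
  also have "\<dots> \<le> n * D" using k m by (intro mult_mono) auto
  finally have 3: "\<bar>k * mT - k * mR\<bar> \<le> \<tau> * sqrt (n * ln n)" using nD by linarith
  have sq: "sqrt (n * ln n) * (1 / n) = sqrt (ln n / n)" "sqrt (n * ln n) / ln n * sqrt (ln n / n) = 1"
    using n ln by (simp_all add: real_sqrt_mult real_sqrt_divide field_simps)
  have "k * lam * vT \<le> cJ * lam * vR"
    using k v lam0 by (intro mult_mono) auto
  also have "\<dots> = sqrt (n * ln n) * (c * (cJ / n) * vR)"
    unfolding lam sq(1)[symmetric] by (simp add: field_simps)
  finally have 4: "k * lam * vT \<le> sqrt (n * ln n) * (c * (cJ / n) * vR)" .
  have "sqrt (n * ln n) / (c * ln n) * lam = sqrt (n * ln n) / ln n * sqrt (ln n / n)"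
    using c by (simp add: lam)
  then have "1 / lam = sqrt (n * ln n) / (c * ln n)"
    using lam0 n unfolding sq(2) by (simp add: field_simps)
  then have 5: "2 * ln j / lam = sqrt (n * ln n) * (2 * ln j / (c * ln n))"
    by (metis (no_types, opaque_lifting) mult.commute mult.right_neutral times_divide_eq_left times_divide_eq_right)
  show ?thesis
    using 1 2 3 4 unfolding 5 by (simp add: distrib_left mult.commute)
qed

text \<open>A tilt \<open>lam\<close> gives the deviation
  \<open>k * lam * v + 2 * ln j / lam\<close>. With \<open>lam = c * sqrt (ln n / n)\<close> the
  first term has at most the order \<open>sqrt (n * ln n)\<close>, and so has the second if
  \<open>ln j\<close> is of order \<open>ln n\<close>; \<open>c\<close> trades one against the
  other. The window size multiplies only the variance term, which makes short windows cheap.\<close>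

lemma fold_deviation:
  fixes R :: "nat \<Rightarrow> 'w \<times> 'd \<Rightarrow> real" and n :: "nat \<Rightarrow> nat" and J :: "nat \<Rightarrow> nat set"
  assumes R: "\<And>j. R j \<in> borel_measurable (train (n j) \<Otimes>\<^sub>M N)"
    and n: "filterlim n at_top sequentially" and J: "\<And>j. J j \<subseteq> {1..n j}"
    and V: "V \<in> borel_measurable N" and V0: "\<And>w. V w \<ge> 0"
    and V4: "integrable P (\<lambda>w. V w ^ 4)"
    and dom: "AE \<omega> in M. \<exists>C. \<forall>\<^sub>F j in sequentially. AE w in P. \<bar>R j (\<omega>, w)\<bar> \<le> C * V w"
    and c: "c > 0" and \<tau>: "\<tau> > 0"
  shows "AE \<omega> in M. \<forall>\<^sub>F j in sequentially.
    \<bar>(\<Sum>i\<in>fold_set \<kappa> (n j) 1 \<omega> \<inter> J j. R j (\<omega>, W i \<omega>)) -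
      real (card (fold_set \<kappa> (n j) 1 \<omega> \<inter> J j)) * (\<integral>w. R j (\<omega>, w) \<partial>P)\<bar>
    \<le> sqrt (real (n j) * ln (real (n j))) *
      (c * (real (card (J j)) / real (n j)) * (\<integral>w. (R j (\<omega>, w))\<^sup>2 \<partial>P) + 2 * ln (real j) / (c * ln (real (n j))) + \<tau>)"
proof -
  \<comment> \<open>The exponent exceeds 1/3, so that truncation is eventually inactive on the
    sample, and is below 1/2, so that \<open>lam j * b j\<close> tends to 0. The truncation bias of
    the sum has order \<open>n / b ^ 3 = n powr (- 1/5)\<close>.\<close>
  define b where "b j = real (n j) powr (2/5)" for j
  define lam where "lam j = c * sqrt (ln (real (n j)) / real (n j))" for j
  define T where "T j x = (if \<bar>R j x\<bar> \<le> b j then R j x else 0)" for j x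
  \<comment> \<open>The cut-off bounds \<open>F\<close> by 1 at every index when \<open>s\<close> is
    a sign; from some index on it does not act, since \<open>lam j * b j\<close> tends to 0. The
    sign \<open>s\<close> selects the upper or the lower tail.\<close>
  define F where "F s j x = (if \<bar>s * lam j * b j\<bar> \<le> 1 then s * lam j * T j x else 0)" for s j x
  have T: "T j \<in> borel_measurable (train (n j) \<Otimes>\<^sub>M N)" for j
    using R[of j] unfolding T_def by measurable
  have F: "F s j \<in> borel_measurable (train (n j) \<Otimes>\<^sub>M N)" for s j
    using T[of j] unfolding F_def by measurable
  have T_le: "\<bar>T j x\<bar> \<le> b j" for j x
    by (auto simp: T_def b_def)
  have F_le: "\<bar>F s j x\<bar> \<le> 1" for s j x
  proof -
    have "\<bar>s * lam j * T j x\<bar> \<le> \<bar>s * lam j * b j\<bar>"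
      using T_le[of j x] unfolding abs_mult by (intro mult_left_mono) auto
    then show ?thesis by (auto simp: F_def)
  qed
  note AE1 = exp_sum_fold_le[of "F 1" n "\<lambda>_. 1" J, OF F F_le]
    exp_sum_fold_le[of "F (-1)" n "\<lambda>_. 1" J, OF F F_le]
  define v4 where "v4 = (\<integral>w. V w ^ 4 \<partial>P)"
  have lim: "\<forall>\<^sub>F j in sequentially. n j > 1 \<and> c * sqrt (ln (real (n j)) / real (n j)) * real (n j) powr (2/5) \<le> 1 \<and>
      real (n j) * (D / (real (n j) powr (2/5)) ^ 3) \<le> \<tau> * sqrt (real (n j) * ln (real (n j)))" for D
  proof -
    have "(\<lambda>n::nat. c * (sqrt (ln (real n) / real n) * real n powr (2/5))) \<longlonglongrightarrow> 0"
      by (rule tendsto_mult_right_zero) real_asymp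
    then have 1: "\<forall>\<^sub>F n::nat in sequentially. c * (sqrt (ln (real n) / real n) * real n powr (2/5)) < 1"
      by (rule order_tendstoD) simp
    have "(\<lambda>n::nat. D * (real n * (1 / (real n powr (2/5)) ^ 3) / sqrt (real n * ln (real n)))) \<longlonglongrightarrow> 0"
      by (rule tendsto_mult_right_zero) real_asymp
    then have 2: "\<forall>\<^sub>F n::nat in sequentially. D * (real n * (1 / (real n powr (2/5)) ^ 3) / sqrt (real n * ln (real n))) < \<tau>"
      by (rule order_tendstoD) (rule \<tau>)
    have "\<forall>\<^sub>F n::nat in sequentially. n > 1 \<and> c * sqrt (ln (real n) / real n) * real n powr (2/5) \<le> 1 \<and>
      real n * (D / (real n powr (2/5)) ^ 3) \<le> \<tau> * sqrt (real n * ln (real n))"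
      using 1 2 eventually_gt_at_top[of 1]
    proof eventually_elim
      case (elim n)
      have "sqrt (real n * ln (real n)) > 0" using elim by simp
      with elim show ?case by (simp add: field_simps)
    qed
    then show ?thesis
      by (rule eventually_compose_filterlim[OF _ n])
  qed
  show ?thesis
    using AE1 AE_space dom AE_fold_dominated[of R n V, OF R V V0] AE_max_envelope[OF V V0 V4]
  proof eventually_elim
    case (elim \<omega>)
    obtain C where C: "\<forall>\<^sub>F j in sequentially. AE w in P. \<bar>R j (\<omega>, w)\<bar> \<le> C * V w"
      using elim(4) by blast
    have env: "\<forall>\<^sub>F j in sequentially. \<forall>i\<in>{1..n j}. real (nat \<lceil>C\<rceil>) * V (W i \<omega>) \<le> real (n j) powr (2/5)"
      by (rule eventually_compose_filterlim[OF _ n]) (use elim(6) in blast)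
    show ?case
      using elim(1,2) C env lim[of "C ^ 4 * v4"]
    proof eventually_elim
      case (elim j)
      let ?I = "fold_set \<kappa> (n j) 1 \<omega> \<inter> J j"
      note n1 = elim(5)
      have I: "?I \<subseteq> {1..n j}" "finite ?I" by (auto simp: fold_set_def)
      have b0: "b j > 0" using n1 by (simp add: b_def)
      have lam0: "lam j \<ge> 0" using c n1 by (simp add: lam_def)
      have "lam j * b j \<le> 1" using n1 by (simp add: lam_def b_def)
      then have Feq: "F s j x = s * lam j * T j x" if "s = 1 \<or> s = -1" for s x
        using that lam0 b0 by (auto simp: F_def)
      have Rj: "(\<lambda>w. R j (\<omega>, w)) \<in> borel_measurable P"
        by (rule measurable_train_section[OF R \<open>\<omega> \<in> space M\<close>])
      have Fj: "(\<lambda>w. F s j (\<omega>, w)) \<in> borel_measurable P" for s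
        by (rule measurable_train_section[OF F \<open>\<omega> \<in> space M\<close>])
      note tail = P.truncation_bounds[OF Rj elim(3) b0 V4, folded v4_def, folded T_def]
      \<comment> \<open>On the sample the envelope stays below the truncation level, so the
        truncated and the original sums agree.\<close>
      have sumeq: "(\<Sum>i\<in>?I. T j (\<omega>, W i \<omega>)) = (\<Sum>i\<in>?I. R j (\<omega>, W i \<omega>))"
      proof (rule sum.cong)
        fix i assume i: "i \<in> ?I"
        then have "\<bar>R j (\<omega>, W i \<omega>)\<bar> \<le> real (nat \<lceil>C\<rceil>) * V (W i \<omega>)"
          using \<open>\<forall>C j. _ C j\<close> elim(3) by blast
        also have "\<dots> \<le> b j"
          using elim(4) i I unfolding b_def by blast
        finally show "T j (\<omega>, W i \<omega>) = R j (\<omega>, W i \<omega>)" by (simp add: T_def)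
      qed simp
      have key: "s * lam j * (\<Sum>i\<in>?I. T j (\<omega>, W i \<omega>)) \<le>
          real (card ?I) * (s * lam j * (\<integral>w. T j (\<omega>, w) \<partial>P) + (lam j)\<^sup>2 * (\<integral>w. (T j (\<omega>, w))\<^sup>2 \<partial>P)) + 2 * ln (real j)"
        if s: "s = 1 \<or> s = -1"
          and le: "(\<Sum>i\<in>?I. F s j (\<omega>, W i \<omega>)) \<le> real (card ?I) * ln (\<integral>w. exp (F s j (\<omega>, w)) \<partial>P) + 2 * ln (real j)" for s
      proof -
        have s2: "(s * lam j * t)\<^sup>2 = (lam j)\<^sup>2 * t\<^sup>2" for t
          using s by (auto simp: power_mult_distrib)
        have "ln (\<integral>w. exp (F s j (\<omega>, w)) \<partial>P) \<le> (\<integral>w. F s j (\<omega>, w) \<partial>P) + (\<integral>w. (F s j (\<omega>, w))\<^sup>2 \<partial>P)"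
          by (rule P.ln_mgf_le[OF Fj F_le])
        also have "\<dots> = s * lam j * (\<integral>w. T j (\<omega>, w) \<partial>P) + (lam j)\<^sup>2 * (\<integral>w. (T j (\<omega>, w))\<^sup>2 \<partial>P)"
          unfolding Feq[OF s] s2 by simp
        finally have "real (card ?I) * ln (\<integral>w. exp (F s j (\<omega>, w)) \<partial>P) \<le>
          real (card ?I) * (s * lam j * (\<integral>w. T j (\<omega>, w) \<partial>P) + (lam j)\<^sup>2 * (\<integral>w. (T j (\<omega>, w))\<^sup>2 \<partial>P))"
          by (intro mult_left_mono) auto
        moreover have "(\<Sum>i\<in>?I. F s j (\<omega>, W i \<omega>)) = s * lam j * (\<Sum>i\<in>?I. T j (\<omega>, W i \<omega>))"
          unfolding Feq[OF s] by (simp add: sum_distrib_left)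
        ultimately show ?thesis using le by linarith
      qed
      have cI: "card ?I \<le> card (J j)" "card (J j) \<le> n j"
        using card_mono[of "J j" ?I] card_mono[OF _ J[of j]] finite_subset[OF J[of j]] by auto
      show ?case
        unfolding sumeq[symmetric]
        by (rule deviation_bound_algebra[where lam="lam j" and vT="\<integral>w. (T j (\<omega>, w))\<^sup>2 \<partial>P"
              and mT="\<integral>w. T j (\<omega>, w) \<partial>P" and D="C ^ 4 * v4 / b j ^ 3"])
           (use n1 c key[of 1] key[of "-1"] elim(1,2) cI tail in \<open>auto simp: lam_def b_def integral_nonneg_AE\<close>)
    qed
  qed
qed

section \<open>Limits of normalised first-fold sums\<close>

abbreviation "I1 n \<omega> \<equiv> fold_set \<kappa> n 1 \<omega>"

lemma fold_deviation_all:
  fixes R :: "nat \<Rightarrow> 'w \<times> 'd \<Rightarrow> real"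
  assumes R: "\<And>n. R n \<in> borel_measurable (train n \<Otimes>\<^sub>M N)"
    and V: "V \<in> borel_measurable N" and V0: "\<And>w. V w \<ge> 0" and V4: "integrable P (\<lambda>w. V w ^ 4)"
    and dom: "AE \<omega> in M. \<exists>C. \<forall>\<^sub>F n in sequentially. AE w in P. \<bar>R n (\<omega>, w)\<bar> \<le> C * V w"
    and c: "c > 0"
  shows "AE \<omega> in M. \<forall>\<^sub>F n in sequentially.
    \<bar>(\<Sum>i\<in>I1 n \<omega>. R n (\<omega>, W i \<omega>)) - real (card (I1 n \<omega>)) * (\<integral>w. R n (\<omega>, w) \<partial>P)\<bar>
    \<le> sqrt (real n * ln (real n)) * (c * (\<integral>w. (R n (\<omega>, w))\<^sup>2 \<partial>P) + 3 / c)"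
proof -
  \<comment> \<open>With \<open>n j = j\<close> the tail term is \<open>2 / c\<close>; the choice
    \<open>\<tau> = 1 / c\<close> completes it to \<open>3 / c\<close>.\<close>
  have c1: "1 / c > 0" using c by simp
  show ?thesis
    using fold_deviation[where R=R and n="\<lambda>n. n" and J="\<lambda>n. {1..n}", OF R filterlim_ident order_refl V V0 V4 dom c c1]
  proof eventually_elim
    case (elim \<omega>)
    then show ?case
      using eventually_gt_at_top[of 1]
    proof eventually_elim
      case (elim n)
      have "c * (real (card {1..n}) / real n) * v + 2 * ln (real n) / (c * ln (real n)) + 1 / c = c * v + 3 / c" for v
        using elim(2) c by simp
      then show ?case using elim(1) by (simp only: fold_set_Int_all)
    qed
  qed
qed

text \<open>A large \<open>c\<close> makes \<open>3 / c\<close> small, and the vanishing second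
  moment then takes care of \<open>c\<close> times it. Integer values of \<open>c\<close> suffice,
  which keeps the exceptional null sets countable.\<close>

lemma fold_sum_negligible:
  fixes R :: "nat \<Rightarrow> 'w \<times> 'd \<Rightarrow> real"
  assumes R: "\<And>n. R n \<in> borel_measurable (train n \<Otimes>\<^sub>M N)"
    and V: "V \<in> borel_measurable N" and V0: "\<And>w. V w \<ge> 0" and V4: "integrable P (\<lambda>w. V w ^ 4)"
    and dom: "AE \<omega> in M. \<exists>C. \<forall>\<^sub>F n in sequentially. AE w in P. \<bar>R n (\<omega>, w)\<bar> \<le> C * V w"
    and var: "AE \<omega> in M. (\<lambda>n. \<integral>w. (R n (\<omega>, w))\<^sup>2 \<partial>P) \<longlonglongrightarrow> 0"
  shows "AE \<omega> in M. (\<lambda>n. ((\<Sum>i\<in>I1 n \<omega>. R n (\<omega>, W i \<omega>)) -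
      real (card (I1 n \<omega>)) * (\<integral>w. R n (\<omega>, w) \<partial>P)) / sqrt (real n * ln (real n))) \<longlonglongrightarrow> 0"
proof -
  define s where "s n \<omega> = (\<Sum>i\<in>I1 n \<omega>. R n (\<omega>, W i \<omega>)) - real (card (I1 n \<omega>)) * (\<integral>w. R n (\<omega>, w) \<partial>P)" for n \<omega>
  define v where "v n \<omega> = (\<integral>w. (R n (\<omega>, w))\<^sup>2 \<partial>P)" for n \<omega>
  have "AE \<omega> in M. \<forall>m. \<forall>\<^sub>F n in sequentially.
      \<bar>s n \<omega>\<bar> \<le> sqrt (real n * ln (real n)) * (real (Suc m) * v n \<omega> + 3 / real (Suc m))"
    unfolding AE_all_countable s_def v_def
    by (intro allI fold_deviation_all[OF R V V0 V4 dom]) simp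
  with var[folded v_def] show ?thesis
    unfolding s_def[symmetric]
  proof eventually_elim
    case (elim \<omega>)
    show ?case
    proof (rule tendstoI)
      fix e :: real assume e: "e > 0"
      obtain m where m: "3 / real (Suc m) < e / 2"
        using e reals_Archimedean[of "e / 6"] by (auto simp: field_simps inverse_eq_divide)
      have "\<forall>\<^sub>F n in sequentially. real (Suc m) * v n \<omega> < e / 2"
        by (rule order_tendstoD(2)[OF tendsto_mult_right_zero[OF elim(1)]]) (use e in simp)
      moreover from elim(2) have "\<forall>\<^sub>F n in sequentially.
          \<bar>s n \<omega>\<bar> \<le> sqrt (real n * ln (real n)) * (real (Suc m) * v n \<omega> + 3 / real (Suc m))" ..
      ultimately show "\<forall>\<^sub>F n in sequentially. dist (s n \<omega> / sqrt (real n * ln (real n))) 0 < e"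
        using eventually_gt_at_top[of 1]
      proof eventually_elim
        case (elim n)
        define q where "q = sqrt (real n * ln (real n))"
        have q: "q > 0" using elim by (simp add: q_def)
        have "\<bar>s n \<omega>\<bar> \<le> q * (real (Suc m) * v n \<omega> + 3 / real (Suc m))" using elim(2) by (simp add: q_def)
        also have "\<dots> < q * e" using elim(1) m q by (intro mult_strict_left_mono) linarith+
        finally show ?case using q unfolding q_def[symmetric] by (simp add: field_simps)
      qed
    qed
  qed
qed

text \<open>On the coarser scale \<open>n\<close> the choice \<open>c = 1\<close> is enough, with
  the second moment merely bounded by that of the envelope.\<close>

lemma fold_mean_negligible:
  fixes R :: "nat \<Rightarrow> 'w \<times> 'd \<Rightarrow> real"
  assumes R: "\<And>n. R n \<in> borel_measurable (train n \<Otimes>\<^sub>M N)"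
    and V: "V \<in> borel_measurable N" and V0: "\<And>w. V w \<ge> 0" and V4: "integrable P (\<lambda>w. V w ^ 4)"
    and dom: "AE \<omega> in M. \<exists>C. \<forall>\<^sub>F n in sequentially. AE w in P. \<bar>R n (\<omega>, w)\<bar> \<le> C * V w"
  shows "AE \<omega> in M. (\<lambda>n. ((\<Sum>i\<in>I1 n \<omega>. R n (\<omega>, W i \<omega>)) -
      real (card (I1 n \<omega>)) * (\<integral>w. R n (\<omega>, w) \<partial>P)) / real n) \<longlonglongrightarrow> 0"
  using fold_deviation_all[OF R V V0 V4 dom zero_less_one] dom
proof eventually_elim
  case (elim \<omega>)
  define s where "s n = (\<Sum>i\<in>I1 n \<omega>. R n (\<omega>, W i \<omega>)) - real (card (I1 n \<omega>)) * (\<integral>w. R n (\<omega>, w) \<partial>P)" for n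
  obtain C where C: "\<forall>\<^sub>F n in sequentially. AE w in P. \<bar>R n (\<omega>, w)\<bar> \<le> C * V w"
    using elim(2) by blast
  have V2: "integrable P (\<lambda>w. (V w)\<^sup>2)"
    using P.integrable_of_power4(2)[OF _ V4] V by simp
  define B where "B = C\<^sup>2 * (\<integral>w. (V w)\<^sup>2 \<partial>P)"
  have v: "(\<integral>w. (R n (\<omega>, w))\<^sup>2 \<partial>P) \<le> B" if "AE w in P. \<bar>R n (\<omega>, w)\<bar> \<le> C * V w" for n
  proof -
    have "(\<integral>w. (R n (\<omega>, w))\<^sup>2 \<partial>P) \<le> (\<integral>w. C\<^sup>2 * (V w)\<^sup>2 \<partial>P)"
    proof (rule integral_mono_AE')
      show "AE w in P. (R n (\<omega>, w))\<^sup>2 \<le> C\<^sup>2 * (V w)\<^sup>2"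
        using that
      proof eventually_elim
        case (elim w)
        then have "\<bar>R n (\<omega>, w)\<bar>\<^sup>2 \<le> (C * V w)\<^sup>2" by (intro power_mono) auto
        then show ?case by (simp add: power_mult_distrib)
      qed
    qed (use V2 in auto)
    then show ?thesis by (simp add: B_def)
  qed
  have lim: "(\<lambda>n. (B + 3) * (sqrt (real n * ln (real n)) / real n)) \<longlonglongrightarrow> 0"
    by (rule tendsto_mult_right_zero) real_asymp
  show ?case
    unfolding s_def[symmetric]
  proof (rule Lim_null_comparison[OF _ lim])
    show "\<forall>\<^sub>F n in sequentially. norm (s n / real n) \<le> (B + 3) * (sqrt (real n * ln (real n)) / real n)"
      using elim(1) C eventually_gt_at_top[of 1]
    proof eventually_elim
      case (elim n)
      have "\<bar>s n\<bar> \<le> sqrt (real n * ln (real n)) * (1 * (\<integral>w. (R n (\<omega>, w))\<^sup>2 \<partial>P) + 3 / 1)"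
        using elim(1) unfolding s_def .
      also have "\<dots> \<le> sqrt (real n * ln (real n)) * (B + 3)"
        using v[OF elim(2)] elim(3) by (intro mult_left_mono) auto
      finally show ?case
        using elim(3) by (simp add: field_simps)
    qed
  qed
qed

text \<open>For a fixed positive variance \<open>v\<close> no \<open>c\<close> makes
  \<open>c * v + 3 / c\<close> arbitrarily small. Along \<open>j ^ p\<close> the logarithm of the
  sample size is \<open>p * ln j\<close>, which divides the tail term by \<open>p\<close>, so a
  small \<open>c\<close> becomes affordable. Between members of the subsequence the window is short,
  so a large \<open>c\<close> is affordable there.\<close>

lemma fold_sum_iid_negligible:
  fixes g :: "'d \<Rightarrow> real"
  assumes g: "g \<in> borel_measurable N" and g0: "(\<integral>w. g w \<partial>P) = 0"
    and V: "V \<in> borel_measurable N" and V0: "\<And>w. V w \<ge> 0" and V4: "integrable P (\<lambda>w. V w ^ 4)"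
    and dom: "AE w in P. \<bar>g w\<bar> \<le> C * V w"
  shows "AE \<omega> in M. (\<lambda>n. (\<Sum>i\<in>I1 n \<omega>. g (W i \<omega>)) / sqrt (real n * ln (real n))) \<longlonglongrightarrow> 0"
proof -
  define v where "v = (\<integral>w. (g w)\<^sup>2 \<partial>P)"
  have v0: "v \<ge> 0" by (simp add: v_def)
  have gm: "(\<lambda>x. g (snd x)) \<in> borel_measurable (train n \<Otimes>\<^sub>M N)" for n
    using g by measurable
  have dom': "AE \<omega> in M. \<exists>C. \<forall>\<^sub>F n in sequentially. AE w in P. \<bar>g (snd (\<omega>, w))\<bar> \<le> C * V w"
    using dom by (intro AE_I2 exI[of _ C]) simp
  \<comment> \<open>With power \<open>Suc m ^ 2\<close> and \<open>c = 1 / Suc m\<close>, the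
    variance term \<open>c * v\<close>, the tail term \<open>2 / (c * Suc m ^ 2)\<close> and \<tau>
    are all of order \<open>1 / Suc m\<close>.\<close>
  define N' where "N' m j = j ^ (Suc m ^ 2)" for m j :: nat
  \<comment> \<open>The index of the last member of the subsequence that does not exceed
    \<open>n\<close>.\<close>
  define r where "r m n = nat \<lfloor>root (Suc m ^ 2) (real n)\<rfloor>" for m n :: nat
  have N'_lim: "filterlim (N' m) at_top sequentially" for m
    unfolding N'_def by (rule filterlim_at_top_mono[OF filterlim_ident]) (rule eventually_mono[OF eventually_ge_at_top[of 1]], auto intro: self_le_power)
  have r_lim: "filterlim (r m) at_top sequentially" for m
  proof -
    have "filterlim (\<lambda>n. root (Suc m ^ 2) (real n)) at_top sequentially"
      by (rule root_at_top) simp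
    then show ?thesis
      unfolding r_def
      by (intro filterlim_compose[OF filterlim_nat_sequentially] filterlim_compose[OF filterlim_floor_sequentially])
  qed
  have Nr: "N' m (r m n) \<le> n" for m n
  proof -
    have "real (N' m (r m n)) = (real_of_int \<lfloor>root (Suc m ^ 2) (real n)\<rfloor>) ^ (Suc m ^ 2)"
      unfolding N'_def r_def of_nat_power by (subst of_nat_nat) (simp_all add: real_root_ge_zero)
    also have "\<dots> \<le> (root (Suc m ^ 2) (real n)) ^ (Suc m ^ 2)"
      by (intro power_mono) (simp_all add: real_root_ge_zero)
    also have "\<dots> = real n" by (simp add: real_root_pow_pos2)
    finally show ?thesis by simp
  qed
  have A: "AE \<omega> in M. \<forall>m. \<forall>\<^sub>F j in sequentially.
      \<bar>\<Sum>i\<in>I1 (N' m j) \<omega>. g (W i \<omega>)\<bar> \<le> sqrt (real (N' m j) * ln (real (N' m j))) * ((v + 3) / real (Suc m))"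
    (is "AE \<omega> in M. \<forall>m. ?A \<omega> m")
    unfolding AE_all_countable
  proof
    fix m
    define c where "c = 1 / real (Suc m)"
    have c: "c > 0" by (simp add: c_def)
    show "AE \<omega> in M. ?A \<omega> m"
      using fold_deviation[where n="N' m" and J="\<lambda>j. {1..N' m j}" and R="\<lambda>_ x. g (snd x)",
          OF gm N'_lim order_refl V V0 V4 dom' c c]
    proof eventually_elim
      case (elim \<omega>)
      then show ?case
        using eventually_gt_at_top[of 1]
      proof eventually_elim
        case (elim j)
        have lnN: "ln (real (N' m j)) = real (Suc m) ^ 2 * ln (real j)"
          using elim(2) by (simp add: N'_def ln_realpow)
        have N0: "N' m j > 0" using elim(2) by (simp add: N'_def)
        have "2 * ln (real j) / (c * ln (real (N' m j))) = 2 / real (Suc m)"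
          unfolding lnN c_def using elim(2) by (simp add: power2_eq_square)
        then have "c * (real (card {1..N' m j}) / real (N' m j)) * v + 2 * ln (real j) / (c * ln (real (N' m j))) + c = (v + 3) / real (Suc m)"
          using N0 by (simp add: c_def add_divide_distrib)
        then show ?case
          using elim(1) by (simp only: fold_set_Int_all snd_conv g0 v_def[symmetric] mult_zero_right diff_0_right)
      qed
    qed
  qed
  \<comment> \<open>On the gap the union runs over every sample size, with the large constant
    \<open>c = Suc m\<close>; the vanishing relative window size compensates for it in the variance
    term.\<close>
  have B: "AE \<omega> in M. \<forall>m. \<forall>\<^sub>F n in sequentially.
      \<bar>\<Sum>i\<in>I1 n \<omega> \<inter> {N' m (r m n)<..n}. g (W i \<omega>)\<bar> \<le> sqrt (real n * ln (real n)) *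
        (real (Suc m) * ((real n - real (N' m (r m n))) / real n) * v + 3 / real (Suc m))"
    (is "AE \<omega> in M. \<forall>m. ?B \<omega> m")
    unfolding AE_all_countable
  proof
    fix m
    define c where "c = real (Suc m)"
    have c: "c > 0" "1 / c > 0" by (simp_all add: c_def)
    have J: "{N' m (r m n)<..n} \<subseteq> {1..n}" for n by auto
    show "AE \<omega> in M. ?B \<omega> m"
      using fold_deviation[where n="\<lambda>n. n" and J="\<lambda>n. {N' m (r m n)<..n}" and R="\<lambda>_ x. g (snd x)",
          OF gm filterlim_ident J V V0 V4 dom' c]
    proof eventually_elim
      case (elim \<omega>)
      then show ?case
        using eventually_gt_at_top[of 1]
      proof eventually_elim
        case (elim n)
        have "2 * ln (real n) / (c * ln (real n)) = 2 / c" using elim(2) by simp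
        moreover have "real (card {N' m (r m n)<..n}) = real n - real (N' m (r m n))"
          using Nr[of m n] by (simp add: of_nat_diff)
        ultimately have "c * (real (card {N' m (r m n)<..n}) / real n) * v + 2 * ln (real n) / (c * ln (real n)) + 1 / c =
            real (Suc m) * ((real n - real (N' m (r m n))) / real n) * v + 3 / real (Suc m)"
          by (simp add: c_def)
        then show ?case
          using elim(1) by (simp only: snd_conv g0 v_def[symmetric] mult_zero_right diff_0_right)
      qed
    qed
  qed
  from A B show ?thesis
  proof eventually_elim
    case (elim \<omega>)
    show ?case
    proof (rule tendstoI)
      fix e :: real assume e: "e > 0"
      obtain m where "inverse (real (Suc m)) < e / (2 * (v + 6))"
        using e v0 reals_Archimedean[of "e / (2 * (v + 6))"] by auto
      then have m: "(v + 6) / real (Suc m) < e / 2"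
        using v0 by (simp add: field_simps inverse_eq_divide)
      define gap where "gap n = (real n - real (N' m (r m n))) / real n" for n
      have "gap \<longlonglongrightarrow> 0"
        unfolding gap_def[abs_def] N'_def r_def using floor_root_power_ratio[of "Suc m ^ 2"] by simp
      from tendsto_mult_left_zero[OF tendsto_mult_right_zero[OF this, of "real (Suc m)"], of v]
      have gap: "\<forall>\<^sub>F n in sequentially. real (Suc m) * gap n * v < e / 2"
        by (rule order_tendstoD) (use e in simp)
      have A: "\<forall>\<^sub>F n in sequentially. \<bar>\<Sum>i\<in>I1 (N' m (r m n)) \<omega>. g (W i \<omega>)\<bar> \<le>
          sqrt (real (N' m (r m n)) * ln (real (N' m (r m n)))) * ((v + 3) / real (Suc m))"
        by (rule eventually_compose_filterlim[OF _ r_lim]) (use elim(1) in blast)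
      have r0: "\<forall>\<^sub>F n in sequentially. r m n > 0"
        by (rule eventually_compose_filterlim[OF eventually_gt_at_top r_lim])
      show "\<forall>\<^sub>F n in sequentially. dist ((\<Sum>i\<in>I1 n \<omega>. g (W i \<omega>)) / sqrt (real n * ln (real n))) 0 < e"
        using gap A spec[OF elim(2), of m] r0 eventually_gt_at_top[of 1]
      proof eventually_elim
        case (elim n)
        define q where "q = sqrt (real n * ln (real n))"
        have q: "q > 0" using elim(5) by (simp add: q_def)
        have N0: "N' m (r m n) > 0" using elim(4) by (simp add: N'_def)
        \<comment> \<open>Labels are assigned once, so the first fold at the smaller sample size is
          an initial segment of the first fold at \<open>n\<close>.\<close>
        have "I1 n \<omega> = I1 (N' m (r m n)) \<omega> \<union> (I1 n \<omega> \<inter> {N' m (r m n)<..n})"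
          using Nr[of m n] by (auto simp: fold_set_def)
        then have "(\<Sum>i\<in>I1 n \<omega>. g (W i \<omega>)) =
            (\<Sum>i\<in>I1 (N' m (r m n)) \<omega>. g (W i \<omega>)) + (\<Sum>i\<in>I1 n \<omega> \<inter> {N' m (r m n)<..n}. g (W i \<omega>))"
          by (subst sum.union_disjoint[symmetric]) (auto simp: fold_set_def)
        moreover have "sqrt (real (N' m (r m n)) * ln (real (N' m (r m n)))) * ((v + 3) / real (Suc m)) \<le> q * ((v + 3) / real (Suc m))"
          unfolding q_def using Nr[of m n] N0 v0 by (intro mult_right_mono real_sqrt_le_mono mult_mono) auto
        ultimately have "\<bar>\<Sum>i\<in>I1 n \<omega>. g (W i \<omega>)\<bar> \<le>
            q * ((v + 3) / real (Suc m)) + q * (real (Suc m) * gap n * v + 3 / real (Suc m))"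
          using elim(2,3) unfolding q_def[symmetric] gap_def[symmetric] by linarith
        also have "\<dots> = q * ((v + 6) / real (Suc m) + real (Suc m) * gap n * v)"
          by (simp add: add_divide_distrib distrib_left)
        also have "\<dots> < q * e" using elim(1) m q by (intro mult_strict_left_mono) linarith+
        finally show ?case using q unfolding q_def[symmetric] by (simp add: field_simps)
      qed
    qed
  qed
qed

end

section \<open>Bias of the doubly robust score\<close>

lemma norm_fst: "norm (fst z) \<le> norm z" and norm_snd: "norm (snd z) \<le> norm z"
  for z :: "'a::real_normed_vector \<times> 'b::real_normed_vector"
  using norm_fst_le[of "fst z" "snd z"] norm_snd_le[of "snd z" "fst z"] by simp_all

lemma measurable_nuisance_components:
  assumes "\<eta> \<in> borel_measurable S"
  shows "g_t \<eta> \<in> borel_measurable S" "g_c \<eta> \<in> borel_measurable S" "m_t \<eta> \<in> borel_measurable S"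
    "m_c \<eta> \<in> borel_measurable S" "propensity \<eta> \<in> borel_measurable S"
  unfolding g_t_def[abs_def] g_c_def[abs_def] m_t_def[abs_def] m_c_def[abs_def] propensity_def[abs_def]
  by (rule measurable_compose[OF assms borel_measurable_continuous_onI], intro continuous_intros)+

lemma nuisance_diff_le:
  fixes \<eta> \<eta>' :: "'x nuisance"
  shows "\<bar>g_t \<eta> x - g_t \<eta>' x\<bar> \<le> norm (\<eta> x - \<eta>' x)" "\<bar>g_c \<eta> x - g_c \<eta>' x\<bar> \<le> norm (\<eta> x - \<eta>' x)"
    "\<bar>m_t \<eta> x - m_t \<eta>' x\<bar> \<le> norm (\<eta> x - \<eta>' x)" "\<bar>m_c \<eta> x - m_c \<eta>' x\<bar> \<le> norm (\<eta> x - \<eta>' x)"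
    "\<bar>propensity \<eta> x - propensity \<eta>' x\<bar> \<le> norm (\<eta> x - \<eta>' x)"
proof -
  define d where "d = \<eta> x - \<eta>' x"
  have "norm (fst d) \<le> norm d" "norm (snd d) \<le> norm d"
    "norm (fst (snd d)) \<le> norm (snd d)" "norm (snd (snd d)) \<le> norm (snd d)"
    "norm (fst (snd (snd d))) \<le> norm (snd (snd d))" "norm (snd (snd (snd d))) \<le> norm (snd (snd d))"
    "norm (fst (snd (snd (snd d)))) \<le> norm (snd (snd (snd d)))"
    "norm (snd (snd (snd (snd d)))) \<le> norm (snd (snd (snd d)))"
    by (rule norm_fst norm_snd)+
  then show "\<bar>g_t \<eta> x - g_t \<eta>' x\<bar> \<le> norm (\<eta> x - \<eta>' x)" "\<bar>g_c \<eta> x - g_c \<eta>' x\<bar> \<le> norm (\<eta> x - \<eta>' x)"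
    "\<bar>m_t \<eta> x - m_t \<eta>' x\<bar> \<le> norm (\<eta> x - \<eta>' x)" "\<bar>m_c \<eta> x - m_c \<eta>' x\<bar> \<le> norm (\<eta> x - \<eta>' x)"
    "\<bar>propensity \<eta> x - propensity \<eta>' x\<bar> \<le> norm (\<eta> x - \<eta>' x)"
    unfolding g_t_def g_c_def m_t_def m_c_def propensity_def d_def[symmetric]
    by (simp_all add: d_def)
qed

text \<open>Up to a constant, one dominating function for the scores of all nuisances that satisfy
  overlap and lie within a bounded distance of \<eta>. The summand 1 covers the binary treatment and
  lets additive constants be absorbed into the factor.\<close>

definition envelope :: "'x nuisance \<Rightarrow> 'x obs \<Rightarrow> real" where
  "envelope \<eta> w = (case w of (y, a, z, x) \<Rightarrow> 1 + \<bar>y\<bar> + norm (\<eta> x))"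

lemma envelope_ge_1: "envelope \<eta> w \<ge> 1"
  by (cases w) (simp add: envelope_def)

lemma envelope_nonneg: "envelope \<eta> w \<ge> 0"
  using envelope_ge_1[of \<eta> w] by simp

lemma measurable_envelope:
  assumes [measurable]: "\<eta> \<in> borel_measurable S"
  shows "envelope \<eta> \<in> borel_measurable (obs_space S)"
  unfolding envelope_def[abs_def] obs_space_def by measurable

lemma measurable_score:
  assumes "\<eta> \<in> borel_measurable S"
  shows "(\<lambda>w. score w \<theta> \<eta>) \<in> borel_measurable (obs_space S)"
proof -
  note [measurable] = measurable_nuisance_components[OF assms]
  show ?thesis
    unfolding score_def[abs_def] obs_space_def by measurable
qed

lemma nuisance_component_le:
  fixes \<eta> :: "'x nuisance"
  shows "\<bar>g_t \<eta> x\<bar> \<le> norm (\<eta> x)" "\<bar>g_c \<eta> x\<bar> \<le> norm (\<eta> x)" "\<bar>m_t \<eta> x\<bar> \<le> norm (\<eta> x)" "\<bar>m_c \<eta> x\<bar> \<le> norm (\<eta> x)"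
  using nuisance_diff_le[of \<eta> x "\<lambda>_. 0"]
  by (simp_all add: g_t_def g_c_def m_t_def m_c_def)

lemma norm_nuisance_le:
  fixes \<eta> :: "'x nuisance"
  shows "norm (\<eta> x) \<le> \<bar>g_t \<eta> x\<bar> + \<bar>g_c \<eta> x\<bar> + \<bar>m_t \<eta> x\<bar> + \<bar>m_c \<eta> x\<bar> + \<bar>propensity \<eta> x\<bar>"
proof -
  obtain a b c d e where e: "\<eta> x = (a, b, c, d, e)" by (metis prod.collapse)
  have "norm (a, b, c, d, e) \<le> norm a + (norm b + (norm c + (norm d + norm e)))"
    by (intro order.trans[OF norm_Pair_le] add_left_mono order_refl)
  then show ?thesis
    by (simp add: e g_t_def g_c_def m_t_def m_c_def propensity_def)
qed

lemma aipw_le: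
  fixes s u v y p \<delta> w :: real
  assumes "\<bar>u\<bar> \<le> s" "\<bar>v\<bar> \<le> s" "\<bar>y\<bar> \<le> w" "\<delta> > 0" "\<delta> \<le> p" "p \<le> 1 - \<delta>"
  shows "\<bar>u - v + of_bool z * (y - u) / p - (1 - of_bool z) * (y - v) / (1 - p)\<bar> \<le> (2 + 2 / \<delta>) * (w + s)"
proof -
  have s0: "0 \<le> s" "0 \<le> w" using assms by linarith+
  have d: "\<bar>x / p'\<bar> \<le> (w + s) / \<delta>" if "\<bar>x\<bar> \<le> w + s" "\<delta> \<le> p'" for x p'
  proof -
    have "\<bar>x / p'\<bar> = \<bar>x\<bar> / p'" using that assms by simp
    also have "\<dots> \<le> (w + s) / \<delta>" using that assms s0 by (intro frac_le) auto
    finally show ?thesis .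
  qed
  have 1: "\<bar>of_bool z * (y - u) / p\<bar> \<le> (w + s) / \<delta>"
    using assms s0 by (intro d) auto
  have 2: "\<bar>(1 - of_bool z) * (y - v) / (1 - p)\<bar> \<le> (w + s) / \<delta>"
    using assms s0 by (intro d) auto
  have "(2 + 2 / \<delta>) * (w + s) = 2 * w + 2 * s + ((w + s) / \<delta> + (w + s) / \<delta>)"
    by (simp add: distrib_right add_divide_distrib)
  then show ?thesis using 1 2 assms(1,2) s0 by linarith
qed

lemma score_le_envelope:
  fixes \<eta> \<eta>' :: "'x nuisance"
  assumes \<delta>: "\<delta> > 0" and e: "propensity \<eta>' x \<in> {\<delta>..1 - \<delta>}" and B: "norm (\<eta>' x - \<eta> x) \<le> B"
  shows "\<bar>score (y, a, z, x) \<theta> \<eta>'\<bar> \<le> (1 + \<bar>\<theta>\<bar>) * (2 + 2 / \<delta>) * (1 + B) * envelope \<eta> (y, a, z, x)"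
proof -
  define s where "s = norm (\<eta> x) + B"
  \<comment> \<open>Dominates the outcome and, because of the 1, the treatment indicator as well, so
    both augmented differences obey the same bound.\<close>
  define w where "w = 1 + \<bar>y\<bar>"
  have B0: "B \<ge> 0" using B norm_ge_zero order.trans by blast
  have "norm (\<eta>' x) \<le> norm (\<eta>' x - \<eta> x) + norm (\<eta> x)"
    using norm_triangle_ineq[of "\<eta>' x - \<eta> x" "\<eta> x"] by simp
  then have "norm (\<eta>' x) \<le> s" using B by (simp add: s_def)
  then have comp: "\<bar>g_t \<eta>' x\<bar> \<le> s" "\<bar>g_c \<eta>' x\<bar> \<le> s" "\<bar>m_t \<eta>' x\<bar> \<le> s" "\<bar>m_c \<eta>' x\<bar> \<le> s"
    using nuisance_component_le[where \<eta>=\<eta>' and x=x] by linarith+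
  define p where "p = propensity \<eta>' x"
  define arm where "arm u v t = u - v + of_bool z * (t - u) / p - (1 - of_bool z) * (t - v) / (1 - p)" for u v t
  have 1: "\<bar>arm (g_t \<eta>' x) (g_c \<eta>' x) y\<bar> \<le> (2 + 2 / \<delta>) * (w + s)"
    unfolding arm_def using e comp \<delta> by (intro aipw_le) (auto simp: p_def w_def)
  have 2: "\<bar>arm (m_t \<eta>' x) (m_c \<eta>' x) (of_bool a)\<bar> \<le> (2 + 2 / \<delta>) * (w + s)"
    unfolding arm_def using e comp \<delta> by (intro aipw_le) (auto simp: p_def w_def)
  have "score (y, a, z, x) \<theta> \<eta>' = arm (g_t \<eta>' x) (g_c \<eta>' x) y - \<theta> * arm (m_t \<eta>' x) (m_c \<eta>' x) (of_bool a)"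
    by (simp add: score_def arm_def p_def)
  then have "\<bar>score (y, a, z, x) \<theta> \<eta>'\<bar> \<le> \<bar>arm (g_t \<eta>' x) (g_c \<eta>' x) y\<bar> + \<bar>\<theta>\<bar> * \<bar>arm (m_t \<eta>' x) (m_c \<eta>' x) (of_bool a)\<bar>"
    by (simp add: abs_mult[symmetric] abs_triangle_ineq4)
  also have "\<dots> \<le> (2 + 2 / \<delta>) * (w + s) + \<bar>\<theta>\<bar> * ((2 + 2 / \<delta>) * (w + s))"
    by (intro add_mono mult_left_mono 1 2) auto
  also have "\<dots> = (1 + \<bar>\<theta>\<bar>) * (2 + 2 / \<delta>) * (w + s)"
    by (simp only: distrib_right mult_1 mult.assoc)
  also have "w + s \<le> (1 + B) * envelope \<eta> (y, a, z, x)"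
  proof -
    have "B * 1 \<le> B * envelope \<eta> (y, a, z, x)" using B0 envelope_ge_1 by (intro mult_left_mono) auto
    then show ?thesis by (simp add: w_def s_def envelope_def distrib_right)
  qed
  finally show ?thesis
    using \<delta> by (simp add: mult_left_mono mult.assoc)
qed

lemma tendsto_score:
  fixes \<eta>n :: "nat \<Rightarrow> 'x nuisance"
  assumes lim: "(\<lambda>n. \<eta>n n x) \<longlonglongrightarrow> \<eta> x" and e: "\<delta> > 0" "propensity \<eta> x \<in> {\<delta>..1 - \<delta>}"
  shows "(\<lambda>n. score (y, a, z, x) \<theta> (\<eta>n n)) \<longlonglongrightarrow> score (y, a, z, x) \<theta> \<eta>"
proof -
  have "(\<lambda>n. g_t (\<eta>n n) x) \<longlonglongrightarrow> g_t \<eta> x" "(\<lambda>n. g_c (\<eta>n n) x) \<longlonglongrightarrow> g_c \<eta> x"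
    "(\<lambda>n. m_t (\<eta>n n) x) \<longlonglongrightarrow> m_t \<eta> x" "(\<lambda>n. m_c (\<eta>n n) x) \<longlonglongrightarrow> m_c \<eta> x"
    "(\<lambda>n. propensity (\<eta>n n) x) \<longlonglongrightarrow> propensity \<eta> x"
    unfolding g_t_def g_c_def m_t_def m_c_def propensity_def by (intro tendsto_fst tendsto_snd lim)+
  then show ?thesis
    unfolding score_def prod.case using e by (intro tendsto_intros) auto
qed

text \<open>The slope in \<theta> is written as a difference of two scores, so bounds, measurability
  and limits of scores carry over to it.\<close>

lemma score_affine:
  "score w \<theta> \<eta> = score w \<theta>' \<eta> - (\<theta> - \<theta>') * (score w 0 \<eta> - score w 1 \<eta>)"
proof -
  obtain u v where uv: "\<And>\<theta>. score w \<theta> \<eta> = u - \<theta> * v"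
    by (cases w) (auto simp: score_def)
  show ?thesis unfolding uv by (simp add: algebra_simps)
qed

text \<open>Conditions (a) to (c). They concern the law of a single observation, so moments and bias
  are treated here for an arbitrary fixed nuisance.\<close>

locale iv_regular = iv_model M MX MU Ypot Apot Y A Z X U \<eta>\<^sub>0 \<theta>\<^sub>0
  for M :: "'w measure" and MX :: "'x measure" and MU :: "'u measure"
    and Ypot Apot Y A Z X U \<eta>\<^sub>0 \<theta>\<^sub>0 +
  fixes q C\<^sub>q \<epsilon> c :: real
  assumes q: "q \<ge> 4"
    and moment: "(\<integral>\<^sup>+ \<omega>. ennreal (\<bar>Ypot a \<omega>\<bar> powr q) \<partial>M) \<le> ennreal C\<^sub>q"
    and \<epsilon>: "\<epsilon> > 0"
    and overlap: "AE \<omega> in M. propensity \<eta>\<^sub>0 (X \<omega>) \<in> {\<epsilon>..1 - \<epsilon>}"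
    and g_t_moment: "Lp_norm (distr M MX X) q (g_t \<eta>\<^sub>0) < \<infinity>"
    and g_c_moment: "Lp_norm (distr M MX X) q (g_c \<eta>\<^sub>0) < \<infinity>"
    and c: "c > 0"
    and compliance: "(\<integral>\<omega>. m_t \<eta>\<^sub>0 (X \<omega>) - m_c \<eta>\<^sub>0 (X \<omega>) \<partial>M) \<ge> c"
begin

section \<open>Moments and bias under overlap\<close>

lemmas [measurable] = rv_Ypot rv_Apot rv_Y rv_A rv_Z rv_X

definition pscore :: "bool \<Rightarrow> 'x \<Rightarrow> real" where
  "pscore s x = (if s then propensity \<eta>\<^sub>0 x else 1 - propensity \<eta>\<^sub>0 x)"

lemma measurable_eta0 [measurable]:
  "\<eta>\<^sub>0 \<in> borel_measurable MX" "g_t \<eta>\<^sub>0 \<in> borel_measurable MX" "g_c \<eta>\<^sub>0 \<in> borel_measurable MX"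
  "m_t \<eta>\<^sub>0 \<in> borel_measurable MX" "m_c \<eta>\<^sub>0 \<in> borel_measurable MX" "propensity \<eta>\<^sub>0 \<in> borel_measurable MX"
  using eta0_measurable measurable_nuisance_components[OF eta0_measurable] by auto

lemma measurable_pscore [measurable]: "pscore s \<in> borel_measurable MX"
  unfolding pscore_def[abs_def] by measurable

lemma weight_integral:
  assumes u[measurable]: "u \<in> borel_measurable MX" and int: "integrable M (\<lambda>\<omega>. u (X \<omega>))"
  shows "(\<integral>\<omega>. of_bool (Z \<omega> = s) * u (X \<omega>) \<partial>M) = (\<integral>\<omega>. pscore s (X \<omega>) * u (X \<omega>) \<partial>M)"
    and "integrable M (\<lambda>\<omega>. pscore s (X \<omega>) * u (X \<omega>))"
proof -
  have intZ: "integrable M (\<lambda>\<omega>. u (X \<omega>) * of_bool (Z \<omega>))"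
    by (rule Bochner_Integration.integrable_bound[OF int]) auto
  have T: "(\<integral>\<omega>. u (X \<omega>) * of_bool (Z \<omega>) \<partial>M) = (\<integral>\<omega>. u (X \<omega>) * propensity \<eta>\<^sub>0 (X \<omega>) \<partial>M)"
    by (rule sigma_gen_integral[OF rv_X u _ _ intZ eta0_e]) measurable
  have e01: "AE \<omega> in M. propensity \<eta>\<^sub>0 (X \<omega>) \<in> {0..1}"
    using overlap by eventually_elim (use \<epsilon> in auto)
  have intp: "integrable M (\<lambda>\<omega>. u (X \<omega>) * propensity \<eta>\<^sub>0 (X \<omega>))"
  proof (rule Bochner_Integration.integrable_bound[OF int])
    show "AE \<omega> in M. norm (u (X \<omega>) * propensity \<eta>\<^sub>0 (X \<omega>)) \<le> norm (u (X \<omega>))"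
      using e01 by eventually_elim (auto simp: abs_mult intro!: mult_left_le)
  qed measurable
  show "(\<integral>\<omega>. of_bool (Z \<omega> = s) * u (X \<omega>) \<partial>M) = (\<integral>\<omega>. pscore s (X \<omega>) * u (X \<omega>) \<partial>M)"
  proof (cases s)
    case True
    then show ?thesis using T by (simp add: pscore_def mult.commute)
  next
    case False
    have "(\<integral>\<omega>. of_bool (Z \<omega> = s) * u (X \<omega>) \<partial>M) = (\<integral>\<omega>. u (X \<omega>) - u (X \<omega>) * of_bool (Z \<omega>) \<partial>M)"
      using False by (intro Bochner_Integration.integral_cong) auto
    also have "\<dots> = (\<integral>\<omega>. u (X \<omega>) - u (X \<omega>) * propensity \<eta>\<^sub>0 (X \<omega>) \<partial>M)"
      using int intZ intp T by simp
    also have "\<dots> = (\<integral>\<omega>. pscore s (X \<omega>) * u (X \<omega>) \<partial>M)"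
      using False by (simp add: pscore_def algebra_simps)
    finally show ?thesis .
  qed
  show "integrable M (\<lambda>\<omega>. pscore s (X \<omega>) * u (X \<omega>))"
    using int intp by (cases s) (simp_all add: pscore_def algebra_simps)
qed

text \<open>Conditioning on \<open>(Z, X)\<close> replaces \<open>T\<close> by \<open>r s\<close> on
  \<open>Z = s\<close>, and conditioning on \<open>X\<close> replaces the indicator by
  \<open>pscore s\<close>. What is left is the integral of
  \<open>(t - r s) * (p - pscore s) / p\<close>, a product of two errors to which Cauchy--Schwarz
  applies.\<close>

lemma arm_bias:
  fixes T :: "'w \<Rightarrow> real" and r :: "bool \<Rightarrow> 'x \<Rightarrow> real"
  assumes T[measurable]: "T \<in> borel_measurable M" and Ti: "integrable M T"
    and r[measurable]: "\<And>s. r s \<in> borel_measurable MX" and ri: "integrable M (\<lambda>\<omega>. r s (X \<omega>))"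
    and ce: "AE \<omega> in M.
      real_cond_exp M (sigma_gen M (count_space UNIV \<Otimes>\<^sub>M MX) (\<lambda>\<omega>. (Z \<omega>, X \<omega>))) T \<omega> = r (Z \<omega>) (X \<omega>)"
    and t[measurable]: "t \<in> borel_measurable MX" and p[measurable]: "p \<in> borel_measurable MX"
    and tB: "AE \<omega> in M. \<bar>t (X \<omega>) - r s (X \<omega>)\<bar> \<le> B" and p\<delta>: "AE \<omega> in M. \<delta> \<le> p (X \<omega>)" "\<delta> > 0"
    and pp: "AE \<omega> in M. \<bar>p (X \<omega>) - pscore s (X \<omega>)\<bar> \<le> B"
  shows "integrable M (\<lambda>\<omega>. t (X \<omega>) + of_bool (Z \<omega> = s) * (T \<omega> - t (X \<omega>)) / p (X \<omega>))" (is "integrable M ?f")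
    and "\<bar>(\<integral>\<omega>. t (X \<omega>) + of_bool (Z \<omega> = s) * (T \<omega> - t (X \<omega>)) / p (X \<omega>) \<partial>M) - (\<integral>\<omega>. r s (X \<omega>) \<partial>M)\<bar>
      \<le> sqrt (\<integral>\<omega>. (t (X \<omega>) - r s (X \<omega>))\<^sup>2 \<partial>M) * sqrt (\<integral>\<omega>. (p (X \<omega>) - pscore s (X \<omega>))\<^sup>2 \<partial>M) / \<delta>"
proof -
  define h where "h x = 1 / p x" for x
  have h[measurable]: "h \<in> borel_measurable MX" unfolding h_def[abs_def] by measurable
  have h\<delta>: "AE \<omega> in M. \<bar>h (X \<omega>)\<bar> \<le> 1 / \<delta>"
    using p\<delta>(1)
  proof eventually_elim
    case (elim \<omega>)
    have "1 / p (X \<omega>) \<le> 1 / \<delta>" by (rule divide_left_mono) (use elim p\<delta>(2) in auto)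
    then show ?case using elim p\<delta>(2) by (simp add: h_def)
  qed
  have d_int: "integrable M (\<lambda>\<omega>. t (X \<omega>) - r s (X \<omega>))"
    by (rule integrable_const_bound[where B=B]) (use tB in auto)
  have t_int: "integrable M (\<lambda>\<omega>. t (X \<omega>))"
    using Bochner_Integration.integrable_add[OF d_int ri] by simp
  have h_int: "integrable M (\<lambda>\<omega>. h (X \<omega>) * u \<omega>)" if "integrable M u" for u
  proof (rule Bochner_Integration.integrable_bound)
    show "integrable M (\<lambda>\<omega>. 1 / \<delta> * u \<omega>)" using that by (rule integrable_mult_right)
    show "AE \<omega> in M. norm (h (X \<omega>) * u \<omega>) \<le> norm (1 / \<delta> * u \<omega>)"
      using h\<delta>
    proof eventually_elim
      case (elim \<omega>)
      then have "\<bar>h (X \<omega>)\<bar> * \<bar>u \<omega>\<bar> \<le> 1 / \<delta> * \<bar>u \<omega>\<bar>" by (rule mult_right_mono) simp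
      then show ?case using p\<delta>(2) by (simp add: abs_mult)
    qed
    show "(\<lambda>\<omega>. h (X \<omega>) * u \<omega>) \<in> borel_measurable M"
      using borel_measurable_integrable[OF that] by measurable
  qed
  have w_int: "integrable M (\<lambda>\<omega>. of_bool (Z \<omega> = s) * u \<omega>)" if "integrable M u" for u :: "'w \<Rightarrow> real"
    by (rule Bochner_Integration.integrable_bound[OF that]) (use borel_measurable_integrable[OF that] in auto)
  have hT: "integrable M (\<lambda>\<omega>. of_bool (Z \<omega> = s) * (h (X \<omega>) * T \<omega>))"
    by (intro w_int h_int Ti)
  have hr: "integrable M (\<lambda>\<omega>. of_bool (Z \<omega> = s) * (h (X \<omega>) * r s (X \<omega>)))"
    by (intro w_int h_int ri)
  have ht: "integrable M (\<lambda>\<omega>. of_bool (Z \<omega> = s) * (h (X \<omega>) * t (X \<omega>)))"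
    by (intro w_int h_int t_int)
  have f_eq: "?f \<omega> = t (X \<omega>) + (of_bool (Z \<omega> = s) * (h (X \<omega>) * T \<omega>) - of_bool (Z \<omega> = s) * (h (X \<omega>) * t (X \<omega>)))" for \<omega>
    by (simp add: h_def algebra_simps add_divide_distrib diff_divide_distrib)
  show "integrable M ?f"
    unfolding f_eq using t_int hT ht by simp
  have ZX: "(\<lambda>\<omega>. (Z \<omega>, X \<omega>)) \<in> measurable M (count_space UNIV \<Otimes>\<^sub>M MX)"
    by measurable
  \<comment> \<open>The indicator of \<open>Z = s\<close> times the inverse propensity is a function
    of \<open>(Z, X)\<close>, so the conditional expectation may be inserted.\<close>
  have "(\<integral>\<omega>. of_bool (Z \<omega> = s) * (h (X \<omega>) * T \<omega>) \<partial>M) =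
      (\<integral>\<omega>. (case (Z \<omega>, X \<omega>) of (z, x) \<Rightarrow> of_bool (z = s) * h x) * T \<omega> \<partial>M)"
    by (simp add: mult.assoc)
  also have "\<dots> = (\<integral>\<omega>. (case (Z \<omega>, X \<omega>) of (z, x) \<Rightarrow> of_bool (z = s) * h x) * r (Z \<omega>) (X \<omega>) \<partial>M)"
  proof (rule sigma_gen_integral[OF ZX _ T _ _ ce])
    have "(\<lambda>\<omega>. if Z \<omega> then r True (X \<omega>) else r False (X \<omega>)) \<in> borel_measurable M" by measurable
    moreover have "r (Z \<omega>) (X \<omega>) = (if Z \<omega> then r True (X \<omega>) else r False (X \<omega>))" for \<omega> by simp
    ultimately show "(\<lambda>\<omega>. r (Z \<omega>) (X \<omega>)) \<in> borel_measurable M" by presburger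
    show "(\<lambda>(z, x). of_bool (z = s) * h x) \<in> borel_measurable (count_space UNIV \<Otimes>\<^sub>M MX)" by measurable
    show "integrable M (\<lambda>\<omega>. (case (Z \<omega>, X \<omega>) of (z, x) \<Rightarrow> of_bool (z = s) * h x) * T \<omega>)"
      using hT by (simp add: mult.assoc)
  qed
  also have "(\<lambda>\<omega>. (case (Z \<omega>, X \<omega>) of (z, x) \<Rightarrow> of_bool (z = s) * h x) * r (Z \<omega>) (X \<omega>)) =
      (\<lambda>\<omega>. of_bool (Z \<omega> = s) * (h (X \<omega>) * r s (X \<omega>)))"
  proof
    show "(case (Z \<omega>, X \<omega>) of (z, x) \<Rightarrow> of_bool (z = s) * h x) * r (Z \<omega>) (X \<omega>) =
        of_bool (Z \<omega> = s) * (h (X \<omega>) * r s (X \<omega>))" for \<omega>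
      by (cases "Z \<omega> = s") auto
  qed
  finally have T_r: "(\<integral>\<omega>. of_bool (Z \<omega> = s) * (h (X \<omega>) * T \<omega>) \<partial>M) = (\<integral>\<omega>. of_bool (Z \<omega> = s) * (h (X \<omega>) * r s (X \<omega>)) \<partial>M)" .
  have hd: "integrable M (\<lambda>\<omega>. h (X \<omega>) * (t (X \<omega>) - r s (X \<omega>)))"
    by (rule h_int[OF d_int])
  have mh: "(\<lambda>x. h x * (t x - r s x)) \<in> borel_measurable MX" by measurable
  note W = weight_integral[OF mh hd, of s]
  have "(\<integral>\<omega>. ?f \<omega> \<partial>M) - (\<integral>\<omega>. r s (X \<omega>) \<partial>M) =
      (\<integral>\<omega>. t (X \<omega>) - r s (X \<omega>) \<partial>M) - (\<integral>\<omega>. of_bool (Z \<omega> = s) * (h (X \<omega>) * (t (X \<omega>) - r s (X \<omega>))) \<partial>M)"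
    unfolding f_eq using t_int hT ht hr ri T_r by (simp add: right_diff_distrib)
  also have "\<dots> = (\<integral>\<omega>. (t (X \<omega>) - r s (X \<omega>)) - pscore s (X \<omega>) * (h (X \<omega>) * (t (X \<omega>) - r s (X \<omega>))) \<partial>M)"
    unfolding W(1) using d_int W(2) by simp
  finally have eq: "(\<integral>\<omega>. ?f \<omega> \<partial>M) - (\<integral>\<omega>. r s (X \<omega>) \<partial>M) =
      (\<integral>\<omega>. (t (X \<omega>) - r s (X \<omega>)) - pscore s (X \<omega>) * (h (X \<omega>) * (t (X \<omega>) - r s (X \<omega>))) \<partial>M)" .
  have sq: "integrable M (\<lambda>\<omega>. (u (X \<omega>))\<^sup>2)" if "u \<in> borel_measurable MX" "AE \<omega> in M. \<bar>u (X \<omega>)\<bar> \<le> B" for u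
  proof (rule integrable_const_bound[where B="B\<^sup>2"])
    show "AE \<omega> in M. norm ((u (X \<omega>))\<^sup>2) \<le> B\<^sup>2"
      using that(2)
    proof eventually_elim
      case (elim \<omega>)
      then show ?case using power_mono[of "\<bar>u (X \<omega>)\<bar>" B 2] by simp
    qed
  qed (use that(1) in measurable)
  have CS: "(\<integral>\<omega>. \<bar>(t (X \<omega>) - r s (X \<omega>)) * (p (X \<omega>) - pscore s (X \<omega>))\<bar> \<partial>M)
      \<le> sqrt (\<integral>\<omega>. (t (X \<omega>) - r s (X \<omega>))\<^sup>2 \<partial>M) * sqrt (\<integral>\<omega>. (p (X \<omega>) - pscore s (X \<omega>))\<^sup>2 \<partial>M)"
    and CSi: "integrable M (\<lambda>\<omega>. (t (X \<omega>) - r s (X \<omega>)) * (p (X \<omega>) - pscore s (X \<omega>)))"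
    using sq[of "\<lambda>x. t x - r s x"] sq[of "\<lambda>x. p x - pscore s x"] tB pp
    by (auto intro!: Cauchy_Schwarz_integral integrable_mult_of_squares)
  have "\<bar>(\<integral>\<omega>. ?f \<omega> \<partial>M) - (\<integral>\<omega>. r s (X \<omega>) \<partial>M)\<bar> \<le>
      (\<integral>\<omega>. \<bar>(t (X \<omega>) - r s (X \<omega>)) - pscore s (X \<omega>) * (h (X \<omega>) * (t (X \<omega>) - r s (X \<omega>)))\<bar> \<partial>M)"
    unfolding eq by (rule integral_abs_bound)
  also have "\<dots> \<le> (\<integral>\<omega>. \<bar>(t (X \<omega>) - r s (X \<omega>)) * (p (X \<omega>) - pscore s (X \<omega>))\<bar> / \<delta> \<partial>M)"
  proof (rule integral_mono_AE)
    show "integrable M (\<lambda>\<omega>. \<bar>(t (X \<omega>) - r s (X \<omega>)) - pscore s (X \<omega>) * (h (X \<omega>) * (t (X \<omega>) - r s (X \<omega>)))\<bar>)"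
      using d_int W(2) by simp
    show "integrable M (\<lambda>\<omega>. \<bar>(t (X \<omega>) - r s (X \<omega>)) * (p (X \<omega>) - pscore s (X \<omega>))\<bar> / \<delta>)"
      using CSi by simp
    show "AE \<omega> in M. \<bar>(t (X \<omega>) - r s (X \<omega>)) - pscore s (X \<omega>) * (h (X \<omega>) * (t (X \<omega>) - r s (X \<omega>)))\<bar> \<le>
        \<bar>(t (X \<omega>) - r s (X \<omega>)) * (p (X \<omega>) - pscore s (X \<omega>))\<bar> / \<delta>"
      using p\<delta>(1)
    proof eventually_elim
      case (elim \<omega>)
      let ?d = "t (X \<omega>) - r s (X \<omega>)" and ?p = "p (X \<omega>)" and ?ps = "pscore s (X \<omega>)"
      have p0: "?p > 0" using elim p\<delta>(2) by simp
      then have "?d - ?ps * (h (X \<omega>) * ?d) = ?d * (?p - ?ps) / ?p"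
        by (simp add: h_def field_simps)
      then have "\<bar>?d - ?ps * (h (X \<omega>) * ?d)\<bar> = \<bar>?d * (?p - ?ps)\<bar> / ?p"
        using p0 by (simp add: abs_mult)
      also have "\<dots> \<le> \<bar>?d * (?p - ?ps)\<bar> / \<delta>"
        using elim p\<delta>(2) by (intro divide_left_mono) auto
      finally show ?case .
    qed
  qed
  also have "\<dots> = (\<integral>\<omega>. \<bar>(t (X \<omega>) - r s (X \<omega>)) * (p (X \<omega>) - pscore s (X \<omega>))\<bar> \<partial>M) / \<delta>" by simp
  also have "\<dots> \<le> sqrt (\<integral>\<omega>. (t (X \<omega>) - r s (X \<omega>))\<^sup>2 \<partial>M) * sqrt (\<integral>\<omega>. (p (X \<omega>) - pscore s (X \<omega>))\<^sup>2 \<partial>M) / \<delta>"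
    using CS p\<delta>(2) by (intro divide_right_mono) auto
  finally show "\<bar>(\<integral>\<omega>. ?f \<omega> \<partial>M) - (\<integral>\<omega>. r s (X \<omega>) \<partial>M)\<bar>
      \<le> sqrt (\<integral>\<omega>. (t (X \<omega>) - r s (X \<omega>))\<^sup>2 \<partial>M) * sqrt (\<integral>\<omega>. (p (X \<omega>) - pscore s (X \<omega>))\<^sup>2 \<partial>M) / \<delta>" .
qed

definition obs :: "'w \<Rightarrow> 'x obs" where "obs \<omega> = (Y \<omega>, A \<omega>, Z \<omega>, X \<omega>)"

lemma measurable_obs [measurable]: "obs \<in> measurable M (obs_space MX)"
  unfolding obs_def[abs_def] obs_space_def by measurable

abbreviation "P\<^sub>0 \<equiv> distr M (obs_space MX) obs"

lemma Y_power4: "integrable M (\<lambda>\<omega>. Y \<omega> ^ 4)"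
proof (rule Bochner_Integration.integrable_bound)
  have "integrable M (\<lambda>\<omega>. Ypot a \<omega> ^ 4)" for a
    by (rule integrable_power4_of_powr[OF _ q])
       (use moment[of a] in \<open>auto simp: less_top[symmetric] top_unique\<close>)
  then show "integrable M (\<lambda>\<omega>. Ypot True \<omega> ^ 4 + Ypot False \<omega> ^ 4)" by simp
  show "AE \<omega> in M. norm (Y \<omega> ^ 4) \<le> norm (Ypot True \<omega> ^ 4 + Ypot False \<omega> ^ 4)"
    using consistency_Y by eventually_elim (case_tac "A \<omega>"; simp)
qed measurable

text \<open>By overlap each value of \<open>Z\<close> keeps conditional probability at least
  \<epsilon> at almost every covariate, so a set of covariates that is null on \<open>Z = s\<close>
  is null. This transfers properties of \<open>m_t\<close> and \<open>m_c\<close>, each of which is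
  tied to a conditional expectation on one arm only.\<close>

lemma AE_X_of_Z:
  assumes D[measurable]: "Measurable.pred MX D" and AE: "AE \<omega> in M. Z \<omega> = s \<longrightarrow> D (X \<omega>)"
  shows "AE \<omega> in M. D (X \<omega>)"
proof -
  define u :: "'x \<Rightarrow> real" where "u x = of_bool (\<not> D x)" for x
  have u[measurable]: "u \<in> borel_measurable MX" unfolding u_def[abs_def] by measurable
  have ui: "integrable M (\<lambda>\<omega>. u (X \<omega>))"
    by (rule integrable_const_bound[where B=1]) (auto simp: u_def)
  have pos: "AE \<omega> in M. pscore s (X \<omega>) \<ge> \<epsilon>"
    using overlap by eventually_elim (auto simp: pscore_def)
  have "(\<integral>\<omega>. of_bool (Z \<omega> = s) * u (X \<omega>) \<partial>M) = 0"
    by (rule integral_eq_zero_AE) (use AE in \<open>eventually_elim, auto simp: u_def\<close>)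
  then have "(\<integral>\<omega>. pscore s (X \<omega>) * u (X \<omega>) \<partial>M) = 0"
    using weight_integral(1)[OF u ui, of s] by simp
  moreover have "AE \<omega> in M. 0 \<le> pscore s (X \<omega>) * u (X \<omega>)"
    using pos by eventually_elim (use \<epsilon> in \<open>auto simp: u_def\<close>)
  ultimately have "AE \<omega> in M. pscore s (X \<omega>) * u (X \<omega>) = 0"
    using integral_nonneg_eq_0_iff_AE[OF weight_integral(2)[OF u ui]] by blast
  with pos show ?thesis
    by eventually_elim (use \<epsilon> in \<open>auto simp: u_def split: if_splits\<close>)
qed

lemma m_range: "AE \<omega> in M. m_t \<eta>\<^sub>0 (X \<omega>) \<in> {0..1}" "AE \<omega> in M. m_c \<eta>\<^sub>0 (X \<omega>) \<in> {0..1}"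
proof -
  let ?F = "sigma_gen M (count_space UNIV \<Otimes>\<^sub>M MX) (\<lambda>\<omega>. (Z \<omega>, X \<omega>))"
  have f: "(\<lambda>\<omega>. (Z \<omega>, X \<omega>)) \<in> measurable M (count_space UNIV \<Otimes>\<^sub>M MX)" by measurable
  interpret finite_measure_subalgebra M ?F
    by unfold_locales (rule subalgebra_sigma_gen[OF f])
  have i: "integrable M (\<lambda>\<omega>. of_bool (A \<omega>) :: real)"
    by (rule integrable_const_bound[where B=1]) auto
  have "AE \<omega> in M. real_cond_exp M ?F (\<lambda>\<omega>. of_bool (A \<omega>)) \<omega> \<ge> 0"
    by (rule real_cond_exp_pos) auto
  moreover have "AE \<omega> in M. real_cond_exp M ?F (\<lambda>\<omega>. of_bool (A \<omega>)) \<omega> \<le> real_cond_exp M ?F (\<lambda>_. 1) \<omega>"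
    by (rule real_cond_exp_mono) (use i in auto)
  moreover have "AE \<omega> in M. real_cond_exp M ?F (\<lambda>_. 1) \<omega> = 1"
    by (rule real_cond_exp_F_meas) auto
  ultimately have "AE \<omega> in M. (if Z \<omega> then m_t \<eta>\<^sub>0 (X \<omega>) else m_c \<eta>\<^sub>0 (X \<omega>)) \<in> {0..1}"
    using eta0_m by eventually_elim auto
  note AE = this
  have "AE \<omega> in M. Z \<omega> = True \<longrightarrow> m_t \<eta>\<^sub>0 (X \<omega>) \<in> {0..1}"
    using AE by eventually_elim (auto split: if_splits)
  moreover have "AE \<omega> in M. Z \<omega> = False \<longrightarrow> m_c \<eta>\<^sub>0 (X \<omega>) \<in> {0..1}"
    using AE by eventually_elim (auto split: if_splits)
  ultimately show "AE \<omega> in M. m_t \<eta>\<^sub>0 (X \<omega>) \<in> {0..1}" "AE \<omega> in M. m_c \<eta>\<^sub>0 (X \<omega>) \<in> {0..1}"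
    by (intro AE_X_of_Z[where D="\<lambda>x. m_t \<eta>\<^sub>0 x \<in> {0..1}"] AE_X_of_Z[where D="\<lambda>x. m_c \<eta>\<^sub>0 x \<in> {0..1}"]; measurable)+
qed

lemma g_power4: "integrable M (\<lambda>\<omega>. g_t \<eta>\<^sub>0 (X \<omega>) ^ 4)" "integrable M (\<lambda>\<omega>. g_c \<eta>\<^sub>0 (X \<omega>) ^ 4)"
proof -
  have "integrable M (\<lambda>\<omega>. f (X \<omega>) ^ 4)"
    if f[measurable]: "f \<in> borel_measurable MX" and fin: "Lp_norm (distr M MX X) q f < \<infinity>" for f :: "'x \<Rightarrow> real"
  proof (rule integrable_power4_of_powr[OF _ q])
    have "(\<integral>\<^sup>+ x. ennreal (norm (f x) powr q) \<partial>distr M MX X) \<noteq> \<infinity>"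
      using fin by (auto simp: Lp_norm_def Let_def)
    then show "(\<integral>\<^sup>+ \<omega>. ennreal (\<bar>f (X \<omega>)\<bar> powr q) \<partial>M) < \<infinity>"
      by (subst (asm) nn_integral_distr) (auto simp: less_top)
  qed measurable
  then show "integrable M (\<lambda>\<omega>. g_t \<eta>\<^sub>0 (X \<omega>) ^ 4)" "integrable M (\<lambda>\<omega>. g_c \<eta>\<^sub>0 (X \<omega>) ^ 4)"
    using g_t_moment g_c_moment by auto
qed

lemma envelope_power4: "integrable P\<^sub>0 (\<lambda>w. envelope \<eta>\<^sub>0 w ^ 4)"
proof -
  \<comment> \<open>The 4 collects the summand 1 of the envelope and the bounds 1 for
    \<open>m_t\<close>, \<open>m_c\<close> and the propensity.\<close>
  have "integrable M (\<lambda>\<omega>. (4 + (\<bar>Y \<omega>\<bar> + (\<bar>g_t \<eta>\<^sub>0 (X \<omega>)\<bar> + \<bar>g_c \<eta>\<^sub>0 (X \<omega>)\<bar>))) ^ 4)"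
    by (intro integrable_power4_add) (use Y_power4 g_power4 in auto)
  then have "integrable M (\<lambda>\<omega>. envelope \<eta>\<^sub>0 (obs \<omega>) ^ 4)"
  proof (rule Bochner_Integration.integrable_bound)
    show "AE \<omega> in M. norm (envelope \<eta>\<^sub>0 (obs \<omega>) ^ 4) \<le>
        norm ((4 + (\<bar>Y \<omega>\<bar> + (\<bar>g_t \<eta>\<^sub>0 (X \<omega>)\<bar> + \<bar>g_c \<eta>\<^sub>0 (X \<omega>)\<bar>))) ^ 4)"
      using m_range overlap
    proof eventually_elim
      case (elim \<omega>)
      have "envelope \<eta>\<^sub>0 (obs \<omega>) \<le> 4 + (\<bar>Y \<omega>\<bar> + (\<bar>g_t \<eta>\<^sub>0 (X \<omega>)\<bar> + \<bar>g_c \<eta>\<^sub>0 (X \<omega>)\<bar>))"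
        using elim \<epsilon> norm_nuisance_le[of \<eta>\<^sub>0 "X \<omega>"] by (simp add: envelope_def obs_def)
      then have "envelope \<eta>\<^sub>0 (obs \<omega>) ^ 4 \<le> (4 + (\<bar>Y \<omega>\<bar> + (\<bar>g_t \<eta>\<^sub>0 (X \<omega>)\<bar> + \<bar>g_c \<eta>\<^sub>0 (X \<omega>)\<bar>))) ^ 4"
        using envelope_nonneg by (intro power_mono)
      then show ?case by simp
    qed
    show "(\<lambda>\<omega>. envelope \<eta>\<^sub>0 (obs \<omega>) ^ 4) \<in> borel_measurable M"
      using measurable_compose[OF measurable_obs measurable_envelope[OF eta0_measurable]] by measurable
  qed
  then show ?thesis
    using measurable_envelope[OF eta0_measurable] by (subst integrable_distr_eq) auto
qed

text \<open>The score is a linear combination of four arms, and the bias of each is bounded by its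
  regression error times the propensity error. This is what makes a rate for the product
  sufficient.\<close>

lemma score_bias:
  assumes \<eta>: "\<eta> \<in> borel_measurable MX" and \<delta>: "\<delta> > 0"
    and near: "AE x in distr M MX X. norm (\<eta> x - \<eta>\<^sub>0 x) \<le> B \<and> propensity \<eta> x \<in> {\<delta>..1 - \<delta>}"
  defines "d f \<equiv> sqrt (\<integral>\<omega>. (f \<eta> (X \<omega>) - f \<eta>\<^sub>0 (X \<omega>))\<^sup>2 \<partial>M)"
  shows "\<bar>(\<integral>w. score w \<theta> \<eta> \<partial>P\<^sub>0) - ((\<integral>\<omega>. g_t \<eta>\<^sub>0 (X \<omega>) - g_c \<eta>\<^sub>0 (X \<omega>) \<partial>M) -
      \<theta> * (\<integral>\<omega>. m_t \<eta>\<^sub>0 (X \<omega>) - m_c \<eta>\<^sub>0 (X \<omega>) \<partial>M))\<bar>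
    \<le> (1 + \<bar>\<theta>\<bar>) / \<delta> * (d propensity * ((d g_t + d g_c) + (d m_t + d m_c)))"
proof -
  let ?F = "sigma_gen M (count_space UNIV \<Otimes>\<^sub>M MX) (\<lambda>\<omega>. (Z \<omega>, X \<omega>))"
  note [measurable] = measurable_nuisance_components[OF \<eta>] \<eta>
  have near: "AE \<omega> in M. norm (\<eta> (X \<omega>) - \<eta>\<^sub>0 (X \<omega>)) \<le> B \<and> propensity \<eta> (X \<omega>) \<in> {\<delta>..1 - \<delta>}"
    using near by (subst (asm) AE_distr_iff) measurable
  have B: "AE \<omega> in M. \<bar>f \<eta> (X \<omega>) - f \<eta>\<^sub>0 (X \<omega>)\<bar> \<le> B" if "f \<in> {g_t, g_c, m_t, m_c, propensity}" for f
    using near that by (auto elim!: eventually_mono intro: order.trans[OF nuisance_diff_le(1)]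
        order.trans[OF nuisance_diff_le(2)] order.trans[OF nuisance_diff_le(3)]
        order.trans[OF nuisance_diff_le(4)] order.trans[OF nuisance_diff_le(5)])
  define p where "p s x = (if s then propensity \<eta> x else 1 - propensity \<eta> x)" for s x
  have p[measurable]: "p s \<in> borel_measurable MX" for s unfolding p_def[abs_def] by measurable
  have p\<delta>: "AE \<omega> in M. \<delta> \<le> p s (X \<omega>)" for s
    using near by eventually_elim (auto simp: p_def)
  have pB: "AE \<omega> in M. \<bar>p s (X \<omega>) - pscore s (X \<omega>)\<bar> \<le> B" for s
    using B[of propensity] by (auto simp: p_def pscore_def abs_minus_commute)
  \<comment> \<open>Both arms have the same propensity error up to sign, so one norm serves all four
    terms.\<close>
  have p2: "(p s x - pscore s x)\<^sup>2 = (propensity \<eta> x - propensity \<eta>\<^sub>0 x)\<^sup>2" for s x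
    by (simp add: p_def pscore_def power2_commute)
  have gi: "integrable M (\<lambda>\<omega>. g_t \<eta>\<^sub>0 (X \<omega>))" "integrable M (\<lambda>\<omega>. g_c \<eta>\<^sub>0 (X \<omega>))"
    by (rule integrable_of_power4(1)[OF _ g_power4(1)], measurable) (rule integrable_of_power4(1)[OF _ g_power4(2)], measurable)
  have mi: "integrable M (\<lambda>\<omega>. m_t \<eta>\<^sub>0 (X \<omega>))" "integrable M (\<lambda>\<omega>. m_c \<eta>\<^sub>0 (X \<omega>))"
  proof -
    have "AE \<omega> in M. norm (m_t \<eta>\<^sub>0 (X \<omega>)) \<le> 1"
      using m_range(1) by eventually_elim simp
    then show "integrable M (\<lambda>\<omega>. m_t \<eta>\<^sub>0 (X \<omega>))"
      by (rule integrable_const_bound) measurable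
    have "AE \<omega> in M. norm (m_c \<eta>\<^sub>0 (X \<omega>)) \<le> 1"
      using m_range(2) by eventually_elim simp
    then show "integrable M (\<lambda>\<omega>. m_c \<eta>\<^sub>0 (X \<omega>))"
      by (rule integrable_const_bound) measurable
  qed
  have Yi: "integrable M Y" by (rule integrable_of_power4(1)[OF rv_Y Y_power4])
  have Ai: "integrable M (\<lambda>\<omega>. of_bool (A \<omega>) :: real)" by (rule integrable_const_bound[where B=1]) auto
  define rY where "rY s = (if s then g_t \<eta>\<^sub>0 else g_c \<eta>\<^sub>0)" for s
  define rA where "rA s = (if s then m_t \<eta>\<^sub>0 else m_c \<eta>\<^sub>0)" for s
  have rY: "rY s \<in> borel_measurable MX" "integrable M (\<lambda>\<omega>. rY s (X \<omega>))" for s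
    using gi by (auto simp: rY_def)
  have rA: "rA s \<in> borel_measurable MX" "integrable M (\<lambda>\<omega>. rA s (X \<omega>))" for s
    using mi by (auto simp: rA_def)
  have ceY: "AE \<omega> in M. real_cond_exp M ?F Y \<omega> = rY (Z \<omega>) (X \<omega>)"
    using eta0_g by eventually_elim (auto simp: rY_def)
  have ceA: "AE \<omega> in M. real_cond_exp M ?F (\<lambda>\<omega>. of_bool (A \<omega>)) \<omega> = rA (Z \<omega>) (X \<omega>)"
    using eta0_m by eventually_elim (auto simp: rA_def)
  define arm where "arm T t s \<omega> = t (X \<omega>) + of_bool (Z \<omega> = s) * (T \<omega> - t (X \<omega>)) / p s (X \<omega>)" for T t s \<omega>
  have arm: "integrable M (arm T (f \<eta>) s) \<and>
      \<bar>(\<integral>\<omega>. arm T (f \<eta>) s \<omega> \<partial>M) - (\<integral>\<omega>. f \<eta>\<^sub>0 (X \<omega>) \<partial>M)\<bar> \<le> d f * d propensity / \<delta>"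
    if "T \<in> borel_measurable M" "integrable M T" "\<And>s. r s \<in> borel_measurable MX" "\<And>s. integrable M (\<lambda>\<omega>. r s (X \<omega>))"
      and "AE \<omega> in M. real_cond_exp M ?F T \<omega> = r (Z \<omega>) (X \<omega>)"
      and f: "r s = f \<eta>\<^sub>0" "f \<eta> \<in> borel_measurable MX" "f \<in> {g_t, g_c, m_t, m_c, propensity}" for T r s f
    using arm_bias[where T=T and r=r and t="f \<eta>" and p="p s" and s=s, OF that(1-5) f(2) p _ p\<delta> \<delta> pB] B[OF f(3)]
    unfolding p2 f(1) by (auto simp: arm_def[abs_def] d_def)
  note \<eta>m = measurable_nuisance_components[OF \<eta>]
  let ?A = "\<lambda>\<omega>. of_bool (A \<omega>) :: real"
  have rvA: "?A \<in> borel_measurable M" by measurable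
  have A1: "integrable M (arm Y (g_t \<eta>) True) \<and> \<bar>(\<integral>\<omega>. arm Y (g_t \<eta>) True \<omega> \<partial>M) - (\<integral>\<omega>. g_t \<eta>\<^sub>0 (X \<omega>) \<partial>M)\<bar> \<le> d g_t * d propensity / \<delta>"
    by (rule arm[of "Y" rY True g_t, OF rv_Y Yi rY ceY _ \<eta>m(1)]) (simp_all add: rY_def)
  have A2: "integrable M (arm Y (g_c \<eta>) False) \<and> \<bar>(\<integral>\<omega>. arm Y (g_c \<eta>) False \<omega> \<partial>M) - (\<integral>\<omega>. g_c \<eta>\<^sub>0 (X \<omega>) \<partial>M)\<bar> \<le> d g_c * d propensity / \<delta>"
    by (rule arm[of "Y" rY False g_c, OF rv_Y Yi rY ceY _ \<eta>m(2)]) (simp_all add: rY_def)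
  have A3: "integrable M (arm ?A (m_t \<eta>) True) \<and> \<bar>(\<integral>\<omega>. arm ?A (m_t \<eta>) True \<omega> \<partial>M) - (\<integral>\<omega>. m_t \<eta>\<^sub>0 (X \<omega>) \<partial>M)\<bar> \<le> d m_t * d propensity / \<delta>"
    by (rule arm[of "?A" rA True m_t, OF rvA Ai rA ceA _ \<eta>m(3)]) (simp_all add: rA_def)
  have A4: "integrable M (arm ?A (m_c \<eta>) False) \<and> \<bar>(\<integral>\<omega>. arm ?A (m_c \<eta>) False \<omega> \<partial>M) - (\<integral>\<omega>. m_c \<eta>\<^sub>0 (X \<omega>) \<partial>M)\<bar> \<le> d m_c * d propensity / \<delta>"
    by (rule arm[of "?A" rA False m_c, OF rvA Ai rA ceA _ \<eta>m(4)]) (simp_all add: rA_def)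
  define a where "a = (\<integral>\<omega>. arm Y (g_t \<eta>) True \<omega> \<partial>M) - (\<integral>\<omega>. arm Y (g_c \<eta>) False \<omega> \<partial>M)"
  define b where "b = (\<integral>\<omega>. arm ?A (m_t \<eta>) True \<omega> \<partial>M) - (\<integral>\<omega>. arm ?A (m_c \<eta>) False \<omega> \<partial>M)"
  have "score (obs \<omega>) \<theta> \<eta> = (arm Y (g_t \<eta>) True \<omega> - arm Y (g_c \<eta>) False \<omega>) -
      \<theta> * (arm ?A (m_t \<eta>) True \<omega> - arm ?A (m_c \<eta>) False \<omega>)" for \<omega>
    by (cases "Z \<omega>") (simp_all add: score_def obs_def arm_def p_def algebra_simps)
  then have "(\<integral>w. score w \<theta> \<eta> \<partial>P\<^sub>0) = a - \<theta> * b"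
    using A1 A2 A3 A4 measurable_score[OF \<eta>, of \<theta>] by (subst integral_distr) (auto simp: a_def b_def)
  moreover have "(\<integral>\<omega>. g_t \<eta>\<^sub>0 (X \<omega>) - g_c \<eta>\<^sub>0 (X \<omega>) \<partial>M) = (\<integral>\<omega>. g_t \<eta>\<^sub>0 (X \<omega>) \<partial>M) - (\<integral>\<omega>. g_c \<eta>\<^sub>0 (X \<omega>) \<partial>M)"
    "(\<integral>\<omega>. m_t \<eta>\<^sub>0 (X \<omega>) - m_c \<eta>\<^sub>0 (X \<omega>) \<partial>M) = (\<integral>\<omega>. m_t \<eta>\<^sub>0 (X \<omega>) \<partial>M) - (\<integral>\<omega>. m_c \<eta>\<^sub>0 (X \<omega>) \<partial>M)"
    using gi mi by simp_all
  moreover define Eg where "Eg = (\<integral>\<omega>. g_t \<eta>\<^sub>0 (X \<omega>) \<partial>M) - (\<integral>\<omega>. g_c \<eta>\<^sub>0 (X \<omega>) \<partial>M)"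
  moreover define Em where "Em = (\<integral>\<omega>. m_t \<eta>\<^sub>0 (X \<omega>) \<partial>M) - (\<integral>\<omega>. m_c \<eta>\<^sub>0 (X \<omega>) \<partial>M)"
  moreover have "\<bar>(a - \<theta> * b) - (Eg - \<theta> * Em)\<bar> \<le> \<bar>a - Eg\<bar> + \<bar>\<theta>\<bar> * \<bar>b - Em\<bar>"
  proof -
    have "(a - \<theta> * b) - (Eg - \<theta> * Em) = (a - Eg) - \<theta> * (b - Em)" by (simp add: algebra_simps)
    then show ?thesis by (metis abs_mult abs_triangle_ineq4)
  qed
  moreover have "\<bar>a - Eg\<bar> + \<bar>\<theta>\<bar> * \<bar>b - Em\<bar> \<le> (1 + \<bar>\<theta>\<bar>) / \<delta> * (d propensity * ((d g_t + d g_c) + (d m_t + d m_c)))"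
  proof -
    define D where "D = d propensity * ((d g_t + d g_c) + (d m_t + d m_c)) / \<delta>"
    have d0: "d f \<ge> 0" for f by (simp add: d_def)
    have n: "0 \<le> d f * d propensity / \<delta>" for f using d0 \<delta> by simp
    have D: "D = d g_t * d propensity / \<delta> + d g_c * d propensity / \<delta> + (d m_t * d propensity / \<delta> + d m_c * d propensity / \<delta>)"
      by (simp add: D_def algebra_simps add_divide_distrib)
    have "\<bar>a - Eg\<bar> \<le> D"
      using A1 A2 n[of m_t] n[of m_c] unfolding a_def Eg_def D by linarith
    moreover have "\<bar>b - Em\<bar> \<le> D"
      using A3 A4 n[of g_t] n[of g_c] unfolding b_def Em_def D by linarith
    ultimately have "\<bar>a - Eg\<bar> + \<bar>\<theta>\<bar> * \<bar>b - Em\<bar> \<le> D + \<bar>\<theta>\<bar> * D"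
      by (intro add_mono mult_left_mono) auto
    also have "\<dots> = (1 + \<bar>\<theta>\<bar>) / \<delta> * (d propensity * ((d g_t + d g_c) + (d m_t + d m_c)))"
      by (simp add: D_def algebra_simps add_divide_distrib)
    finally show ?thesis .
  qed
  ultimately show ?thesis by simp
qed

text \<open>At the true nuisance the bias bound is 0 and becomes an exact formula.\<close>

lemma score_mean:
  "(\<integral>w. score w \<theta> \<eta>\<^sub>0 \<partial>P\<^sub>0) = (\<integral>\<omega>. g_t \<eta>\<^sub>0 (X \<omega>) - g_c \<eta>\<^sub>0 (X \<omega>) \<partial>M) - \<theta> * (\<integral>\<omega>. m_t \<eta>\<^sub>0 (X \<omega>) - m_c \<eta>\<^sub>0 (X \<omega>) \<partial>M)"
proof -
  have "AE x in distr M MX X. norm (\<eta>\<^sub>0 x - \<eta>\<^sub>0 x) \<le> 0 \<and> propensity \<eta>\<^sub>0 x \<in> {\<epsilon>..1 - \<epsilon>}"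
    using overlap by (subst AE_distr_iff) auto
  from score_bias[OF eta0_measurable \<epsilon> this, of \<theta>] show ?thesis by simp
qed

lemma score_mean_zero: "(\<integral>w. score w \<theta>\<^sub>0 \<eta>\<^sub>0 \<partial>P\<^sub>0) = 0"
  unfolding score_mean using theta0_identified c compliance by simp

end

section \<open>Estimation error and interval length\<close>

text \<open>The logarithm in the width supplies the \<open>ln n\<close> that the union bound
  consumes. The factor 2 in front compensates for a small \<rho>:
  \<open>2 * ln (n * \<rho>\<^sup>2)\<close> is at least \<open>ln n\<close> as soon as
  \<open>ln n \<ge> - 2 * ln (\<rho>\<^sup>2)\<close>.\<close>

lemma half_width_ge:
  assumes "0 < \<alpha>" "\<alpha> < 1" "\<rho> > 0"
  shows "\<forall>\<^sub>F n in sequentially. sqrt (ln (real n) / real n) \<le> half_width \<alpha> \<rho> n"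
proof -
  have "filterlim (\<lambda>n. ln (real n)) at_top sequentially"
    by (rule filterlim_compose[OF ln_at_top filterlim_real_sequentially])
  then have "\<forall>\<^sub>F n in sequentially. ln (real n) \<ge> - (2 * ln (\<rho>\<^sup>2))"
    by (simp add: filterlim_at_top)
  then show ?thesis
    using eventually_gt_at_top[of 1]
  proof eventually_elim
    case (elim n)
    have n: "real n > 0" "\<rho>\<^sup>2 > 0" using elim assms by auto
    have "ln (real n) \<le> 2 * ln (real n * \<rho>\<^sup>2)"
      using elim n by (simp add: ln_mult)
    also have "\<dots> \<le> 2 * ln ((real n * \<rho>\<^sup>2 + 1) / \<alpha>)"
    proof -
      have "real n * \<rho>\<^sup>2 * \<alpha> \<le> real n * \<rho>\<^sup>2 * 1" using n assms by (intro mult_left_mono) auto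
      then have "real n * \<rho>\<^sup>2 \<le> (real n * \<rho>\<^sup>2 + 1) / \<alpha>" using assms by (simp add: field_simps)
      then show ?thesis using n by (simp add: ln_mono)
    qed
    finally have 1: "ln (real n) \<le> 2 * ln ((real n * \<rho>\<^sup>2 + 1) / \<alpha>)" .
    moreover have "ln (real n) \<ge> 0" using elim by simp
    ultimately have l: "ln ((real n * \<rho>\<^sup>2 + 1) / \<alpha>) \<ge> 0" by linarith
    have "ln (real n) / real n \<le> (2 * ln ((real n * \<rho>\<^sup>2 + 1) / \<alpha>)) / real n"
      using 1 n by (intro divide_right_mono) auto
    also have "\<dots> = 2 * real n * \<rho>\<^sup>2 / ((real n)\<^sup>2 * \<rho>\<^sup>2) * ln ((real n * \<rho>\<^sup>2 + 1) / \<alpha>)"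
      using n assms(3) by (simp add: power2_eq_square)
    also have "\<dots> \<le> (2 * real n * \<rho>\<^sup>2 + 1) / ((real n)\<^sup>2 * \<rho>\<^sup>2) * ln ((real n * \<rho>\<^sup>2 + 1) / \<alpha>)"
      using l n by (intro mult_right_mono divide_right_mono) auto
    finally show ?case
      unfolding half_width_def by (rule real_sqrt_le_mono)
  qed
qed

text \<open>The deterministic core, for one sample point: \<open>a\<close> is the numerator,
  \<open>d\<close> the slope, \<open>S\<close> the sum of capped squared scores. The error in units
  of \<open>sqrt (ln n / n)\<close> tends to 0, while \<open>sg\<close> is eventually at least
  \<open>sqrt s / 2\<close>.\<close>

lemma eventually_error_le_width:
  fixes a d S err sg :: "nat \<Rightarrow> real"
  assumes a: "(\<lambda>n. a n / sqrt (real n * ln (real n))) \<longlonglongrightarrow> 0"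
    and d: "(\<lambda>n. d n / real n) \<longlonglongrightarrow> D" "D \<noteq> 0"
    and S: "(\<lambda>n. S n / real n) \<longlonglongrightarrow> s" "s > 0"
    and err: "\<forall>\<^sub>F n in sequentially. err n = a n / d n"
    and sg: "\<forall>\<^sub>F n in sequentially. S n / 2 - real n * (err n)\<^sup>2 * real n powr (4/5) \<le> real n * (sg n)\<^sup>2"
    and sg0: "\<And>n. sg n \<ge> 0"
    and \<alpha>: "0 < \<alpha>" "\<alpha> < 1" and \<rho>: "\<rho> > 0"
  shows "\<forall>\<^sub>F n in sequentially. \<bar>err n\<bar> \<le> sg n * half_width \<alpha> \<rho> n"
proof -
  define r where "r n = err n * sqrt (real n / ln (real n))" for n
  have "(\<lambda>n. (a n / sqrt (real n * ln (real n))) / (d n / real n)) \<longlonglongrightarrow> 0 / D"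
    by (intro tendsto_divide a d)
  then have "(\<lambda>n. (a n / sqrt (real n * ln (real n))) / (d n / real n)) \<longlonglongrightarrow> 0" by simp
  then have r: "r \<longlonglongrightarrow> 0"
  proof (rule Lim_transform_eventually)
    show "\<forall>\<^sub>F n in sequentially. (a n / sqrt (real n * ln (real n))) / (d n / real n) = r n"
      using err eventually_gt_at_top[of 1]
    proof eventually_elim
      case (elim n)
      have "sqrt (real n / ln (real n)) = real n / sqrt (real n * ln (real n))"
        using elim(2) by (simp add: real_sqrt_divide real_sqrt_mult field_simps)
      then show ?case using elim by (simp add: r_def)
    qed
  qed
  \<comment> \<open>The correction to the variance is the squared error times
    \<open>n powr (4/5)\<close>, hence \<open>(r n)\<^sup>2\<close> times
    \<open>ln n * n powr (- 1/5)\<close>, and both factors vanish.\<close>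
  have "(\<lambda>n. (r n)\<^sup>2 * (ln (real n) / real n * real n powr (4/5))) \<longlonglongrightarrow> 0\<^sup>2 * 0"
    by (intro tendsto_mult tendsto_power r) real_asymp
  then have "(\<lambda>n. S n / real n / 2 - (r n)\<^sup>2 * (ln (real n) / real n * real n powr (4/5))) \<longlonglongrightarrow> s / 2 - 0"
    by (intro tendsto_diff tendsto_divide S tendsto_const) auto
  then have big: "\<forall>\<^sub>F n in sequentially. S n / real n / 2 - (r n)\<^sup>2 * (ln (real n) / real n * real n powr (4/5)) > s / 4"
    by (rule order_tendstoD(1)) (use S(2) in simp)
  have "\<forall>\<^sub>F n in sequentially. \<bar>r n\<bar> < sqrt s / 2"
    by (rule order_tendstoD(2)[OF tendsto_rabs_zero[OF r]]) (use S(2) in simp)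
  then show ?thesis
    using big sg half_width_ge[OF \<alpha> \<rho>] eventually_gt_at_top[of 1]
  proof eventually_elim
    case (elim n)
    have n: "real n > 0" "ln (real n) > 0" using elim(5) by auto
    have e: "err n = r n * sqrt (ln (real n) / real n)"
      using n by (simp add: r_def real_sqrt_divide)
    have "real n * (s / 4) \<le> real n * (S n / real n / 2 - (r n)\<^sup>2 * (ln (real n) / real n * real n powr (4/5)))"
      using elim(2) n by (intro mult_left_mono) auto
    also have "\<dots> = S n / 2 - real n * (err n)\<^sup>2 * real n powr (4/5)"
      unfolding e power_mult_distrib using n by (simp add: right_diff_distrib)
    also have "\<dots> \<le> real n * (sg n)\<^sup>2" by (rule elim(3))
    finally have "s / 4 \<le> (sg n)\<^sup>2" using n by simp
    then have "sqrt (s / 4) \<le> sg n" using sg0 by (simp add: real_le_lsqrt)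
    then have "sqrt s / 2 \<le> sg n" by (simp add: real_sqrt_divide)
    have "\<bar>err n\<bar> = \<bar>r n\<bar> * sqrt (ln (real n) / real n)" using n by (simp add: e abs_mult)
    also have "\<dots> \<le> sg n * half_width \<alpha> \<rho> n"
      using elim(1,4) n sg0[of n] \<open>sqrt s / 2 \<le> sg n\<close> by (intro mult_mono) auto
    finally show ?case .
  qed
qed

text \<open>\<open>trained_overlap\<close> bounds the inverse weights in the trained score;
  \<open>score_variance\<close> keeps the width from shrinking faster than
  \<open>sqrt (ln n / n)\<close>.\<close>

locale iv_asymptotics =
  iv_split_sample M MX MU Ypot Apot Y A Z X U \<eta>\<^sub>0 \<theta>\<^sub>0 W K \<kappa> \<eta>h \<theta>h +
  iv_regular M MX MU Ypot Apot Y A Z X U \<eta>\<^sub>0 \<theta>\<^sub>0 q C\<^sub>q \<epsilon> c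
  for M :: "'w measure" and MX :: "'x measure" and MU :: "'u measure"
    and Ypot Apot Y A Z X U \<eta>\<^sub>0 \<theta>\<^sub>0 W K \<kappa> \<eta>h \<theta>h q C\<^sub>q \<epsilon> c +
  fixes \<delta> :: real
  assumes consistent: "AE \<omega> in M. AE x in distr M MX X. (\<lambda>n. \<eta>h n \<omega> x) \<longlonglongrightarrow> \<eta>\<^sub>0 x"
    and bounded_error: "AE \<omega> in M. \<exists>B::real. \<forall>\<^sub>F n in sequentially.
      Linf_norm (distr M MX X) (\<lambda>x. \<eta>h n \<omega> x - \<eta>\<^sub>0 x) \<le> ennreal B"
    and product_rate:
      "AE \<omega> in M.
         (\<lambda>n. enn2real (Lp_norm (distr M MX X) 2 (\<lambda>x. propensity (\<eta>h n \<omega>) x - propensity \<eta>\<^sub>0 x) *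
            ((Lp_norm (distr M MX X) 2 (\<lambda>x. g_t (\<eta>h n \<omega>) x - g_t \<eta>\<^sub>0 x) +
              Lp_norm (distr M MX X) 2 (\<lambda>x. g_c (\<eta>h n \<omega>) x - g_c \<eta>\<^sub>0 x)) +
             (Lp_norm (distr M MX X) 2 (\<lambda>x. m_t (\<eta>h n \<omega>) x - m_t \<eta>\<^sub>0 x) +
              Lp_norm (distr M MX X) 2 (\<lambda>x. m_c (\<eta>h n \<omega>) x - m_c \<eta>\<^sub>0 x)))))
         \<in> o(\<lambda>n. sqrt (ln (ln (real n)) / real n))"
    and \<delta>: "\<delta> > 0"
    and trained_overlap: "AE \<omega> in M. \<forall>\<^sub>F n in sequentially. AE x in distr M MX X.
      propensity (\<eta>h n \<omega>) x \<in> {\<delta>..1 - \<delta>}"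
    and score_variance: "(\<integral>\<omega>. (score (Y \<omega>, A \<omega>, Z \<omega>, X \<omega>) \<theta>\<^sub>0 \<eta>\<^sub>0)\<^sup>2 \<partial>M) > 0"
begin

section \<open>Measurability and domination of the trained score\<close>

sublocale split: split_sample M "obs_space MX" P\<^sub>0 W \<kappa>
proof
  show "distr M (obs_space MX) (W i) = P\<^sub>0" if "i \<ge> 1" for i
    using data_law[OF that] unfolding obs_def[abs_def] .
qed (use data_indep rv_label labels_indep in auto)

lemma K_ge_1: "K \<ge> 1"
proof -
  obtain \<omega> where "\<omega> \<in> space M" using not_empty by blast
  then show ?thesis using labels[of 1 \<omega>] by auto
qed

text \<open>The hypotheses say nothing about \<open>\<eta>h 0\<close>.\<close>

definition \<eta>t :: "nat \<Rightarrow> 'w \<Rightarrow> 'x nuisance" where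
  "\<eta>t n \<omega> = (if n = 0 then \<eta>\<^sub>0 else \<eta>h n \<omega>)"

lemma measurable_\<eta>t: "(\<lambda>p. \<eta>t n (fst p) (snd p)) \<in> borel_measurable (split.train n \<Otimes>\<^sub>M MX)"
  using eta_hat_trained[of n] measurable_compose[OF measurable_snd eta0_measurable]
  by (cases "n = 0") (auto simp: \<eta>t_def case_prod_beta')

text \<open>The training information is treated as part of the covariate: over the product space the
  trained nuisance is one fixed nuisance, to which \<open>measurable_score\<close> applies.\<close>

lemma measurable_score_train:
  "(\<lambda>p. score (snd p) \<theta> (\<eta>t n (fst p))) \<in> borel_measurable (split.train n \<Otimes>\<^sub>M obs_space MX)"
proof -
  define T where "T = split.train n"
  define \<zeta> where "\<zeta> p = \<eta>t n (fst p) (snd p)" for p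
  have \<zeta>: "\<zeta> \<in> borel_measurable (T \<Otimes>\<^sub>M MX)"
    using measurable_\<eta>t[of n] by (simp add: \<zeta>_def[abs_def] T_def)
  let ?f = "\<lambda>p. (fst (snd p), fst (snd (snd p)), fst (snd (snd (snd p))), (fst p, snd (snd (snd (snd p)))))"
  have "?f \<in> measurable (T \<Otimes>\<^sub>M obs_space MX) (obs_space (T \<Otimes>\<^sub>M MX))"
    unfolding obs_space_def by measurable
  from measurable_compose[OF this measurable_score[OF \<zeta>, of \<theta>]]
  have "(\<lambda>p. score (?f p) \<theta> \<zeta>) \<in> borel_measurable (T \<Otimes>\<^sub>M obs_space MX)" .
  moreover have "score (?f p) \<theta> \<zeta> = score (snd p) \<theta> (\<eta>t n (fst p))" for p
    by (cases p) (auto simp: score_def \<zeta>_def g_t_def g_c_def m_t_def m_c_def propensity_def)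
  ultimately show ?thesis by (simp add: T_def)
qed

lemma \<eta>t_section: "\<omega> \<in> space M \<Longrightarrow> \<eta>t n \<omega> \<in> borel_measurable MX"
  using measurable_compose[OF measurable_Pair1' measurable_\<eta>t, of \<omega> n] by simp

lemma AE_covariate:
  assumes "AE x in distr M MX X. Q x"
  shows "AE w in P\<^sub>0. Q (snd (snd (snd w)))"
proof -
  have m: "(\<lambda>w. snd (snd (snd w))) \<in> measurable (obs_space MX) MX"
    unfolding obs_space_def by measurable
  have "distr P\<^sub>0 MX (\<lambda>w. snd (snd (snd w))) = distr M MX X"
    using m by (subst distr_distr) (auto simp: comp_def obs_def)
  then have "AE x in distr P\<^sub>0 MX (\<lambda>w. snd (snd (snd w))). Q x"
    using assms by (simp only:)
  then show ?thesis
    using m by (intro AE_distrD[where M=P\<^sub>0 and M'=MX and f="\<lambda>w. snd (snd (snd w))"]) simp_all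
qed

definition near :: "'w \<Rightarrow> real \<Rightarrow> nat \<Rightarrow> bool" where
  "near \<omega> B n \<longleftrightarrow> (AE x in distr M MX X. norm (\<eta>t n \<omega> x - \<eta>\<^sub>0 x) \<le> B \<and> propensity (\<eta>t n \<omega>) x \<in> {\<delta>..1 - \<delta>})"

lemma eventually_near: "AE \<omega> in M. \<exists>B. \<forall>\<^sub>F n in sequentially. near \<omega> B n"
  using bounded_error trained_overlap
proof eventually_elim
  case (elim \<omega>)
  then obtain B where "\<forall>\<^sub>F n in sequentially. Linf_norm (distr M MX X) (\<lambda>x. \<eta>h n \<omega> x - \<eta>\<^sub>0 x) \<le> ennreal B"
    by blast
  \<comment> \<open>\<open>ennreal\<close> sends a negative \<open>B\<close> to 0, so the real bound
    is \<open>max B 0\<close>.\<close>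
  with elim(2) have "\<forall>\<^sub>F n in sequentially. near \<omega> (max B 0) n"
    using eventually_gt_at_top[of 0]
  proof eventually_elim
    case (elim n)
    note e = elim
    have "AE x in distr M MX X. ennreal (norm (\<eta>h n \<omega> x - \<eta>\<^sub>0 x)) \<le> Linf_norm (distr M MX X) (\<lambda>x. \<eta>h n \<omega> x - \<eta>\<^sub>0 x)"
      using esssup_AE[where M="distr M MX X" and f="\<lambda>x. ennreal (norm (\<eta>h n \<omega> x - \<eta>\<^sub>0 x))"]
      by (simp only: Linf_norm_def)
    then have "AE x in distr M MX X. norm (\<eta>h n \<omega> x - \<eta>\<^sub>0 x) \<le> max B 0"
    proof eventually_elim
      case (elim x)
      note elim
      also note e(2)
      also have "ennreal B \<le> ennreal (max B 0)" by (rule ennreal_leI) simp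
      finally have "ennreal (norm (\<eta>h n \<omega> x - \<eta>\<^sub>0 x)) \<le> ennreal (max B 0)" .
      then show ?case by (subst (asm) ennreal_le_iff) simp_all
    qed
    then show ?case
      unfolding near_def using e(1) e(3) by (auto simp: \<eta>t_def)
  qed
  then show ?case ..
qed

lemma score_dominated:
  assumes "near \<omega> B n"
  shows "AE w in P\<^sub>0. \<bar>score w \<theta> (\<eta>t n \<omega>)\<bar> \<le> (1 + \<bar>\<theta>\<bar>) * (2 + 2 / \<delta>) * (1 + B) * envelope \<eta>\<^sub>0 w"
  using AE_covariate[OF assms[unfolded near_def]]
proof eventually_elim
  case (elim w)
  obtain y a z x where "w = (y, a, z, x)" by (cases w)
  with elim show ?case using score_le_envelope[OF \<delta>, of "\<eta>t n \<omega>" x \<eta>\<^sub>0 B y a z \<theta>] by simp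
qed

lemma score0_dominated: "AE w in P\<^sub>0. \<bar>score w \<theta> \<eta>\<^sub>0\<bar> \<le> (1 + \<bar>\<theta>\<bar>) * (2 + 2 / \<epsilon>) * envelope \<eta>\<^sub>0 w"
proof -
  have "AE x in distr M MX X. propensity \<eta>\<^sub>0 x \<in> {\<epsilon>..1 - \<epsilon>}"
    using overlap by (subst AE_distr_iff) auto
  from AE_covariate[OF this] show ?thesis
  proof eventually_elim
    case (elim w)
    obtain y a z x where "w = (y, a, z, x)" by (cases w)
    with elim show ?case using score_le_envelope[OF \<epsilon>, of \<eta>\<^sub>0 x \<eta>\<^sub>0 0 y a z \<theta>] by simp
  qed
qed

lemma score_converges:
  assumes "AE x in distr M MX X. (\<lambda>n. \<eta>h n \<omega> x) \<longlonglongrightarrow> \<eta>\<^sub>0 x"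
  shows "AE w in P\<^sub>0. (\<lambda>n. score w \<theta> (\<eta>t n \<omega>)) \<longlonglongrightarrow> score w \<theta> \<eta>\<^sub>0"
proof -
  have "AE x in distr M MX X. propensity \<eta>\<^sub>0 x \<in> {\<epsilon>..1 - \<epsilon>}"
    using overlap by (subst AE_distr_iff) auto
  from AE_covariate[OF this] AE_covariate[OF assms] show ?thesis
  proof eventually_elim
    case (elim w)
    obtain y a z x where w: "w = (y, a, z, x)" by (cases w)
    have "(\<lambda>n. \<eta>t n \<omega> x) \<longlonglongrightarrow> \<eta>\<^sub>0 x"
    proof (rule Lim_transform_eventually)
      show "(\<lambda>n. \<eta>h n \<omega> x) \<longlonglongrightarrow> \<eta>\<^sub>0 x" using elim(2) w by simp
      show "\<forall>\<^sub>F n in sequentially. \<eta>h n \<omega> x = \<eta>t n \<omega> x"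
        using eventually_gt_at_top[of 0] by eventually_elim (simp add: \<eta>t_def)
    qed
    then show ?case
      using elim(1) \<epsilon> unfolding w by (intro tendsto_score) auto
  qed
qed

section \<open>Almost sure limits along the first fold\<close>

lemma envelope_measurable: "envelope \<eta>\<^sub>0 \<in> borel_measurable (obs_space MX)"
  by (rule measurable_envelope[OF eta0_measurable])

lemma envelope_integrable: "integrable P\<^sub>0 (envelope \<eta>\<^sub>0)" "integrable P\<^sub>0 (\<lambda>w. (envelope \<eta>\<^sub>0 w)\<^sup>2)"
  using split.P.integrable_of_power4[OF _ envelope_power4] envelope_measurable by simp_all

lemma measurable_score_section:
  "\<omega> \<in> space M \<Longrightarrow> (\<lambda>w. score w \<theta> (\<eta>t n \<omega>)) \<in> borel_measurable P\<^sub>0"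
  using measurable_score[OF \<eta>t_section] by simp

lemma measurable_score0: "(\<lambda>w. score w \<theta> \<eta>\<^sub>0) \<in> borel_measurable P\<^sub>0"
  using measurable_score[OF eta0_measurable] by simp

lemma integrable_score0: "integrable P\<^sub>0 (\<lambda>w. score w \<theta> \<eta>\<^sub>0)"
  by (rule split.P.truncation_bounds(1)[OF measurable_score0 score0_dominated zero_less_one envelope_power4])

text \<open>A fold sum divided by \<open>n\<close> is the fold proportion times the conditional mean
  plus a negligible deviation; dominated convergence gives the mean, balance the proportion
  \<open>1 / K\<close>. Squared scores are capped at 1 because the envelope need not dominate the
  uncapped squares, and the variance has only to be bounded below. The bound on single slopes
  controls how the squares change when \<open>\<theta>\<^sub>0\<close> is replaced by
  \<open>\<theta>h n\<close>.\<close>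

lemma AE_denominator:
  "AE \<omega> in M. (\<lambda>n. (\<Sum>i\<in>split.I1 n \<omega>. score (W i \<omega>) 0 (\<eta>t n \<omega>) - score (W i \<omega>) 1 (\<eta>t n \<omega>)) / real n)
    \<longlonglongrightarrow> (\<integral>\<omega>. m_t \<eta>\<^sub>0 (X \<omega>) - m_c \<eta>\<^sub>0 (X \<omega>) \<partial>M) / real K" (is ?lim)
  and AE_denominator_max:
  "AE \<omega> in M. \<forall>\<^sub>F n in sequentially. \<forall>i\<in>split.I1 n \<omega>.
    \<bar>score (W i \<omega>) 0 (\<eta>t n \<omega>) - score (W i \<omega>) 1 (\<eta>t n \<omega>)\<bar> \<le> real n powr (2/5)" (is ?max)
  and AE_truncated_variance:
  "AE \<omega> in M. (\<lambda>n. (\<Sum>i\<in>split.I1 n \<omega>. min 1 ((score (W i \<omega>) \<theta>\<^sub>0 (\<eta>t n \<omega>))\<^sup>2)) / real n)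
    \<longlonglongrightarrow> (\<integral>w. min 1 ((score w \<theta>\<^sub>0 \<eta>\<^sub>0)\<^sup>2) \<partial>P\<^sub>0) / real K" (is ?var)
proof -
  note K = K_ge_1
  have bal: "AE \<omega> in M. (\<lambda>n. real (card (split.I1 n \<omega>)) / real n) \<longlonglongrightarrow> 1 / real K"
    using balanced[of 1] K by simp
  have transfer: "(\<lambda>n. s n / real n) \<longlonglongrightarrow> l / real K"
    if "(\<lambda>n. (s n - k n * v n) / real n) \<longlonglongrightarrow> 0" "(\<lambda>n. k n / real n) \<longlonglongrightarrow> 1 / real K" "v \<longlonglongrightarrow> l"
    for s k v :: "nat \<Rightarrow> real" and l
  proof -
    have "(\<lambda>n. (s n - k n * v n) / real n + k n / real n * v n) \<longlonglongrightarrow> 0 + 1 / real K * l"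
      by (intro tendsto_intros that)
    then show ?thesis by (simp add: diff_divide_distrib)
  qed
  define b where "b n p = score (snd p) 0 (\<eta>t n (fst p)) - score (snd p) 1 (\<eta>t n (fst p))" for n p
  have b: "b n \<in> borel_measurable (split.train n \<Otimes>\<^sub>M obs_space MX)" for n
    unfolding b_def[abs_def] by (intro borel_measurable_diff measurable_score_train)
  have b_near: "AE w in P\<^sub>0. \<bar>b n (\<omega>, w)\<bar> \<le> (3 * (2 + 2 / \<delta>) * (1 + B)) * envelope \<eta>\<^sub>0 w" if "near \<omega> B n" for \<omega> B n
    using score_dominated[OF that, of 0] score_dominated[OF that, of 1]
  proof eventually_elim
    case (elim w)
    define E where "E = (2 + 2 / \<delta>) * (1 + B) * envelope \<eta>\<^sub>0 w"
    have "\<bar>score w 0 (\<eta>t n \<omega>)\<bar> \<le> E" "\<bar>score w 1 (\<eta>t n \<omega>)\<bar> \<le> 2 * E"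
      using elim by (simp_all only: E_def mult.assoc abs_one abs_zero one_add_one add_0_right mult_1)
    then have "\<bar>b n (\<omega>, w)\<bar> \<le> 3 * E" by (simp add: b_def)
    then show ?case by (simp only: E_def mult.assoc)
  qed
  have b_dom: "AE \<omega> in M. \<exists>C. \<forall>\<^sub>F n in sequentially. AE w in P\<^sub>0. \<bar>b n (\<omega>, w)\<bar> \<le> C * envelope \<eta>\<^sub>0 w"
    using eventually_near
  proof eventually_elim
    case (elim \<omega>)
    then obtain B where "\<forall>\<^sub>F n in sequentially. near \<omega> B n" ..
    then show ?case by (auto elim!: eventually_mono dest!: b_near)
  qed
  note env = envelope_measurable envelope_nonneg[of \<eta>\<^sub>0] envelope_power4
  show ?lim
    using split.fold_mean_negligible[OF b env b_dom] b_dom consistent bal AE_space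
  proof eventually_elim
    case (elim \<omega>)
    obtain C where C: "\<forall>\<^sub>F n in sequentially. AE w in P\<^sub>0. \<bar>b n (\<omega>, w)\<bar> \<le> C * envelope \<eta>\<^sub>0 w"
      using elim(2) ..
    have "(\<lambda>n. \<integral>w. b n (\<omega>, w) \<partial>P\<^sub>0) \<longlonglongrightarrow> (\<integral>w. score w 0 \<eta>\<^sub>0 - score w 1 \<eta>\<^sub>0 \<partial>P\<^sub>0)"
    proof (rule tendsto_integral_dominated[OF _ _ _ _ C])
      show "integrable P\<^sub>0 (\<lambda>w. C * envelope \<eta>\<^sub>0 w)" using envelope_integrable by simp
      show "AE w in P\<^sub>0. (\<lambda>n. b n (\<omega>, w)) \<longlonglongrightarrow> score w 0 \<eta>\<^sub>0 - score w 1 \<eta>\<^sub>0"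
        using score_converges[OF elim(3), of 0] score_converges[OF elim(3), of 1]
        by eventually_elim (auto simp: b_def intro: tendsto_diff)
      show "(\<lambda>w. score w 0 \<eta>\<^sub>0 - score w 1 \<eta>\<^sub>0) \<in> borel_measurable P\<^sub>0"
        by (intro borel_measurable_diff measurable_score0)
      show "(\<lambda>w. b n (\<omega>, w)) \<in> borel_measurable P\<^sub>0" for n
        unfolding b_def fst_conv snd_conv by (intro borel_measurable_diff measurable_score_section elim(5))
    qed
    also have "(\<integral>w. score w 0 \<eta>\<^sub>0 - score w 1 \<eta>\<^sub>0 \<partial>P\<^sub>0) = (\<integral>\<omega>. m_t \<eta>\<^sub>0 (X \<omega>) - m_c \<eta>\<^sub>0 (X \<omega>) \<partial>M)"
      using integrable_score0 score_mean[of 0] score_mean[of 1] by simp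
    finally show ?case
      using transfer[OF elim(1) elim(4)] by (simp add: b_def)
  qed
  show ?max
    using split.AE_fold_dominated[of b "\<lambda>n. n", OF b env(1,2)] b_dom split.AE_max_envelope[OF env]
  proof eventually_elim
    case (elim \<omega>)
    obtain C where C: "\<forall>\<^sub>F n in sequentially. AE w in P\<^sub>0. \<bar>b n (\<omega>, w)\<bar> \<le> C * envelope \<eta>\<^sub>0 w"
      using elim(2) ..
    note dom = elim(1)
    show ?case
      using C spec[OF elim(3), of "real (nat \<lceil>C\<rceil>)"]
    proof eventually_elim
      case (elim n)
      show ?case
      proof
        fix i assume i: "i \<in> split.I1 n \<omega>"
        then have "\<bar>b n (\<omega>, W i \<omega>)\<bar> \<le> real (nat \<lceil>C\<rceil>) * envelope \<eta>\<^sub>0 (W i \<omega>)"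
          using dom elim(1) i by blast
        also have "\<dots> \<le> real n powr (2/5)"
          using elim(2) i by (auto simp: fold_set_def)
        finally show "\<bar>score (W i \<omega>) 0 (\<eta>t n \<omega>) - score (W i \<omega>) 1 (\<eta>t n \<omega>)\<bar> \<le> real n powr (2/5)"
          by (simp add: b_def)
      qed
    qed
  qed
  define v where "v n p = min 1 ((score (snd p) \<theta>\<^sub>0 (\<eta>t n (fst p)))\<^sup>2)" for n p
  have v: "v n \<in> borel_measurable (split.train n \<Otimes>\<^sub>M obs_space MX)" for n
    unfolding v_def[abs_def] using measurable_score_train[of \<theta>\<^sub>0 n] by measurable
  have "\<bar>v n p\<bar> \<le> 1 * envelope \<eta>\<^sub>0 w" for n p w
    using envelope_ge_1[of \<eta>\<^sub>0 w] by (simp add: v_def)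
  then have v_dom: "AE \<omega> in M. \<exists>C. \<forall>\<^sub>F n in sequentially. AE w in P\<^sub>0. \<bar>v n (\<omega>, w)\<bar> \<le> C * envelope \<eta>\<^sub>0 w"
    by (intro AE_I2 exI[of _ 1] always_eventually allI) auto
  show ?var
    using split.fold_mean_negligible[OF v env v_dom] consistent bal AE_space
  proof eventually_elim
    case (elim \<omega>)
    have "(\<lambda>n. \<integral>w. v n (\<omega>, w) \<partial>P\<^sub>0) \<longlonglongrightarrow> (\<integral>w. min 1 ((score w \<theta>\<^sub>0 \<eta>\<^sub>0)\<^sup>2) \<partial>P\<^sub>0)"
    proof (rule tendsto_integral_dominated[where g="\<lambda>_. 1"])
      show "AE w in P\<^sub>0. (\<lambda>n. v n (\<omega>, w)) \<longlonglongrightarrow> min 1 ((score w \<theta>\<^sub>0 \<eta>\<^sub>0)\<^sup>2)"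
        using score_converges[OF elim(2), of \<theta>\<^sub>0]
        by eventually_elim (auto simp: v_def intro!: tendsto_intros)
      show "(\<lambda>w. min 1 ((score w \<theta>\<^sub>0 \<eta>\<^sub>0)\<^sup>2)) \<in> borel_measurable P\<^sub>0"
        using measurable_score0 by measurable
      show "(\<lambda>w. v n (\<omega>, w)) \<in> borel_measurable P\<^sub>0" for n
        unfolding v_def using measurable_score_section[OF elim(4), of \<theta>\<^sub>0 n] by simp
    qed (auto simp: v_def split.P.integrable_const)
    from transfer[OF elim(1) elim(3) this] show ?case by (simp add: v_def)
  qed
qed

text \<open>Capping at 1 does not change the zero set of the squared score.\<close>

lemma truncated_variance_pos: "(\<integral>w. min 1 ((score w \<theta>\<^sub>0 \<eta>\<^sub>0)\<^sup>2) \<partial>P\<^sub>0) > 0"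
proof (rule ccontr)
  assume "\<not> ?thesis"
  moreover have "(\<integral>w. min 1 ((score w \<theta>\<^sub>0 \<eta>\<^sub>0)\<^sup>2) \<partial>P\<^sub>0) \<ge> 0" by (rule integral_nonneg_AE) simp
  ultimately have z: "(\<integral>w. min 1 ((score w \<theta>\<^sub>0 \<eta>\<^sub>0)\<^sup>2) \<partial>P\<^sub>0) = 0" by simp
  have "integrable P\<^sub>0 (\<lambda>w. min 1 ((score w \<theta>\<^sub>0 \<eta>\<^sub>0)\<^sup>2))"
    by (rule split.P.integrable_const_bound[where B=1]) (use measurable_score0 in auto)
  from integral_nonneg_eq_0_iff_AE[OF this] z
  have "AE w in P\<^sub>0. min 1 ((score w \<theta>\<^sub>0 \<eta>\<^sub>0)\<^sup>2) = 0" by simp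
  then have "AE w in P\<^sub>0. (score w \<theta>\<^sub>0 \<eta>\<^sub>0)\<^sup>2 = 0"
    by eventually_elim (auto simp: min_def split: if_splits)
  then have "(\<integral>w. (score w \<theta>\<^sub>0 \<eta>\<^sub>0)\<^sup>2 \<partial>P\<^sub>0) = 0" by (rule integral_eq_zero_AE)
  then have "(\<integral>\<omega>. (score (obs \<omega>) \<theta>\<^sub>0 \<eta>\<^sub>0)\<^sup>2 \<partial>M) = 0"
    using measurable_score[OF eta0_measurable, of \<theta>\<^sub>0] by (subst (asm) integral_distr) auto
  then show False using score_variance by (simp add: obs_def)
qed

lemma Lp_norm_covariate:
  assumes f: "f \<in> borel_measurable MX" and B: "AE x in distr M MX X. \<bar>f x\<bar> \<le> (B::real)"
  shows "Lp_norm (distr M MX X) 2 f = ennreal (sqrt (\<integral>\<omega>. (f (X \<omega>))\<^sup>2 \<partial>M))"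
proof -
  interpret PX: prob_space "distr M MX X" by (rule prob_space_distr) (rule rv_X)
  have "integrable (distr M MX X) (\<lambda>x. (norm (f x))\<^sup>2)"
  proof (rule PX.integrable_const_bound[where B="B\<^sup>2"])
    show "AE x in distr M MX X. norm ((norm (f x))\<^sup>2) \<le> B\<^sup>2"
      using B
    proof eventually_elim
      case (elim x)
      then show ?case using power_mono[of "\<bar>f x\<bar>" B 2] by simp
    qed
  qed (use f in measurable)
  from Lp_norm_2[OF this] show ?thesis
    using f by (subst (asm) integral_distr) auto
qed

lemma AE_bias:
  "AE \<omega> in M. (\<lambda>n. (\<integral>w. score w \<theta>\<^sub>0 (\<eta>t n \<omega>) \<partial>P\<^sub>0) / sqrt (ln (real n) / real n)) \<longlonglongrightarrow> 0"
  using product_rate eventually_near AE_space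
proof eventually_elim
  case (elim \<omega>)
  obtain B where B: "\<forall>\<^sub>F n in sequentially. near \<omega> B n" using elim(2) ..
  define x where "x n = enn2real (Lp_norm (distr M MX X) 2 (\<lambda>x. propensity (\<eta>h n \<omega>) x - propensity \<eta>\<^sub>0 x) *
            ((Lp_norm (distr M MX X) 2 (\<lambda>x. g_t (\<eta>h n \<omega>) x - g_t \<eta>\<^sub>0 x) +
              Lp_norm (distr M MX X) 2 (\<lambda>x. g_c (\<eta>h n \<omega>) x - g_c \<eta>\<^sub>0 x)) +
             (Lp_norm (distr M MX X) 2 (\<lambda>x. m_t (\<eta>h n \<omega>) x - m_t \<eta>\<^sub>0 x) +
              Lp_norm (distr M MX X) 2 (\<lambda>x. m_c (\<eta>h n \<omega>) x - m_c \<eta>\<^sub>0 x))))" for n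
  have "x \<in> o(\<lambda>n. sqrt (ln (ln (real n)) / real n))" unfolding x_def[abs_def] using elim(1) .
  \<comment> \<open>The error is measured against \<open>sqrt (ln n / n)\<close>, the lower bound
    for the half-width, so the rate is transferred to that scale.\<close>
  also have "(\<lambda>n::nat. sqrt (ln (ln (real n)) / real n)) \<in> O(\<lambda>n. sqrt (ln (real n) / real n))"
    by real_asymp
  finally have "(\<lambda>n. x n / sqrt (ln (real n) / real n)) \<longlonglongrightarrow> 0"
    by (rule smalloD_tendsto)
  from tendsto_mult_right_zero[OF this, of "(1 + \<bar>\<theta>\<^sub>0\<bar>) / \<delta>"]
  show ?case
  proof (rule Lim_null_comparison[rotated])
    show "\<forall>\<^sub>F n in sequentially. norm ((\<integral>w. score w \<theta>\<^sub>0 (\<eta>t n \<omega>) \<partial>P\<^sub>0) / sqrt (ln (real n) / real n)) \<le>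
        (1 + \<bar>\<theta>\<^sub>0\<bar>) / \<delta> * (x n / sqrt (ln (real n) / real n))"
      using B eventually_gt_at_top[of 1]
    proof eventually_elim
      case (elim n)
      have eq: "\<eta>h n \<omega> = \<eta>t n \<omega>" using elim(2) by (simp add: \<eta>t_def)
      note m = \<eta>t_section[OF \<open>\<omega> \<in> space M\<close>, of n]
      define d where "d f = sqrt (\<integral>\<omega>'. (f (\<eta>t n \<omega>) (X \<omega>') - f \<eta>\<^sub>0 (X \<omega>'))\<^sup>2 \<partial>M)" for f :: "'x nuisance \<Rightarrow> 'x \<Rightarrow> real"
      have d0: "d f \<ge> 0" for f by (simp add: d_def)
      have L: "Lp_norm (distr M MX X) 2 (\<lambda>x. f (\<eta>t n \<omega>) x - f \<eta>\<^sub>0 x) = ennreal (d f)"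
        if "f \<in> {g_t, g_c, m_t, m_c, propensity}" for f
        unfolding d_def
      proof (rule Lp_norm_covariate)
        show "(\<lambda>x. f (\<eta>t n \<omega>) x - f \<eta>\<^sub>0 x) \<in> borel_measurable MX"
          using that measurable_nuisance_components[OF m] measurable_eta0 by (auto intro: borel_measurable_diff)
        have "AE x in distr M MX X. norm (\<eta>t n \<omega> x - \<eta>\<^sub>0 x) \<le> B"
          using elim(1) unfolding near_def by eventually_elim simp
        then show "AE x in distr M MX X. \<bar>f (\<eta>t n \<omega>) x - f \<eta>\<^sub>0 x\<bar> \<le> B"
        proof eventually_elim
          case (elim x)
          then show ?case
            using that nuisance_diff_le[of "\<eta>t n \<omega>" x \<eta>\<^sub>0] by auto
        qed
      qed
      \<comment> \<open>Where \<open>near\<close> holds all five norms are finite, so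
        \<open>enn2real\<close> loses nothing.\<close>
      have x: "x n = d propensity * ((d g_t + d g_c) + (d m_t + d m_c))"
        unfolding x_def eq using d0
        by (simp add: L ennreal_mult[symmetric] ennreal_plus[symmetric] del: ennreal_plus)
      have "\<bar>(\<integral>w. score w \<theta>\<^sub>0 (\<eta>t n \<omega>) \<partial>P\<^sub>0)\<bar> \<le> (1 + \<bar>\<theta>\<^sub>0\<bar>) / \<delta> * x n"
        using score_bias[OF m \<delta> elim(1)[unfolded near_def], of \<theta>\<^sub>0] score_mean[of \<theta>\<^sub>0] score_mean_zero
        unfolding x d_def by simp
      then have "\<bar>(\<integral>w. score w \<theta>\<^sub>0 (\<eta>t n \<omega>) \<partial>P\<^sub>0)\<bar> / sqrt (ln (real n) / real n) \<le> (1 + \<bar>\<theta>\<^sub>0\<bar>) / \<delta> * x n / sqrt (ln (real n) / real n)"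
        using elim(2) by (intro divide_right_mono) auto
      then show ?case using elim(2) by simp
    qed
  qed
qed

text \<open>The sum of trained scores splits into the centred increments from
  \<open>\<eta>\<^sub>0\<close> to \<open>\<eta>t n\<close>, the sum at
  \<open>\<eta>\<^sub>0\<close>, and the fold size times the bias. They are small for different
  reasons: vanishing variance, the sparse subsequence, and double robustness.\<close>

lemma AE_numerator:
  "AE \<omega> in M. (\<lambda>n. (\<Sum>i\<in>split.I1 n \<omega>. score (W i \<omega>) \<theta>\<^sub>0 (\<eta>t n \<omega>)) / sqrt (real n * ln (real n))) \<longlonglongrightarrow> 0"
proof -
  define R where "R n p = score (snd p) \<theta>\<^sub>0 (\<eta>t n (fst p)) - score (snd p) \<theta>\<^sub>0 \<eta>\<^sub>0" for n p
  have R: "R n \<in> borel_measurable (split.train n \<Otimes>\<^sub>M obs_space MX)" for n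
    unfolding R_def[abs_def] using measurable_compose[OF measurable_snd measurable_score[OF eta0_measurable, of \<theta>\<^sub>0]]
    by (intro borel_measurable_diff measurable_score_train) auto
  note env = envelope_measurable envelope_nonneg[of \<eta>\<^sub>0] envelope_power4
  have dom: "AE \<omega> in M. \<exists>C. \<forall>\<^sub>F n in sequentially. AE w in P\<^sub>0. \<bar>R n (\<omega>, w)\<bar> \<le> C * envelope \<eta>\<^sub>0 w"
    using eventually_near
  proof eventually_elim
    case (elim \<omega>)
    then obtain B where B: "\<forall>\<^sub>F n in sequentially. near \<omega> B n" ..
    define C1 where "C1 = (1 + \<bar>\<theta>\<^sub>0\<bar>) * (2 + 2 / \<delta>) * (1 + B)"
    define C2 where "C2 = (1 + \<bar>\<theta>\<^sub>0\<bar>) * (2 + 2 / \<epsilon>)"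
    from B have "\<forall>\<^sub>F n in sequentially. AE w in P\<^sub>0. \<bar>R n (\<omega>, w)\<bar> \<le> (C1 + C2) * envelope \<eta>\<^sub>0 w"
    proof eventually_elim
      case (elim n)
      show ?case
        using score_dominated[OF elim, of \<theta>\<^sub>0] score0_dominated[of \<theta>\<^sub>0] unfolding C1_def[symmetric] C2_def[symmetric]
        by eventually_elim (simp add: R_def distrib_right)
    qed
    then show ?case ..
  qed
  have var: "AE \<omega> in M. (\<lambda>n. \<integral>w. (R n (\<omega>, w))\<^sup>2 \<partial>P\<^sub>0) \<longlonglongrightarrow> 0"
    using dom consistent AE_space
  proof eventually_elim
    case (elim \<omega>)
    obtain C where C: "\<forall>\<^sub>F n in sequentially. AE w in P\<^sub>0. \<bar>R n (\<omega>, w)\<bar> \<le> C * envelope \<eta>\<^sub>0 w"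
      using elim(1) ..
    have "(\<lambda>n. \<integral>w. (R n (\<omega>, w))\<^sup>2 \<partial>P\<^sub>0) \<longlonglongrightarrow> (\<integral>w. 0 \<partial>P\<^sub>0)"
    proof (rule tendsto_integral_dominated)
      show "integrable P\<^sub>0 (\<lambda>w. C\<^sup>2 * (envelope \<eta>\<^sub>0 w)\<^sup>2)" using envelope_integrable by simp
      show "AE w in P\<^sub>0. (\<lambda>n. (R n (\<omega>, w))\<^sup>2) \<longlonglongrightarrow> 0"
        using score_converges[OF elim(2), of \<theta>\<^sub>0]
      proof eventually_elim
        case (elim w)
        from tendsto_power[OF tendsto_diff[OF elim tendsto_const[of "score w \<theta>\<^sub>0 \<eta>\<^sub>0"]], of 2]
        show ?case by (simp add: R_def)
      qed
      show "\<forall>\<^sub>F n in sequentially. AE w in P\<^sub>0. \<bar>(R n (\<omega>, w))\<^sup>2\<bar> \<le> C\<^sup>2 * (envelope \<eta>\<^sub>0 w)\<^sup>2"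
        using C
      proof eventually_elim
        case (elim n)
        then show ?case
        proof eventually_elim
          case (elim w)
          then have "\<bar>R n (\<omega>, w)\<bar>\<^sup>2 \<le> (C * envelope \<eta>\<^sub>0 w)\<^sup>2" by (intro power_mono) auto
          then show ?case by (simp add: power_mult_distrib)
        qed
      qed
      show "(\<lambda>w. (R n (\<omega>, w))\<^sup>2) \<in> borel_measurable P\<^sub>0" for n
        using split.measurable_train_section[OF R elim(3)] by measurable
    qed simp
    then show ?case by simp
  qed
  have g: "(\<lambda>w. score w \<theta>\<^sub>0 \<eta>\<^sub>0) \<in> borel_measurable (obs_space MX)"
    by (rule measurable_score[OF eta0_measurable])
  show ?thesis
    using split.fold_sum_negligible[OF R env dom var] split.fold_sum_iid_negligible[OF g score_mean_zero env score0_dominated]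
      AE_bias eventually_near AE_space
  proof eventually_elim
    case (elim \<omega>)
    define q where "q n = sqrt (real n * ln (real n))" for n
    define k where "k n = real (card (split.I1 n \<omega>))" for n
    define m where "m n = (\<integral>w. score w \<theta>\<^sub>0 (\<eta>t n \<omega>) \<partial>P\<^sub>0)" for n
    define s where "s n = (\<Sum>i\<in>split.I1 n \<omega>. R n (\<omega>, W i \<omega>))" for n
    define s0 where "s0 n = (\<Sum>i\<in>split.I1 n \<omega>. score (W i \<omega>) \<theta>\<^sub>0 \<eta>\<^sub>0)" for n
    obtain B where B: "\<forall>\<^sub>F n in sequentially. near \<omega> B n" using elim(4) ..
    have mean: "\<forall>\<^sub>F n in sequentially. (\<integral>w. R n (\<omega>, w) \<partial>P\<^sub>0) = m n"
      using B
    proof eventually_elim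
      case (elim n)
      have "integrable P\<^sub>0 (\<lambda>w. score w \<theta>\<^sub>0 (\<eta>t n \<omega>))"
        by (rule split.P.truncation_bounds(1)[OF measurable_score_section[OF \<open>\<omega> \<in> space M\<close>] score_dominated[OF elim] zero_less_one envelope_power4])
      then show ?case using integrable_score0 score_mean_zero by (simp add: R_def m_def)
    qed
    have bias: "(\<lambda>n. k n * m n / q n) \<longlonglongrightarrow> 0"
    proof (rule Lim_null_comparison[OF _ tendsto_rabs_zero[OF elim(3)]])
      show "\<forall>\<^sub>F n in sequentially. norm (k n * m n / q n) \<le>
          \<bar>(\<integral>w. score w \<theta>\<^sub>0 (\<eta>t n \<omega>) \<partial>P\<^sub>0) / sqrt (ln (real n) / real n)\<bar>"
        using eventually_gt_at_top[of 1]
      proof eventually_elim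
        case (elim n)
        have "k n \<le> real n"
          unfolding k_def using card_fold_set_le by simp
        then have "k n * \<bar>m n\<bar> / q n \<le> real n * \<bar>m n\<bar> / q n"
          using elim by (intro divide_right_mono mult_right_mono) (auto simp: q_def)
        also have "\<dots> = \<bar>m n\<bar> / sqrt (ln (real n) / real n)"
          using elim by (simp add: q_def real_sqrt_mult real_sqrt_divide field_simps)
        finally show ?case using elim by (simp add: m_def[symmetric] abs_mult k_def q_def)
      qed
    qed
    have "(\<lambda>n. (s n - k n * (\<integral>w. R n (\<omega>, w) \<partial>P\<^sub>0)) / q n + s0 n / q n + k n * m n / q n) \<longlonglongrightarrow> 0 + 0 + 0"
      using elim(1,2) bias unfolding s_def s0_def k_def q_def by (intro tendsto_add)
    then have "(\<lambda>n. (s n - k n * (\<integral>w. R n (\<omega>, w) \<partial>P\<^sub>0)) / q n + s0 n / q n + k n * m n / q n) \<longlonglongrightarrow> 0" by simp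
    then show ?case
    proof (rule Lim_transform_eventually)
      show "\<forall>\<^sub>F n in sequentially. (s n - k n * (\<integral>w. R n (\<omega>, w) \<partial>P\<^sub>0)) / q n + s0 n / q n + k n * m n / q n =
          (\<Sum>i\<in>split.I1 n \<omega>. score (W i \<omega>) \<theta>\<^sub>0 (\<eta>t n \<omega>)) / sqrt (real n * ln (real n))"
        using mean
      proof eventually_elim
        case (elim n)
        have "s n + s0 n = (\<Sum>i\<in>split.I1 n \<omega>. score (W i \<omega>) \<theta>\<^sub>0 (\<eta>t n \<omega>))"
          unfolding s_def s0_def R_def by (simp flip: sum.distrib)
        then show ?case unfolding elim q_def[symmetric] by (simp add: diff_divide_distrib add_divide_distrib flip: add_divide_distrib)
      qed
    qed
  qed
qed

text \<open>The score at \<open>\<theta>h n\<close> is the score at \<open>\<theta>\<^sub>0\<close>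
  minus the error times the slope, and the slope is at most \<open>n powr (2/5)\<close> in absolute
  value, whence the exponent 4/5. The other folds served for training; their squares are bounded
  below by 0.\<close>

lemma sigma_hat_ge:
  fixes \<omega>
  defines "b i n \<equiv> score (W i \<omega>) 0 (\<eta>h n \<omega>) - score (W i \<omega>) 1 (\<eta>h n \<omega>)"
  assumes n: "n \<ge> 1" and K: "K \<ge> 1" and b: "\<And>i. i \<in> split.I1 n \<omega> \<Longrightarrow> \<bar>b i n\<bar> \<le> real n powr (2/5)"
  shows "(\<Sum>i\<in>split.I1 n \<omega>. min 1 ((score (W i \<omega>) \<theta>\<^sub>0 (\<eta>h n \<omega>))\<^sup>2)) / 2 - real n * (\<theta>h n \<omega> - \<theta>\<^sub>0)\<^sup>2 * real n powr (4/5)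
    \<le> real n * (sigma_hat W K \<kappa> \<eta>h \<theta>h n \<omega>)\<^sup>2"
proof -
  define e where "e = \<theta>h n \<omega> - \<theta>\<^sub>0"
  define sc where "sc i = score (W i \<omega>) \<theta>\<^sub>0 (\<eta>h n \<omega>)" for i
  define L where "L = e\<^sup>2 * real n powr (4/5)"
  have L0: "L \<ge> 0" by (simp add: L_def)
  have summand: "min 1 ((sc i)\<^sup>2) / 2 - L \<le> (score (W i \<omega>) (\<theta>h n \<omega>) (\<eta>h n \<omega>))\<^sup>2" if i: "i \<in> split.I1 n \<omega>" for i
  proof -
    \<comment> \<open>Half of \<open>0 \<le> (u - 2 * v)\<^sup>2\<close>: the cross term disappears
      at the price of the factor 1/2.\<close>
    have sq: "(u - v)\<^sup>2 \<ge> u\<^sup>2 / 2 - v\<^sup>2" for u v :: real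
      using zero_le_power2[of "u - 2 * v"] by (simp add: power2_eq_square algebra_simps)
    have "(b i n)\<^sup>2 \<le> (real n powr (2/5))\<^sup>2"
      using b[OF i] by (metis abs_ge_zero power2_abs power_mono)
    also have "\<dots> = real n powr (4/5)" using n by (simp add: powr_power)
    finally have "(e * b i n)\<^sup>2 \<le> L" unfolding L_def power_mult_distrib by (intro mult_left_mono) auto
    moreover have "min 1 ((sc i)\<^sup>2) \<le> (sc i)\<^sup>2" by simp
    moreover have eq: "score (W i \<omega>) (\<theta>h n \<omega>) (\<eta>h n \<omega>) = sc i - e * b i n"
      unfolding sc_def e_def b_def by (rule score_affine)
    ultimately show ?thesis unfolding eq using sq[of "sc i" "e * b i n"] by linarith
  qed
  have k: "real (card (split.I1 n \<omega>)) \<le> real n"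
    using card_fold_set_le by simp
  define T where "T k = (\<Sum>i\<in>fold_set \<kappa> n k \<omega>. (score (W i \<omega>) (\<theta>h n \<omega>) (\<eta>h n \<omega>))\<^sup>2)" for k
  have T0: "T k \<ge> 0" for k unfolding T_def by (intro sum_nonneg) auto
  have "(\<Sum>i\<in>split.I1 n \<omega>. min 1 ((sc i)\<^sup>2)) / 2 - real n * L \<le>
      (\<Sum>i\<in>split.I1 n \<omega>. min 1 ((sc i)\<^sup>2)) / 2 - real (card (split.I1 n \<omega>)) * L"
    using mult_right_mono[OF k L0] by simp
  also have "\<dots> = (\<Sum>i\<in>split.I1 n \<omega>. min 1 ((sc i)\<^sup>2) / 2 - L)"
    by (simp add: sum_subtractf sum_divide_distrib)
  also have "\<dots> \<le> T 1" unfolding T_def by (intro sum_mono summand)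
  also have "\<dots> \<le> (\<Sum>k = 1..K. T k)" using K T0 by (intro member_le_sum) auto
  also have "\<dots> = real n * (sigma_hat W K \<kappa> \<eta>h \<theta>h n \<omega>)\<^sup>2"
    using n T0 by (simp add: sigma_hat_def T_def[symmetric] sum_nonneg)
  finally show ?thesis by (simp add: sc_def L_def e_def mult.assoc)
qed

lemma measurable_sigma_hat:
  assumes n: "n \<ge> 1"
  shows "sigma_hat W K \<kappa> \<eta>h \<theta>h n \<in> borel_measurable M"
proof -
  have eq: "\<eta>h n \<omega> = \<eta>t n \<omega>" for \<omega> using n by (simp add: \<eta>t_def)
  have sc: "(\<lambda>\<omega>. score (W i \<omega>) \<theta> (\<eta>t n \<omega>)) \<in> borel_measurable M" if "i \<ge> 1" for i \<theta>
  proof -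
    note [measurable] = split.rv_W[OF that] split.id_train[of n]
    have "(\<lambda>\<omega>. (\<omega>, W i \<omega>)) \<in> measurable M (split.train n \<Otimes>\<^sub>M obs_space MX)" by measurable
    from measurable_compose[OF this measurable_score_train] show ?thesis by simp
  qed
  have sc': "(\<lambda>\<omega>. score (W i \<omega>) (\<theta>h n \<omega>) (\<eta>t n \<omega>)) \<in> borel_measurable M" if "i \<ge> 1" for i
  proof -
    note [measurable] = sc[OF that] rv_theta_hat[OF n]
    \<comment> \<open>\<open>\<theta>h n\<close> is random, so the score is expanded around the
      fixed parameter 0, where measurability is known.\<close>
    show ?thesis by (subst score_affine[where \<theta>'=0]) measurable
  qed
  have S: "(\<Sum>i\<in>fold_set \<kappa> n k \<omega>. (score (W i \<omega>) (\<theta>h n \<omega>) (\<eta>h n \<omega>))\<^sup>2) =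
      (\<Sum>i\<in>{1..n}. if \<kappa> i \<omega> = k then (score (W i \<omega>) (\<theta>h n \<omega>) (\<eta>t n \<omega>))\<^sup>2 else 0)" for k \<omega>
    unfolding eq fold_set_def by (rule sum.inter_filter) simp
  have "(\<lambda>\<omega>. if \<kappa> i \<omega> = k then (score (W i \<omega>) (\<theta>h n \<omega>) (\<eta>t n \<omega>))\<^sup>2 else 0) \<in> borel_measurable M"
    if i: "i \<in> {1..n}" for i k
  proof -
    have "i \<ge> 1" using i by simp
    note [measurable] = sc'[OF this] rv_label[OF this]
    show ?thesis by measurable
  qed
  then have "(\<lambda>\<omega>. \<Sum>k = 1..K. \<Sum>i\<in>{1..n}. if \<kappa> i \<omega> = k then (score (W i \<omega>) (\<theta>h n \<omega>) (\<eta>t n \<omega>))\<^sup>2 else 0) \<in> borel_measurable M"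
    by (intro borel_measurable_sum)
  then show ?thesis
    unfolding sigma_hat_def[abs_def] S by measurable
qed

lemma AE_error_le_width:
  assumes \<alpha>: "0 < \<alpha>" "\<alpha> < 1" and \<rho>: "\<rho> > 0"
  shows "AE \<omega> in M. \<forall>\<^sub>F n in sequentially.
    \<bar>\<theta>h n \<omega> - \<theta>\<^sub>0\<bar> \<le> sigma_hat W K \<kappa> \<eta>h \<theta>h n \<omega> * half_width \<alpha> \<rho> n"
proof -
  note K = K_ge_1
  define D where "D = (\<integral>\<omega>. m_t \<eta>\<^sub>0 (X \<omega>) - m_c \<eta>\<^sub>0 (X \<omega>) \<partial>M) / real K"
  have D: "D > 0" using compliance c K by (simp add: D_def)
  have v: "(\<integral>w. min 1 ((score w \<theta>\<^sub>0 \<eta>\<^sub>0)\<^sup>2) \<partial>P\<^sub>0) / real K > 0"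
    using truncated_variance_pos K by simp
  show ?thesis
    using AE_numerator AE_denominator AE_denominator_max AE_truncated_variance AE_space
  proof eventually_elim
    case (elim \<omega>)
    define a where "a n = (\<Sum>i\<in>split.I1 n \<omega>. score (W i \<omega>) \<theta>\<^sub>0 (\<eta>t n \<omega>))" for n
    define d where "d n = (\<Sum>i\<in>split.I1 n \<omega>. score (W i \<omega>) 0 (\<eta>t n \<omega>) - score (W i \<omega>) 1 (\<eta>t n \<omega>))" for n
    note lim = elim(1)[folded a_def] elim(2)[folded d_def D_def]
    have "\<forall>\<^sub>F n in sequentially. d n / real n > 0"
      by (rule order_tendstoD(1)[OF lim(2) D])
    \<comment> \<open>A nonzero slope makes the estimating equation solvable, which is the premise
      of \<open>theta_hat_solves\<close>, and rules out an empty first fold.\<close>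
    then have err: "\<forall>\<^sub>F n in sequentially. \<theta>h n \<omega> - \<theta>\<^sub>0 = a n / d n"
      using eventually_gt_at_top[of 0]
    proof eventually_elim
      case (elim n)
      have dn: "d n \<noteq> 0" using elim by auto
      have "finite (split.I1 n \<omega>)" by (simp add: fold_set_def)
      then have card: "card (split.I1 n \<omega>) > 0"
        using dn by (auto simp: d_def card_gt_0_iff)
      have eq: "\<eta>h n \<omega> = \<eta>t n \<omega>" using elim by (simp add: \<eta>t_def)
      have ms: "mean_score W (split.I1 n \<omega>) \<omega> \<theta> (\<eta>h n \<omega>) = (a n - (\<theta> - \<theta>\<^sub>0) * d n) / real (card (split.I1 n \<omega>))" for \<theta>
        unfolding mean_score_def eq a_def d_def
        by (subst score_affine[where \<theta>'=\<theta>\<^sub>0]) (simp add: sum_subtractf sum_distrib_left right_diff_distrib)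
      have "mean_score W (split.I1 n \<omega>) \<omega> (\<theta>\<^sub>0 + a n / d n) (\<eta>h n \<omega>) = 0"
        unfolding ms using dn by simp
      then have "mean_score W (split.I1 n \<omega>) \<omega> (\<theta>h n \<omega>) (\<eta>h n \<omega>) = 0"
        using theta_hat_solves[of n \<omega>] elim \<open>\<omega> \<in> space M\<close> by auto
      then show ?case unfolding ms using dn card by (simp add: field_simps)
    qed
    have sg: "\<forall>\<^sub>F n in sequentially. (\<Sum>i\<in>split.I1 n \<omega>. min 1 ((score (W i \<omega>) \<theta>\<^sub>0 (\<eta>t n \<omega>))\<^sup>2)) / 2 -
        real n * (\<theta>h n \<omega> - \<theta>\<^sub>0)\<^sup>2 * real n powr (4/5) \<le> real n * (sigma_hat W K \<kappa> \<eta>h \<theta>h n \<omega>)\<^sup>2"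
      using elim(3) eventually_gt_at_top[of 0]
    proof eventually_elim
      case (elim n)
      have eq: "\<eta>t n \<omega> = \<eta>h n \<omega>" using elim by (simp add: \<eta>t_def)
      show ?case using sigma_hat_ge[of n \<omega>] elim K unfolding eq by simp
    qed
    show ?case
      by (rule eventually_error_le_width[OF lim _ elim(4) v err sg _ \<alpha> \<rho>]) (use D in \<open>auto simp: sigma_hat_def sum_nonneg\<close>)
  qed
qed

end

section \<open>The confidence sequence\<close>

theorem theorem5p1:
  fixes M :: "'w measure" and MX :: "'x measure" and MU :: "'u measure"
    and Ypot :: "bool \<Rightarrow> 'w \<Rightarrow> real" and Apot :: "bool \<Rightarrow> 'w \<Rightarrow> bool"
    and Y :: "'w \<Rightarrow> real" and A Z :: "'w \<Rightarrow> bool"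
    and X :: "'w \<Rightarrow> 'x" and U :: "'w \<Rightarrow> 'u"
    and \<eta>\<^sub>0 :: "'x nuisance" and \<theta>\<^sub>0 :: real
    and W :: "nat \<Rightarrow> 'w \<Rightarrow> 'x obs" and K :: nat and \<kappa> :: "nat \<Rightarrow> 'w \<Rightarrow> nat"
    and \<eta>h :: "nat \<Rightarrow> 'w \<Rightarrow> 'x nuisance" and \<theta>h :: "nat \<Rightarrow> 'w \<Rightarrow> real"
    and q C\<^sub>q \<epsilon> c \<delta> \<alpha> \<rho> :: real
  assumes setting: "iv_split_sample M MX MU Ypot Apot Y A Z X U \<eta>\<^sub>0 \<theta>\<^sub>0 W K \<kappa> \<eta>h \<theta>h"
    and alpha: "0 < \<alpha>" "\<alpha> < 1"
    and regularity: "q \<ge> 4"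
      "\<And>a. (\<integral>\<^sup>+ \<omega>. ennreal (\<bar>Ypot a \<omega>\<bar> powr q) \<partial>M) \<le> ennreal C\<^sub>q"
    and boundedness: "\<epsilon> > 0"
      "AE \<omega> in M. propensity \<eta>\<^sub>0 (X \<omega>) \<in> {\<epsilon>..1 - \<epsilon>}"
      "Lp_norm (distr M MX X) q (g_t \<eta>\<^sub>0) < \<infinity>" "Lp_norm (distr M MX X) q (g_c \<eta>\<^sub>0) < \<infinity>"
    and identification: "c > 0"
      "(\<integral>\<omega>. m_t \<eta>\<^sub>0 (X \<omega>) - m_c \<eta>\<^sub>0 (X \<omega>) \<partial>M) \<ge> c"
    and strong_consistency:
      "AE \<omega> in M. (\<lambda>n. Lp_norm (distr M MX X) 2 (\<lambda>x. \<eta>h n \<omega> x - \<eta>\<^sub>0 x)) \<longlonglongrightarrow> 0"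
      "AE \<omega> in M. AE x in distr M MX X. (\<lambda>n. \<eta>h n \<omega> x) \<longlonglongrightarrow> \<eta>\<^sub>0 x"
      "AE \<omega> in M. \<exists>B::real. \<forall>\<^sub>F n in sequentially. Linf_norm (distr M MX X) (\<lambda>x. \<eta>h n \<omega> x - \<eta>\<^sub>0 x) \<le> ennreal B"
    and rate:
      "AE \<omega> in M.
         (\<lambda>n. enn2real (Lp_norm (distr M MX X) 2 (\<lambda>x. propensity (\<eta>h n \<omega>) x - propensity \<eta>\<^sub>0 x) *
            ((Lp_norm (distr M MX X) 2 (\<lambda>x. g_t (\<eta>h n \<omega>) x - g_t \<eta>\<^sub>0 x) +
              Lp_norm (distr M MX X) 2 (\<lambda>x. g_c (\<eta>h n \<omega>) x - g_c \<eta>\<^sub>0 x)) +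
             (Lp_norm (distr M MX X) 2 (\<lambda>x. m_t (\<eta>h n \<omega>) x - m_t \<eta>\<^sub>0 x) +
              Lp_norm (distr M MX X) 2 (\<lambda>x. m_c (\<eta>h n \<omega>) x - m_c \<eta>\<^sub>0 x)))))
         \<in> o(\<lambda>n. sqrt (ln (ln (real n)) / real n))"
    and estimated_overlap: "\<delta> > 0"
      "AE \<omega> in M. \<forall>\<^sub>F n in sequentially. AE x in distr M MX X.
         propensity (\<eta>h n \<omega>) x \<in> {\<delta>..1 - \<delta>}"
    and nondegenerate:
      "(\<integral>\<omega>. (score (Y \<omega>, A \<omega>, Z \<omega>, X \<omega>) \<theta>\<^sub>0 \<eta>\<^sub>0)\<^sup>2 \<partial>M) > 0"
    and rho: "\<rho> > 0"
  shows "asymptotic_confseq M \<alpha> \<theta>\<^sub>0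
     (\<lambda>n \<omega>. \<theta>h n \<omega> - sigma_hat W K \<kappa> \<eta>h \<theta>h n \<omega> * half_width \<alpha> \<rho> n)
     (\<lambda>n \<omega>. \<theta>h n \<omega> + sigma_hat W K \<kappa> \<eta>h \<theta>h n \<omega> * half_width \<alpha> \<rho> n)"
proof -
  interpret iv_split_sample M MX MU Ypot Apot Y A Z X U \<eta>\<^sub>0 \<theta>\<^sub>0 W K \<kappa> \<eta>h \<theta>h by (rule setting)
  interpret iv_asymptotics M MX MU Ypot Apot Y A Z X U \<eta>\<^sub>0 \<theta>\<^sub>0 W K \<kappa> \<eta>h \<theta>h q C\<^sub>q \<epsilon> c \<delta>
    by unfold_locales (fact regularity boundedness identification strong_consistency rate estimated_overlap nondegenerate)+
  let ?L = "\<lambda>n \<omega>. \<theta>h n \<omega> - sigma_hat W K \<kappa> \<eta>h \<theta>h n \<omega> * half_width \<alpha> \<rho> n"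
  let ?U = "\<lambda>n \<omega>. \<theta>h n \<omega> + sigma_hat W K \<kappa> \<eta>h \<theta>h n \<omega> * half_width \<alpha> \<rho> n"
  note cover = AE_error_le_width[OF alpha rho]
  show ?thesis
    unfolding asymptotic_confseq_def
  proof (rule exI[of _ "\<lambda>n \<omega>. min \<theta>\<^sub>0 (?L n \<omega>)"], rule exI[of _ "\<lambda>n \<omega>. max \<theta>\<^sub>0 (?U n \<omega>)"],
      intro conjI allI impI)
    fix n :: nat assume n: "1 \<le> n"
    note [measurable] = measurable_sigma_hat[OF n] rv_theta_hat[OF n]
    show "(\<lambda>\<omega>. min \<theta>\<^sub>0 (?L n \<omega>)) \<in> borel_measurable M" "(\<lambda>\<omega>. max \<theta>\<^sub>0 (?U n \<omega>)) \<in> borel_measurable M"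
      by measurable
  next
    have "{\<omega> \<in> space M. \<forall>n\<ge>1. \<theta>\<^sub>0 \<in> {min \<theta>\<^sub>0 (?L n \<omega>)..max \<theta>\<^sub>0 (?U n \<omega>)}} = space M" by auto
    then show "1 - \<alpha> \<le> measure M {\<omega> \<in> space M. \<forall>n\<ge>1. \<theta>\<^sub>0 \<in> {min \<theta>\<^sub>0 (?L n \<omega>)..max \<theta>\<^sub>0 (?U n \<omega>)}}"
      using alpha by (simp add: prob_space)
  next
    \<comment> \<open>The endpoints agree from some \<open>n\<close> on, so the equivalence holds
      even where an endpoint vanishes.\<close>
    show "AE \<omega> in M. (\<lambda>n. min \<theta>\<^sub>0 (?L n \<omega>)) \<sim>[sequentially] (\<lambda>n. ?L n \<omega>)"
      using cover
    proof eventually_elim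
      case (elim \<omega>)
      show ?case
        by (rule asymp_equiv_refl_ev, rule eventually_mono[OF elim]) (auto simp: abs_le_iff min_def)
    qed
    show "AE \<omega> in M. (\<lambda>n. max \<theta>\<^sub>0 (?U n \<omega>)) \<sim>[sequentially] (\<lambda>n. ?U n \<omega>)"
      using cover
    proof eventually_elim
      case (elim \<omega>)
      show ?case
        by (rule asymp_equiv_refl_ev, rule eventually_mono[OF elim]) (auto simp: abs_le_iff max_def)
    qed
  qed
qed

end
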